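(* Let $\Omega\subseteq\mathbb{R}^d$ be open. Then: (i) $(E_\Omega\circ L_\Omega)(f)=\sigma_\Omega(f)$ for all $f\in\mathcal{E}(\Omega)$. Consequently $\mathcal{E}(\Omega)$ and $(E_\Omega\circ L_\Omega)[\mathcal{E}(\Omega)]$ are isomorphic differential algebras over $\mathbb{C}$; moreover $\int_\Omega f(x)\tau(x)\,dx=(\sigma_\Omega(f)|\tau)=((E_\Omega\circ L_\Omega)(f)|\tau)$ for all $f\in\mathcal{E}(\Omega)$, $\tau\in\mathcal{D}(\Omega)$, and $E_\Omega\circ L_\Omega=\sigma_\Omega$ is injective on $\mathcal{E}(\Omega)$. (ii) $E_\Omega$ is $\mathbb{C}$-linear, satisfies $E_\Omega(\partial^\alpha T)=\partial^\alpha E_\Omega(T)$ for all $T\in\mathcal{D}'(\Omega)$, $\alpha\in\mathbb{N}_0^d$, and $(T|\tau)=(E_\Omega(T)|\tau)$ for all $T\in\mathcal{D}'(\Omega)$, $\tau\in\mathcal{D}(\Omega)$; consequently $E_\Omega$ is injective. (iii) $E_\Omega\circ L_\Omega$ is $\mathbb{C}$-linear on $\mathcal{L}_{loc}(\Omega)$ and $\int_\Omega f(x)\tau(x)\,dx=((E_\Omega\circ L_\Omega)(f)|\tau)$ for all $f\in\mathcal{L}_{loc}(\Omega)$, $\tau\in\mathcal{D}(\Omega)$; consequently $E_\Omega\circ L_\Omega$ is injective. (iv) Each of $\sigma_\Omega$, $E_\Omega$, $E_\Omega\circ L_\Omega$ preserves restriction to open subsets: for every open $\mathcal{O}\subseteq\Omega$,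 $\sigma_\Omega(f)\restriction\mathcal{O}=\sigma_{\mathcal{O}}(f\restriction\mathcal{O})$, $E_\Omega(T)\restriction\mathcal{O}=E_{\mathcal{O}}(T\restriction\mathcal{O})$ and $(E_\Omega\circ L_\Omega)(g)\restriction\mathcal{O}=(E_{\mathcal{O}}\circ L_{\mathcal{O}})(g\restriction\mathcal{O})$.
   Context: Fix $\mathcal{D}_0=\mathcal{D}(\mathbb{R}^d)$. For $\varphi\in\mathcal{D}_0$ let $R_\varphi=\sup\{\|x\|:\varphi(x)\neq0\}$ if $\varphi\neq0$, $R_0=1$. For $n\in\mathbb{N}$, $\mathcal{D}_n$ is the set of $\varphi\in\mathcal{D}_0$ that are real-valued, even, with $R_\varphi\le1/n$, $\int\varphi=1$, $\int x^\alpha\varphi(x)dx=0$ for $1\le|\alpha|\le n$, $\int|\varphi|\le1+1/n$, and $\sup_x|\partial^\alpha\varphi(x)|\le R_\varphi^{-2(|\alpha|+d)}$ for $|\alpha|\le n$. $\mathcal{U}$ is a fixed free ultrafilter on $\mathcal{D}_0$ containing every $\mathcal{D}_n$ (and $\mathfrak c^+$-good, $\mathfrak c=\mathrm{card}\,\mathbb{R}$); "$P(\varphi)$ a.e." means $\{\varphi:P(\varphi)\}\in\mathcal{U}$. Asymptotic numbers: $\widehat{\mathbb{C}^{\mathcal{D}_0}}$ is the ring of nets $(A_\varphi)\in\mathbb{C}^{\mathcal{D}_0}$ with $|A_\varphi|\le R_\varphi^{-m}$ a.e. for some $m$, modulo nets with $|A_\varphi|<R_\varphi^p$ a.e. for all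 $p\in\mathbb{N}$ (it is a field; $\mathbb{C}$ embeds by constant nets). Asymptotic functions: $\mathcal{E}(\Omega)=C^\infty(\Omega;\mathbb{C})$. $\mathcal{M}(\mathcal{E}(\Omega)^{\mathcal{D}_0})$: nets $(f_\varphi)$ in $\mathcal{E}(\Omega)$ such that for all compact $K\subset\Omega$, $\alpha\in\mathbb{N}_0^d$ there is $m$ with $\sup_K|\partial^\alpha f_\varphi|\le R_\varphi^{-m}$ a.e.; $\mathcal{N}(\mathcal{E}(\Omega)^{\mathcal{D}_0})$: nets such that for all $K,\alpha$ and all $p\in\mathbb{N}$, $\sup_K|\partial^\alpha f_\varphi|\le R_\varphi^{p}$ a.e. $\widehat{\mathcal{E}(\Omega)^{\mathcal{D}_0}}=\mathcal{M}/\mathcal{N}$, a differential algebra over $\widehat{\mathbb{C}^{\mathcal{D}_0}}$ with operations and derivatives $\partial^\alpha\widehat{f_\varphi}=\widehat{\partial^\alpha f_\varphi}$ taken pointwise in $\varphi$. Pairing: $(\widehat{f_\varphi}|\tau)$ is the class of $(\int_\Omega f_\varphi\tau\,dx)_\varphi$ for $\tau\in\mathcal{D}(\Omega)$. Restriction: $\widehat{f_\varphi}\restriction\mathcal{O}=\widehat{f_\varphi\restriction\mathcal{O}}$. Regularization: $\widetilde\Omega_\varphi=\{x\in\Omega: d(x,\partial\Omega)>2R_\varphi,\ \|x\|<1/R_\varphi\}$, $C_{\Omega,\varphi}(x)=\int_{\widetilde\Omega_\varphi}\varphi(x-t)\,dt$, $(T\circledast\varphi)(x)=(T(t)\,|\,C_{\Omega,\varphi}(t)\varphi(x-t))$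 for $T\in\mathcal{D}'(\Omega)$, $x\in\Omega$. Embeddings: $\sigma_\Omega(f)=\widehat{f}$ (class of the constant net) for $f\in\mathcal{E}(\Omega)$; $E_\Omega(T)=\widehat{T\circledast\varphi}$ for $T\in\mathcal{D}'(\Omega)$; $L_\Omega:\mathcal{L}_{loc}(\Omega)\to\mathcal{D}'(\Omega)$ is the Schwartz embedding $f\mapsto T_f$, $(T_f|\tau)=\int_\Omega f\tau$. Complex numbers such as $(T|\tau)$ are regarded as elements of $\widehat{\mathbb{C}^{\mathcal{D}_0}}$. *)

theory Defs
  imports "HOL-Analysis.Analysis"
begin

text \<open>Points of R^d are vectors of type real^'n, d = CARD('n).
  Functions on an open set are represented as total functions real^'n => complex,
  only their values on the set matter.\<close>

type_synonym 'n cfun = "real^'n \<Rightarrow> complex"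
type_synonym 'n mindex = "'n \<Rightarrow> nat"

definition mdeg :: "'n::finite mindex \<Rightarrow> nat" where
  "mdeg \<alpha> = (\<Sum>i\<in>UNIV. \<alpha> i)"

definition mmono :: "'n::finite mindex \<Rightarrow> real^'n \<Rightarrow> real" where
  "mmono \<alpha> x = (\<Prod>i\<in>UNIV. (x $ i) ^ (\<alpha> i))"

definition pd :: "'n::finite \<Rightarrow> 'n cfun \<Rightarrow> 'n cfun" where
  "pd i f x = vector_derivative (\<lambda>t::real. f (x + t *\<^sub>R axis i 1)) (at 0)"

definition pds :: "'n::finite list \<Rightarrow> 'n cfun \<Rightarrow> 'n cfun" where
  "pds xs f = foldr pd xs f"

text \<open>multi-index derivative: iterate partial derivatives (order irrelevant for smooth f)\<close>
definition mpd :: "'n::finite mindex \<Rightarrow> 'n cfun \<Rightarrow> 'n cfun" where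
  "mpd \<alpha> f = pds (SOME xs. \<forall>i. count_list xs i = \<alpha> i) f"

definition smooth_on :: "(real^'n::finite) set \<Rightarrow> 'n cfun \<Rightarrow> bool" where
  "smooth_on \<Omega> f \<longleftrightarrow> (\<forall>xs. continuous_on \<Omega> (pds xs f) \<and>
     (\<forall>x\<in>\<Omega>. \<forall>i. ((\<lambda>t. pds xs f (x + t *\<^sub>R axis i 1)) has_vector_derivative pds (i # xs) f x) (at 0)))"

definition tsupp :: "'n::finite cfun \<Rightarrow> (real^'n) set" where
  "tsupp f = closure {x. f x \<noteq> 0}"

definition test_fun :: "(real^'n::finite) set \<Rightarrow> 'n cfun \<Rightarrow> bool" where
  "test_fun \<Omega> \<tau> \<longleftrightarrow> smooth_on UNIV \<tau> \<and> compact (tsupp \<tau>) \<and> tsupp \<tau> \<subseteq> \<Omega>"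

definition distribution :: "(real^'n::finite) set \<Rightarrow> ('n cfun \<Rightarrow> complex) \<Rightarrow> bool" where
  "distribution \<Omega> T \<longleftrightarrow>
     (\<forall>\<tau>1 \<tau>2 a b. test_fun \<Omega> \<tau>1 \<longrightarrow> test_fun \<Omega> \<tau>2 \<longrightarrow>
        T (\<lambda>x. a * \<tau>1 x + b * \<tau>2 x) = a * T \<tau>1 + b * T \<tau>2) \<and>
     (\<forall>K. compact K \<and> K \<subseteq> \<Omega> \<longrightarrow> (\<exists>C m. \<forall>\<tau> B. test_fun \<Omega> \<tau> \<longrightarrow> tsupp \<tau> \<subseteq> K \<longrightarrow>
        (\<forall>\<alpha> x. mdeg \<alpha> \<le> m \<longrightarrow> norm (mpd \<alpha> \<tau> x) \<le> B) \<longrightarrow> norm (T \<tau>) \<le> C * B))"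

definition dderiv :: "'n::finite mindex \<Rightarrow> ('n cfun \<Rightarrow> complex) \<Rightarrow> ('n cfun \<Rightarrow> complex)" where
  "dderiv \<alpha> T \<tau> = (-1) ^ mdeg \<alpha> * T (mpd \<alpha> \<tau>)"

definition loc_int :: "(real^'n::finite) set \<Rightarrow> 'n cfun \<Rightarrow> bool" where
  "loc_int \<Omega> f \<longleftrightarrow> (\<forall>K. compact K \<and> K \<subseteq> \<Omega> \<longrightarrow> f absolutely_integrable_on K)"

definition Lemb :: "(real^'n::finite) set \<Rightarrow> 'n cfun \<Rightarrow> ('n cfun \<Rightarrow> complex)" where
  "Lemb \<Omega> f \<tau> = integral \<Omega> (\<lambda>x. f x * \<tau> x)"

definition Rad :: "'n::finite cfun \<Rightarrow> real" where
  "Rad \<phi> = (if \<phi> = (\<lambda>_. 0) then 1 else Sup (norm ` {x. \<phi> x \<noteq> 0}))"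

definition Dn :: "nat \<Rightarrow> ('n::finite cfun) set" where
  "Dn n = {\<phi>. test_fun UNIV \<phi> \<and> (\<forall>x. Im (\<phi> x) = 0) \<and> (\<forall>x. \<phi> (- x) = \<phi> x) \<and>
     Rad \<phi> \<le> 1 / real n \<and> integral UNIV \<phi> = 1 \<and>
     (\<forall>\<alpha>. 1 \<le> mdeg \<alpha> \<and> mdeg \<alpha> \<le> n \<longrightarrow> integral UNIV (\<lambda>x. complex_of_real (mmono \<alpha> x) * \<phi> x) = 0) \<and>
     integral UNIV (\<lambda>x. norm (\<phi> x)) \<le> 1 + 1 / real n \<and>
     (\<forall>\<alpha> x. mdeg \<alpha> \<le> n \<longrightarrow> norm (mpd \<alpha> \<phi> x) \<le> inverse (Rad \<phi>) ^ (2 * (mdeg \<alpha> + CARD('n))))}"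

text \<open>the ultrafilter U on D_0 (as a filter on the function type containing D_0)\<close>
definition in_U :: "'a filter \<Rightarrow> 'a set \<Rightarrow> bool" where
  "in_U U S \<longleftrightarrow> eventually (\<lambda>x. x \<in> S) U"

text \<open>kappa-good for kappa = c^+: index sets of cardinality at most c are subsets of the reals\<close>
definition cplus_good :: "'a filter \<Rightarrow> bool" where
  "cplus_good U \<longleftrightarrow> (\<forall>(I::real set) f.
     (\<forall>A. finite A \<and> A \<subseteq> I \<longrightarrow> in_U U (f A)) \<and>
     (\<forall>A B. finite B \<and> B \<subseteq> I \<and> A \<subseteq> B \<longrightarrow> f B \<subseteq> f A) \<longrightarrow>
     (\<exists>g. (\<forall>A. finite A \<and> A \<subseteq> I \<longrightarrow> in_U U (g A) \<and> g A \<subseteq> f A) \<and>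
          (\<forall>A B. finite A \<and> A \<subseteq> I \<and> finite B \<and> B \<subseteq> I \<longrightarrow> g (A \<union> B) = g A \<inter> g B)))"

definition admissible_U :: "('n::finite cfun) filter \<Rightarrow> bool" where
  "admissible_U U \<longleftrightarrow> U \<noteq> bot \<and> (\<forall>P. eventually P U \<or> eventually (\<lambda>x. \<not> P x) U) \<and>
     (\<forall>\<phi>. \<not> eventually (\<lambda>\<psi>. \<psi> = \<phi>) U) \<and>
     (\<forall>n\<ge>1. in_U U (Dn n)) \<and> cplus_good U"

definition mod_num :: "('n::finite cfun) filter \<Rightarrow> ('n cfun \<Rightarrow> complex) \<Rightarrow> bool" where
  "mod_num U A \<longleftrightarrow> (\<exists>m::nat. eventually (\<lambda>\<phi>. norm (A \<phi>) \<le> inverse (Rad \<phi>) ^ m) U)"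

definition negl_num :: "('n::finite cfun) filter \<Rightarrow> ('n cfun \<Rightarrow> complex) \<Rightarrow> bool" where
  "negl_num U A \<longleftrightarrow> (\<forall>p::nat. p \<ge> 1 \<longrightarrow> eventually (\<lambda>\<phi>. norm (A \<phi>) < Rad \<phi> ^ p) U)"

definition mod_fun :: "('n::finite cfun) filter \<Rightarrow> (real^'n) set \<Rightarrow> ('n cfun \<Rightarrow> 'n cfun) \<Rightarrow> bool" where
  "mod_fun U \<Omega> f \<longleftrightarrow> (\<forall>\<phi>. test_fun UNIV \<phi> \<longrightarrow> smooth_on \<Omega> (f \<phi>)) \<and>
     (\<forall>K \<alpha>. compact K \<and> K \<subseteq> \<Omega> \<longrightarrow>
        (\<exists>m::nat. eventually (\<lambda>\<phi>. \<forall>x\<in>K. norm (mpd \<alpha> (f \<phi>) x) \<le> inverse (Rad \<phi>) ^ m) U))"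

definition negl_fun :: "('n::finite cfun) filter \<Rightarrow> (real^'n) set \<Rightarrow> ('n cfun \<Rightarrow> 'n cfun) \<Rightarrow> bool" where
  "negl_fun U \<Omega> f \<longleftrightarrow> (\<forall>\<phi>. test_fun UNIV \<phi> \<longrightarrow> smooth_on \<Omega> (f \<phi>)) \<and>
     (\<forall>K \<alpha> p::nat. compact K \<and> K \<subseteq> \<Omega> \<and> p \<ge> 1 \<longrightarrow>
        eventually (\<lambda>\<phi>. \<forall>x\<in>K. norm (mpd \<alpha> (f \<phi>) x) \<le> Rad \<phi> ^ p) U)"

text \<open>equality in the quotient algebra\<close>
definition fun_eq :: "('n::finite cfun) filter \<Rightarrow> (real^'n) set \<Rightarrow> ('n cfun \<Rightarrow> 'n cfun) \<Rightarrow> ('n cfun \<Rightarrow> 'n cfun) \<Rightarrow> bool" where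
  "fun_eq U \<Omega> f g \<longleftrightarrow> negl_fun U \<Omega> (\<lambda>\<phi> x. f \<phi> x - g \<phi> x)"

definition pairing :: "(real^'n::finite) set \<Rightarrow> ('n cfun \<Rightarrow> 'n cfun) \<Rightarrow> 'n cfun \<Rightarrow> ('n cfun \<Rightarrow> complex)" where
  "pairing \<Omega> f \<tau> \<phi> = integral \<Omega> (\<lambda>x. f \<phi> x * \<tau> x)"

text \<open>regularization; d(x, boundary) = infinity when the boundary is empty\<close>
definition Omega_t :: "(real^'n::finite) set \<Rightarrow> 'n cfun \<Rightarrow> (real^'n) set" where
  "Omega_t \<Omega> \<phi> = {x\<in>\<Omega>. (frontier \<Omega> = {} \<or> infdist x (frontier \<Omega>) > 2 * Rad \<phi>) \<and> norm x < 1 / Rad \<phi>}"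

definition Cut :: "(real^'n::finite) set \<Rightarrow> 'n cfun \<Rightarrow> 'n cfun" where
  "Cut \<Omega> \<phi> x = integral (Omega_t \<Omega> \<phi>) (\<lambda>t. \<phi> (x - t))"

definition conv :: "(real^'n::finite) set \<Rightarrow> ('n cfun \<Rightarrow> complex) \<Rightarrow> 'n cfun \<Rightarrow> 'n cfun" where
  "conv \<Omega> T \<phi> x = T (\<lambda>t. Cut \<Omega> \<phi> t * \<phi> (x - t))"

text \<open>E_Omega(T) is represented by the net phi |-> T circledast phi\<close>
definition Emb :: "(real^'n::finite) set \<Rightarrow> ('n cfun \<Rightarrow> complex) \<Rightarrow> ('n cfun \<Rightarrow> 'n cfun)" where
  "Emb \<Omega> T = conv \<Omega> T"

definition sig :: "'n::finite cfun \<Rightarrow> ('n cfun \<Rightarrow> 'n cfun)" where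
  "sig f = (\<lambda>\<phi>. f)"

end

theory Submission
  imports Defs "HOL-Library.Multiset"
begin

text \<open>
  Everything reduces to two facts about \<open>\<phi> \<in> D\<^sub>n\<close>. First, on a neighbourhood of a compact
  subset of \<open>\<Omega>\<close> the cut-off equals 1 once \<open>n\<close> is large, so there the regularization is simply
  \<open>x \<mapsto> T(\<phi>(x - \<cdot>))\<close>; this gives moderateness (from the bounds on the derivatives of \<open>\<phi>\<close>), the
  commutation with derivatives and the compatibility with restrictions. Second, Taylor's formula and the
  vanishing moments give \<open>\<bar>\<phi> * \<tau> - \<tau>\<bar> \<le> M R\<^sup>p\<close> for test functions \<open>\<tau>\<close> and all \<open>p \<le> n\<close>. For smooth
  \<open>f\<close>, cut off near a compact set, this is (i). For a distribution one first moves \<open>T\<close> out of the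
  integral \<open>\<integral> T(\<phi>(x - \<cdot>)) \<tau>(x) dx = T(\<phi> * \<tau>)\<close> (Riemann sums) and then applies the estimate to all
  derivatives of \<open>\<tau>\<close>, which gives the pairing and hence the injectivity statements; for locally integrable
  functions injectivity needs in addition that a function annihilating all test functions vanishes
  almost everywhere.

  Iterated derivatives are indexed by words \<open>w\<close> rather than multi-indices, so that Leibniz and Taylor
  have no binomial coefficients and derivatives of distributions need no reordering. The symmetry of
  second derivatives is needed only to differentiate under \<open>T\<close> and to read the bounds in
  \<open>D\<^sub>n\<close>.
\<close>

subsection \<open>Iterated partial derivatives\<close>

text \<open>Every estimate comes out as a constant times a power of \<open>Rad \<phi>\<close>,
  whereas moderateness and negligibility compare with bare powers. The estimates are therefore made
  one order higher than required, and the spare factor \<open>Rad \<phi>\<close>, which becomes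
  arbitrarily small along U, absorbs the constant. The same smallness forces a fixed number bounded
  by C * \<open>Rad \<phi>\<close> to be nonpositive, which is how injectivity is read off from
  infinitesimal differences.

  Negligibility concerns all derivatives, and an identity of nets valid only on a compact set says
  nothing about derivatives at its boundary. Such identities are proved on a compact neighbourhood,
  which contains an open set to differentiate in.

  The nets have to be smooth for every test function \<phi>, however large its radius, so the
  product of the cut-off with \<phi>(x - \<cdot>) must be a test function on \<Omega> in all cases;
  only the estimates may assume \<phi> \<in> \<open>Dn n\<close> for a suitable n.

  Moving T out of the pairing integral integrates the kernel over its other variable; the evenness
  of \<phi> is what turns the result into a convolution with \<phi> again.\<close>

lemma pds_simps [simp]: "pds [] f = f" "pds (i # w) f = pd i (pds w f)"
  by (simp_all add: pds_def)

lemma pds_append: "pds (u @ v) f = pds u (pds v f)"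
  by (simp add: pds_def)

lemma open_line_preimage:
  fixes \<Omega> :: "'a::real_normed_vector set"
  assumes "open \<Omega>"
  shows "open {t. x + t *\<^sub>R v \<in> \<Omega>}"
proof -
  have "open ((\<lambda>t. x + t *\<^sub>R v) -` \<Omega>)"
    by (intro open_vimage assms continuous_intros)
  then show ?thesis by (simp add: vimage_def)
qed

lemma line_derivative_cong:
  fixes x v :: "'a::real_normed_vector"
  assumes "open \<Omega>" "x \<in> \<Omega>" "\<And>y. y \<in> \<Omega> \<Longrightarrow> f y = g y"
    and "((\<lambda>t. f (x + t *\<^sub>R v)) has_vector_derivative d) (at 0)"
  shows "((\<lambda>t. g (x + t *\<^sub>R v)) has_vector_derivative d) (at 0)"
  using assms(4)
  by (rule has_vector_derivative_transform_within_open[where S = "{t. x + t *\<^sub>R v \<in> \<Omega>}"])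
     (use assms in \<open>simp_all add: open_line_preimage[simplified]\<close>)

text \<open>Every smoothness proof below exhibits the whole family of iterated partial derivatives at once.\<close>

lemma smooth_on_jet:
  assumes "open \<Omega>" and F0: "\<And>x. x \<in> \<Omega> \<Longrightarrow> F [] x = f x"
    and cont: "\<And>w. continuous_on \<Omega> (F w)"
    and der: "\<And>w i x. x \<in> \<Omega> \<Longrightarrow>
      ((\<lambda>t. F w (x + t *\<^sub>R axis i 1)) has_vector_derivative F (i # w) x) (at 0)"
  shows "smooth_on \<Omega> f" and "\<And>w x. x \<in> \<Omega> \<Longrightarrow> pds w f x = F w x"
proof -
  have eq: "pds w f x = F w x" if "x \<in> \<Omega>" for w x
    using that
  proof (induction w arbitrary: x)
    case Nil
    then show ?case using F0 by simp
  next
    case (Cons i w)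
    have "((\<lambda>t. pds w f (x + t *\<^sub>R axis i 1)) has_vector_derivative F (i # w) x) (at 0)"
      by (rule line_derivative_cong[OF \<open>open \<Omega>\<close> Cons.prems _ der[OF Cons.prems]])
        (simp add: Cons.IH)
    then show ?case
      unfolding pds_simps pd_def by (rule vector_derivative_at)
  qed
  then show "\<And>w x. x \<in> \<Omega> \<Longrightarrow> pds w f x = F w x" .
  show "smooth_on \<Omega> f"
    unfolding smooth_on_def
  proof (intro allI conjI ballI)
    show "continuous_on \<Omega> (pds w f)" for w
      using cont[of w] eq by (simp cong: continuous_on_cong)
    show "((\<lambda>t. pds w f (x + t *\<^sub>R axis i 1)) has_vector_derivative pds (i # w) f x) (at 0)"
      if "x \<in> \<Omega>" for w x i
      unfolding eq[OF that]
      by (rule line_derivative_cong[OF \<open>open \<Omega>\<close> that _ der[OF that]]) (simp add: eq)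
  qed
qed

lemma smooth_on_continuous: "smooth_on \<Omega> f \<Longrightarrow> continuous_on \<Omega> (pds w f)"
  by (simp add: smooth_on_def)

lemma smooth_on_derivative:
  "smooth_on \<Omega> f \<Longrightarrow> x \<in> \<Omega> \<Longrightarrow>
    ((\<lambda>t. pds w f (x + t *\<^sub>R axis i 1)) has_vector_derivative pds (i # w) f x) (at 0)"
  unfolding smooth_on_def by blast

lemma smooth_on_pds: "smooth_on \<Omega> f \<Longrightarrow> smooth_on \<Omega> (pds u f)"
  unfolding smooth_on_def by (metis pds_append append_Cons)

lemma smooth_on_subset: "smooth_on \<Omega> f \<Longrightarrow> V \<subseteq> \<Omega> \<Longrightarrow> smooth_on V f"
  unfolding smooth_on_def by (meson continuous_on_subset subsetD)

lemma smooth_on_Un: "open A \<Longrightarrow> open B \<Longrightarrow> smooth_on A f \<Longrightarrow> smooth_on B f \<Longrightarrow> smooth_on (A \<union> B) f"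
  unfolding smooth_on_def using continuous_on_open_Un by blast

text \<open>Differentiation is local, so the derivatives of f can serve as those of g on an open
  set. This is what makes values outside \<Omega> immaterial.\<close>

lemma smooth_on_cong:
  assumes "open \<Omega>" "smooth_on \<Omega> f" "\<And>x. x \<in> \<Omega> \<Longrightarrow> f x = g x"
  shows "smooth_on \<Omega> g" and "\<And>w x. x \<in> \<Omega> \<Longrightarrow> pds w g x = pds w f x"
proof -
  note jet = smooth_on_jet[OF \<open>open \<Omega>\<close>, of "\<lambda>w. pds w f" g,
      OF _ smooth_on_continuous[OF assms(2)] smooth_on_derivative[OF assms(2)]]
  show "smooth_on \<Omega> g" and "\<And>w x. x \<in> \<Omega> \<Longrightarrow> pds w g x = pds w f x"
    using jet assms(3) by simp_all
qed

lemma smooth_on_zero: "smooth_on UNIV (\<lambda>_. 0)" and pds_zero: "pds w (\<lambda>_. 0) x = 0"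
  using smooth_on_jet[of UNIV "\<lambda>_ _. 0" "\<lambda>_. 0"] by auto

lemma smooth_on_one: "smooth_on UNIV (\<lambda>_. 1)"
proof (rule smooth_on_jet(1)[of UNIV "\<lambda>w _. if w = [] then 1 else 0"])
qed auto

lemma smooth_on_lincomb:
  assumes "open \<Omega>" "smooth_on \<Omega> f" "smooth_on \<Omega> g"
  shows "smooth_on \<Omega> (\<lambda>x. a * f x + b * g x)"
    and "\<And>w x. x \<in> \<Omega> \<Longrightarrow> pds w (\<lambda>x. a * f x + b * g x) x = a * pds w f x + b * pds w g x"
proof -
  have d: "((\<lambda>t. a * pds w f (x + t *\<^sub>R axis i 1) + b * pds w g (x + t *\<^sub>R axis i 1))
      has_vector_derivative a * pds (i # w) f x + b * pds (i # w) g x) (at 0)"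
    if "x \<in> \<Omega>" for w i x
    by (intro has_vector_derivative_add has_vector_derivative_mult_right
        smooth_on_derivative[OF assms(2) that] smooth_on_derivative[OF assms(3) that])
  note jet = smooth_on_jet[OF \<open>open \<Omega>\<close>, of "\<lambda>w x. a * pds w f x + b * pds w g x"
      "\<lambda>x. a * f x + b * g x"]
  have c: "continuous_on \<Omega> (\<lambda>x. a * pds w f x + b * pds w g x)" for w
    by (intro continuous_intros smooth_on_continuous assms)
  show "smooth_on \<Omega> (\<lambda>x. a * f x + b * g x)"
    by (rule jet(1)) (use c d in auto)
  show "pds w (\<lambda>x. a * f x + b * g x) x = a * pds w f x + b * pds w g x" if "x \<in> \<Omega>" for w x
    by (rule jet(2)) (use c d that in auto)
qed

lemma smooth_on_diff:
  assumes "open \<Omega>" "smooth_on \<Omega> f" "smooth_on \<Omega> g"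
  shows "smooth_on \<Omega> (\<lambda>x. f x - g x)"
    and "\<And>w x. x \<in> \<Omega> \<Longrightarrow> pds w (\<lambda>x. f x - g x) x = pds w f x - pds w g x"
  using smooth_on_lincomb[OF assms, where a = 1 and b = "-1"] by simp_all

text \<open>All ways of sending each letter of a word to one of two factors. A list, not a set:
  equal pairs must be counted as often as they arise, which replaces the binomial
  coefficients.\<close>

fun splits :: "'a list \<Rightarrow> ('a list \<times> 'a list) list" where
  "splits [] = [([], [])]"
| "splits (i # w) = map (\<lambda>(u, v). (i # u, v)) (splits w) @ map (\<lambda>(u, v). (u, i # v)) (splits w)"

lemma length_splits: "length (splits w) = 2 ^ length w"
  by (induction w) auto

lemma splits_length_le: "(u, v) \<in> set (splits w) \<Longrightarrow> length u + length v = length w"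
  by (induction w arbitrary: u v) auto

lemma has_vector_derivative_sum_list:
  assumes "\<And>x. x \<in> set xs \<Longrightarrow> (f x has_vector_derivative f' x) F"
  shows "((\<lambda>t. \<Sum>x\<leftarrow>xs. f x t) has_vector_derivative (\<Sum>x\<leftarrow>xs. f' x)) F"
  using assms by (induction xs) (auto intro!: has_vector_derivative_add)

lemma continuous_on_sum_list:
  fixes f :: "'a \<Rightarrow> 'b::topological_space \<Rightarrow> 'c::real_normed_vector"
  assumes "\<And>x. x \<in> set xs \<Longrightarrow> continuous_on S (f x)"
  shows "continuous_on S (\<lambda>t. \<Sum>x\<leftarrow>xs. f x t)"
  using assms by (induction xs) (auto intro!: continuous_on_add)

text \<open>A new outermost derivative hits either the first or the second factor of each term, and
  these are the two halves of \<open>splits (i # w)\<close>.\<close>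

lemma smooth_on_mult:
  assumes "open \<Omega>" "smooth_on \<Omega> f" "smooth_on \<Omega> g"
  shows "smooth_on \<Omega> (\<lambda>x. f x * g x)"
    and "\<And>w x. x \<in> \<Omega> \<Longrightarrow>
      pds w (\<lambda>x. f x * g x) x = (\<Sum>(u, v)\<leftarrow>splits w. pds u f x * pds v g x)"
proof -
  let ?F = "\<lambda>w x. \<Sum>(u, v)\<leftarrow>splits w. pds u f x * pds v g x"
  have d: "((\<lambda>t. ?F w (x + t *\<^sub>R axis i 1)) has_vector_derivative ?F (i # w) x) (at 0)"
    if x: "x \<in> \<Omega>" for w i x
  proof -
    have "((\<lambda>t. (case p of (u, v) \<Rightarrow> pds u f (x + t *\<^sub>R axis i 1) * pds v g (x + t *\<^sub>R axis i 1)))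
       has_vector_derivative
         (case p of (u, v) \<Rightarrow> pds (i # u) f x * pds v g x) +
         (case p of (u, v) \<Rightarrow> pds u f x * pds (i # v) g x)) (at 0)" for p
      using has_vector_derivative_mult[OF smooth_on_derivative[OF assms(2) x, of "fst p" i]
          smooth_on_derivative[OF assms(3) x, of "snd p" i]]
      by (simp add: case_prod_beta add.commute)
    from has_vector_derivative_sum_list[of "splits w", OF this]
    have "((\<lambda>t. ?F w (x + t *\<^sub>R axis i 1)) has_vector_derivative
       (\<Sum>p\<leftarrow>splits w. (case p of (u, v) \<Rightarrow> pds (i # u) f x * pds v g x) +
         (case p of (u, v) \<Rightarrow> pds u f x * pds (i # v) g x))) (at 0)"
      by simp
    also have "(\<Sum>p\<leftarrow>splits w. (case p of (u, v) \<Rightarrow> pds (i # u) f x * pds v g x) +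
         (case p of (u, v) \<Rightarrow> pds u f x * pds (i # v) g x)) = ?F (i # w) x"
      by (simp add: sum_list_addf comp_def case_prod_beta)
    finally show ?thesis .
  qed
  have c: "continuous_on \<Omega> (?F w)" for w
    by (intro continuous_on_sum_list)
      (auto simp: case_prod_beta intro!: continuous_intros smooth_on_continuous assms)
  note jet = smooth_on_jet[OF \<open>open \<Omega>\<close>, of ?F "\<lambda>x. f x * g x"]
  show "smooth_on \<Omega> (\<lambda>x. f x * g x)"
    by (rule jet(1)) (use c d in auto)
  show "pds w (\<lambda>x. f x * g x) x = ?F w x" if "x \<in> \<Omega>" for w x
    by (rule jet(2)) (use c d that in auto)
qed

lemma norm_sum_list_le:
  fixes f :: "'a \<Rightarrow> 'b::real_normed_vector"
  assumes "\<And>x. x \<in> set xs \<Longrightarrow> norm (f x) \<le> B"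
  shows "norm (\<Sum>x\<leftarrow>xs. f x) \<le> real (length xs) * B"
  using assms
proof (induction xs)
  case (Cons x xs)
  have "norm (\<Sum>x\<leftarrow>x # xs. f x) \<le> norm (f x) + norm (\<Sum>x\<leftarrow>xs. f x)"
    by (simp add: norm_triangle_ineq)
  also have "\<dots> \<le> B + real (length xs) * B"
    using Cons by (intro add_mono) auto
  finally show ?case by (simp add: algebra_simps)
qed simp

text \<open>The factor \<open>2 ^ length w\<close> is the number of Leibniz terms. The bounds are
  asked for at the single point x, so the lemma applies on compact sets where only local bounds are
  available.\<close>

lemma pds_mult_bound:
  assumes "open \<Omega>" "smooth_on \<Omega> f" "smooth_on \<Omega> g" "x \<in> \<Omega>"
    and "\<And>u. length u \<le> length w \<Longrightarrow> norm (pds u f x) \<le> A"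
    and "\<And>u. length u \<le> length w \<Longrightarrow> norm (pds u g x) \<le> B"
  shows "norm (pds w (\<lambda>x. f x * g x) x) \<le> 2 ^ length w * A * B"
proof -
  have "0 \<le> A" using assms(5)[of "[]"] by (auto intro: order_trans[OF norm_ge_zero])
  have "norm (pds w (\<lambda>x. f x * g x) x) \<le> real (length (splits w)) * (A * B)"
    unfolding smooth_on_mult(2)[OF assms(1-4)]
  proof (rule norm_sum_list_le)
    fix p assume "p \<in> set (splits w)"
    then have "length (fst p) \<le> length w" "length (snd p) \<le> length w"
      using splits_length_le[of "fst p" "snd p" w] by auto
    then show "norm (case p of (u, v) \<Rightarrow> pds u f x * pds v g x) \<le> A * B"
      using assms(5,6) \<open>0 \<le> A\<close> by (auto simp: case_prod_beta norm_mult intro!: mult_mono)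
  qed
  then show ?thesis by (simp add: length_splits mult.assoc)
qed

text \<open>Smoothness is phrased with line derivatives at parameter 0; the mean value inequality
  needs them at every parameter, by moving the base point along the line.\<close>

lemma line_derivative_shift:
  fixes x v :: "'a::real_normed_vector"
  assumes "((\<lambda>t. f ((x + s *\<^sub>R v) + t *\<^sub>R v)) has_vector_derivative d) (at 0)"
  shows "((\<lambda>t. f (x + t *\<^sub>R v)) has_vector_derivative d) (at s)"
proof -
  have "((\<lambda>t. f ((x + s *\<^sub>R v) + t *\<^sub>R v)) \<circ> (\<lambda>t. t - s) has_vector_derivative 1 *\<^sub>R d) (at s)"
    by (rule vector_diff_chain_at)
      (use assms in \<open>auto intro!: derivative_eq_intros simp: has_vector_derivative_def\<close>)
  then show ?thesis
    by (simp add: comp_def scaleR_diff_left)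
qed

lemma smooth_on_line_derivative:
  assumes "smooth_on \<Omega> f" "x + s *\<^sub>R axis i 1 \<in> \<Omega>"
  shows "((\<lambda>t. pds w f (x + t *\<^sub>R axis i 1)) has_vector_derivative pds (i # w) f (x + s *\<^sub>R axis i 1)) (at s)"
  by (rule line_derivative_shift, rule smooth_on_derivative[OF assms])

text \<open>Each derivative contributes one factor c by the chain rule. Reflections are the case c =
  -1, translations the case c = 1.\<close>

lemma smooth_on_affine:
  assumes "smooth_on UNIV f"
  shows "smooth_on UNIV (\<lambda>t. f (a + c *\<^sub>R t))"
    and "\<And>w x. pds w (\<lambda>t. f (a + c *\<^sub>R t)) x = c ^ length w *\<^sub>R pds w f (a + c *\<^sub>R x)"
proof -
  let ?F = "\<lambda>w x. c ^ length w *\<^sub>R pds w f (a + c *\<^sub>R x)"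
  have d: "((\<lambda>t. ?F w (x + t *\<^sub>R axis i 1)) has_vector_derivative ?F (i # w) x) (at 0)" for w i x
  proof -
    have "((\<lambda>t. pds w f ((a + c *\<^sub>R x) + t *\<^sub>R axis i 1)) \<circ> (\<lambda>t. c * t) has_vector_derivative
        c *\<^sub>R pds (i # w) f (a + c *\<^sub>R x)) (at 0)"
      by (rule vector_diff_chain_at)
        (use smooth_on_derivative[OF assms] in
          \<open>auto intro!: derivative_eq_intros simp: has_vector_derivative_def\<close>)
    from has_vector_derivative_scaleR[OF DERIV_const this, of "c ^ length w"] show ?thesis
      by (simp add: comp_def algebra_simps)
  qed
  have c: "continuous_on UNIV (?F w)" for w
    by (intro continuous_intros continuous_on_compose2[OF smooth_on_continuous[OF assms]]) auto
  show "smooth_on UNIV (\<lambda>t. f (a + c *\<^sub>R t))"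
    by (rule smooth_on_jet(1)[of UNIV ?F]) (use c d in auto)
  show "pds w (\<lambda>t. f (a + c *\<^sub>R t)) x = ?F w x" for w x
    by (rule smooth_on_jet(2)[of UNIV ?F]) (use c d in auto)
qed

subsection \<open>Differentiability and symmetry of derivatives\<close>

text \<open>The mean value inequality applied to \<open>\<phi> t - t *\<^sub>R d\<close>. The closed
  segment from 0 to s covers both signs of s.\<close>

lemma line_increment_bound:
  fixes \<phi> :: "real \<Rightarrow> 'b::real_normed_vector"
  assumes "\<And>t. t \<in> closed_segment 0 s \<Longrightarrow> (\<phi> has_vector_derivative \<phi>' t) (at t)"
    and "\<And>t. t \<in> closed_segment 0 s \<Longrightarrow> norm (\<phi>' t - d) \<le> B"
  shows "norm (\<phi> s - \<phi> 0 - s *\<^sub>R d) \<le> B * \<bar>s\<bar>"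
proof -
  let ?g = "\<lambda>t. \<phi> t - t *\<^sub>R d"
  have "norm (?g s - ?g 0) \<le> B * norm (s - 0)"
  proof (rule differentiable_bound)
    show "convex (closed_segment 0 s)" by simp
    show "(?g has_derivative (\<lambda>h. h *\<^sub>R (\<phi>' t - d))) (at t within closed_segment 0 s)"
      if "t \<in> closed_segment 0 s" for t
    proof -
      have "(?g has_vector_derivative (\<phi>' t - d)) (at t)"
        by (intro has_vector_derivative_diff assms(1)[OF that])
          (auto intro!: derivative_eq_intros simp: has_vector_derivative_def)
      then show ?thesis
        unfolding has_vector_derivative_def by (rule has_derivative_at_withinI)
    qed
    show "onorm (\<lambda>h. h *\<^sub>R (\<phi>' t - d)) \<le> B" if "t \<in> closed_segment 0 s" for t
      using mult_left_mono[OF assms(2)[OF that] abs_ge_zero] by (intro onorm_le) (simp add: mult.commute)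
  qed auto
  then show ?thesis by (simp add: algebra_simps)
qed

lemma axis_segment_bound:
  assumes "smooth_on \<Omega> f"
    and seg: "\<And>t. t \<in> closed_segment 0 s \<Longrightarrow> x + t *\<^sub>R axis i 1 \<in> \<Omega>"
    and "\<And>t. t \<in> closed_segment 0 s \<Longrightarrow> norm (pds (i # w) f (x + t *\<^sub>R axis i 1) - d) \<le> B"
  shows "norm (pds w f (x + s *\<^sub>R axis i 1) - pds w f x - s *\<^sub>R d) \<le> B * \<bar>s\<bar>"
  using line_increment_bound[of s "\<lambda>t. pds w f (x + t *\<^sub>R axis i 1)",
      OF smooth_on_line_derivative[OF assms(1) seg] assms(3)] by simp

lemma closed_segment_0_abs: "t \<in> closed_segment 0 (s::real) \<Longrightarrow> \<bar>t\<bar> \<le> \<bar>s\<bar>"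
  by (auto simp: closed_segment_eq_real_ivl split: if_splits)

text \<open>Continuous partial derivatives give total differentiability. The induction is over the
  set A of coordinates in which the increment h may move; the new coordinate j is changed last,
  along one axis, where the mean value inequality and the continuity of \<open>pds [j] f\<close>
  apply.\<close>

lemma smooth_on_has_derivative:
  fixes x :: "real^'n::finite"
  assumes "open \<Omega>" "smooth_on \<Omega> f" "x \<in> \<Omega>"
  shows "(f has_derivative (\<lambda>h. \<Sum>i\<in>UNIV. (h $ i) *\<^sub>R pds [i] f x)) (at x)"
proof -
  have main: "\<exists>\<delta>>0. \<forall>h. norm h < \<delta> \<longrightarrow> (\<forall>i. i \<notin> A \<longrightarrow> h $ i = 0) \<longrightarrow>
      norm (f (x + h) - f x - (\<Sum>i\<in>A. (h $ i) *\<^sub>R pds [i] f x)) \<le> e * norm h"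
    if "finite A" "e > 0" for A :: "'n set" and e :: real
    using that
  proof (induction A arbitrary: e)
    case empty
    have "h = 0" if "\<forall>i. i \<notin> {} \<longrightarrow> h $ i = 0" for h :: "real^'n"
      using that by (simp add: vec_eq_iff)
    then have "norm (f (x + h) - f x - (\<Sum>i\<in>{}. (h $ i) *\<^sub>R pds [i] f x)) \<le> e * norm h"
      if "\<forall>i. i \<notin> {} \<longrightarrow> h $ i = 0" for h :: "real^'n"
      using \<open>\<And>h. \<forall>i. i \<notin> {} \<longrightarrow> h $ i = 0 \<Longrightarrow> h = 0\<close>[OF that] by simp
    then show ?case by (intro exI[of _ 1] conjI allI impI zero_less_one)
  next
    case (insert j A)
    obtain \<delta>1 where "\<delta>1 > 0" and \<delta>1: "\<And>h. norm h < \<delta>1 \<Longrightarrow> (\<forall>i. i \<notin> A \<longrightarrow> h $ i = 0) \<Longrightarrow>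
      norm (f (x + h) - f x - (\<Sum>i\<in>A. (h $ i) *\<^sub>R pds [i] f x)) \<le> e / 2 * norm h"
      using insert.IH[of "e / 2"] insert.prems by auto
    have "continuous (at x) (pds [j] f)"
      using smooth_on_continuous[OF assms(2)] assms(1,3) by (metis continuous_on_eq_continuous_at)
    then obtain \<delta>2 where "\<delta>2 > 0"
      and \<delta>2: "\<And>y. dist y x < \<delta>2 \<Longrightarrow> dist (pds [j] f y) (pds [j] f x) < e / 2"
      unfolding continuous_at_eps_delta using insert.prems
      by (metis half_gt_zero)
    obtain \<delta>3 where "\<delta>3 > 0" and \<delta>3: "ball x \<delta>3 \<subseteq> \<Omega>"
      using assms openE by blast
    show ?case
    proof (intro exI[of _ "min \<delta>1 (min \<delta>2 \<delta>3)"] conjI allI impI)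
      show "0 < min \<delta>1 (min \<delta>2 \<delta>3)"
        using \<open>\<delta>1 > 0\<close> \<open>\<delta>2 > 0\<close> \<open>\<delta>3 > 0\<close> by simp
      fix h :: "real^'n" assume h: "norm h < min \<delta>1 (min \<delta>2 \<delta>3)" and hA: "\<forall>i. i \<notin> insert j A \<longrightarrow> h $ i = 0"
      define h' where "h' = h - (h $ j) *\<^sub>R axis j 1"
      have h'c: "h' $ i = (if i = j then 0 else h $ i)" for i
        by (simp add: h'_def axis_def)
      \<comment> \<open>The whole axis segment from h' to h stays within distance
        \<open>norm h\<close> of 0, so the continuity radius imposed on h covers every intermediate
        point.\<close>
      have part: "norm (h' + t *\<^sub>R axis j 1) \<le> norm h" if "\<bar>t\<bar> \<le> \<bar>h $ j\<bar>" for t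
      proof (rule norm_le_componentwise_cart)
        show "norm ((h' + t *\<^sub>R axis j 1) $ i) \<le> norm (h $ i)" for i
          using that by (cases "i = j") (auto simp: h'c axis_def)
      qed
      have "norm h' \<le> norm h" using part[of 0] by simp
      have hj: "\<bar>h $ j\<bar> \<le> norm h" by (rule component_le_norm_cart)
      have close: "dist (x + h' + t *\<^sub>R axis j 1) x < min \<delta>2 \<delta>3" if "t \<in> closed_segment 0 (h $ j)" for t
        using part[OF closed_segment_0_abs[OF that]] h by (simp add: dist_norm add.assoc)
      have inc: "norm (pds [] f (x + h' + (h $ j) *\<^sub>R axis j 1) - pds [] f (x + h') - (h $ j) *\<^sub>R pds [j] f x)
          \<le> e / 2 * \<bar>h $ j\<bar>"
      proof (rule axis_segment_bound[OF assms(2)])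
        show "x + h' + t *\<^sub>R axis j 1 \<in> \<Omega>" if "t \<in> closed_segment 0 (h $ j)" for t
          using close[OF that] \<delta>3 by (auto simp: subset_iff dist_commute)
        show "norm (pds [j] f (x + h' + t *\<^sub>R axis j 1) - pds [j] f x) \<le> e / 2"
          if "t \<in> closed_segment 0 (h $ j)" for t
          using \<delta>2[of "x + h' + t *\<^sub>R axis j 1"] close[OF that] by (simp add: dist_norm)
      qed
      have hh: "x + h' + (h $ j) *\<^sub>R axis j 1 = x + h" by (simp add: h'_def)
      have "norm (f (x + h') - f x - (\<Sum>i\<in>A. (h' $ i) *\<^sub>R pds [i] f x)) \<le> e / 2 * norm h'"
        using \<open>norm h' \<le> norm h\<close> h hA by (intro \<delta>1) (auto simp: h'c)
      also have "\<dots> \<le> e / 2 * norm h"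
        using \<open>norm h' \<le> norm h\<close> insert.prems by simp
      finally have A: "norm (f (x + h') - f x - (\<Sum>i\<in>A. (h' $ i) *\<^sub>R pds [i] f x)) \<le> e / 2 * norm h" .
      have s: "(\<Sum>i\<in>A. (h' $ i) *\<^sub>R pds [i] f x) = (\<Sum>i\<in>A. (h $ i) *\<^sub>R pds [i] f x)"
        using insert.hyps by (intro sum.cong) (auto simp: h'c)
      have "norm (f (x + h) - f x - (\<Sum>i\<in>insert j A. (h $ i) *\<^sub>R pds [i] f x))
          = norm ((f (x + h') - f x - (\<Sum>i\<in>A. (h' $ i) *\<^sub>R pds [i] f x))
               + (f (x + h) - f (x + h') - (h $ j) *\<^sub>R pds [j] f x))"
        using insert.hyps unfolding s by (simp add: algebra_simps)
      also have "\<dots> \<le> e / 2 * norm h + e / 2 * \<bar>h $ j\<bar>"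
        using A inc unfolding hh by (intro order_trans[OF norm_triangle_ineq] add_mono) auto
      also have "\<dots> \<le> e / 2 * norm h + e / 2 * norm h"
        using insert.prems hj by (intro add_left_mono mult_left_mono) auto
      finally show "norm (f (x + h) - f x - (\<Sum>i\<in>insert j A. (h $ i) *\<^sub>R pds [i] f x)) \<le> e * norm h"
        by simp
    qed
  qed
  show ?thesis
    unfolding has_derivative_at_alt
  proof (intro conjI allI impI)
    show "bounded_linear (\<lambda>h. \<Sum>i\<in>UNIV. (h $ i) *\<^sub>R pds [i] f x)"
      by (intro bounded_linear_sum bounded_linear_scaleR_const bounded_linear_vec_nth)
    fix e :: real assume "e > 0"
    from main[OF finite[of UNIV] this] obtain d where "d > 0" and d: "\<And>h. norm h < d \<Longrightarrow>
      norm (f (x + h) - f x - (\<Sum>i\<in>UNIV. (h $ i) *\<^sub>R pds [i] f x)) \<le> e * norm h"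
      by auto
    show "\<exists>d>0. \<forall>y. norm (y - x) < d \<longrightarrow>
        norm (f y - f x - (\<Sum>i\<in>UNIV. ((y - x) $ i) *\<^sub>R pds [i] f x)) \<le> e * norm (y - x)"
    proof (intro exI[of _ d] conjI allI impI \<open>d > 0\<close>)
      fix y assume "norm (y - x) < d"
      from d[OF this] show "norm (f y - f x - (\<Sum>i\<in>UNIV. ((y - x) $ i) *\<^sub>R pds [i] f x)) \<le> e * norm (y - x)"
        by simp
    qed
  qed
qed

text \<open>The second difference of f over a square of side s. The increment bound is used twice:
  in direction i for the difference of two parallel edges, and in direction j for the derivative of
  that difference.\<close>

lemma square_increment_bound:
  assumes "smooth_on UNIV f"
    and "\<And>t u. t \<in> closed_segment 0 s \<Longrightarrow> u \<in> closed_segment 0 s \<Longrightarrow>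
      norm (pds [j, i] f (x + t *\<^sub>R axis i 1 + u *\<^sub>R axis j 1) - d) \<le> e"
  shows "norm (f (x + s *\<^sub>R axis i 1 + s *\<^sub>R axis j 1) - f (x + s *\<^sub>R axis i 1) - f (x + s *\<^sub>R axis j 1) + f x
    - (s * s) *\<^sub>R d) \<le> e * \<bar>s\<bar> * \<bar>s\<bar>"
proof -
  let ?\<phi> = "\<lambda>t. f ((x + s *\<^sub>R axis j 1) + t *\<^sub>R axis i 1) - f (x + t *\<^sub>R axis i 1)"
  let ?\<phi>' = "\<lambda>t. pds [i] f ((x + s *\<^sub>R axis j 1) + t *\<^sub>R axis i 1) - pds [i] f (x + t *\<^sub>R axis i 1)"
  have "norm (?\<phi> s - ?\<phi> 0 - s *\<^sub>R (s *\<^sub>R d)) \<le> (e * \<bar>s\<bar>) * \<bar>s\<bar>"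
  proof (rule line_increment_bound)
    show "(?\<phi> has_vector_derivative ?\<phi>' t) (at t)" for t
      using smooth_on_line_derivative[OF assms(1), of _ t i "[]"]
      by (intro has_vector_derivative_diff) auto
    fix t assume t: "t \<in> closed_segment 0 s"
    have "norm (pds [i] f ((x + t *\<^sub>R axis i 1) + s *\<^sub>R axis j 1) - pds [i] f (x + t *\<^sub>R axis i 1) - s *\<^sub>R d) \<le> e * \<bar>s\<bar>"
      by (rule axis_segment_bound[OF assms(1)]) (use assms(2)[OF t] in auto)
    then show "norm (?\<phi>' t - s *\<^sub>R d) \<le> e * \<bar>s\<bar>"
      by (simp add: algebra_simps)
  qed
  then show ?thesis by (simp add: algebra_simps)
qed

text \<open>One and the same second difference over a small square equals s * s times either mixed
  derivative, up to e * s * s, because both mixed derivatives are continuous at x.\<close>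

lemma pd_commute:
  assumes f: "smooth_on UNIV f"
  shows "pds [i, j] f = pds [j, i] f"
proof
  fix x
  let ?a = "pds [i, j] f x" and ?b = "pds [j, i] f x"
  have cont: "\<exists>s>0. \<forall>t u. t \<in> closed_segment 0 s \<longrightarrow> u \<in> closed_segment 0 s \<longrightarrow>
      norm (pds [i, j] f (x + t *\<^sub>R axis j 1 + u *\<^sub>R axis i 1) - ?a) \<le> e \<and>
      norm (pds [j, i] f (x + t *\<^sub>R axis i 1 + u *\<^sub>R axis j 1) - ?b) \<le> e" if "e > 0" for e
  proof -
    have "isCont (pds [i, j] f) x" "isCont (pds [j, i] f) x"
      using smooth_on_continuous[OF f, of "[i, j]"] smooth_on_continuous[OF f, of "[j, i]"]
      by (auto simp: continuous_on_eq_continuous_at)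
    then have ex: "\<exists>d>0. \<forall>y. dist y x < d \<longrightarrow> dist (pds [i, j] f y) ?a < e"
      "\<exists>d>0. \<forall>y. dist y x < d \<longrightarrow> dist (pds [j, i] f y) ?b < e"
      unfolding continuous_at_eps_delta using \<open>e > 0\<close> by (auto simp only:)
    from ex(1) obtain d1 where "d1 > 0" and d1: "\<And>y. dist y x < d1 \<Longrightarrow> dist (pds [i, j] f y) ?a < e"
      by blast
    from ex(2) obtain d2 where "d2 > 0" and d2: "\<And>y. dist y x < d2 \<Longrightarrow> dist (pds [j, i] f y) ?b < e"
      by blast
    \<comment> \<open>Points of the square are within 2 * s of x; dividing by 3 makes this strictly
      smaller than both radii.\<close>
    define s where "s = min d1 d2 / 3"
    have "s > 0" using \<open>d1 > 0\<close> \<open>d2 > 0\<close> by (simp add: s_def)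
    have near: "dist (x + t *\<^sub>R axis k 1 + u *\<^sub>R axis l 1) x < min d1 d2"
      if "t \<in> closed_segment 0 s" "u \<in> closed_segment 0 s" for t u k l
    proof -
      have "dist (x + t *\<^sub>R axis k 1 + u *\<^sub>R axis l 1) x \<le> \<bar>t\<bar> + \<bar>u\<bar>"
        using norm_triangle_ineq[of "t *\<^sub>R axis k (1::real)" "u *\<^sub>R axis l 1"]
        by (simp add: dist_norm add.assoc)
      also have "\<dots> \<le> 2 * s"
        using closed_segment_0_abs[OF that(1)] closed_segment_0_abs[OF that(2)] \<open>s > 0\<close> by simp
      also have "\<dots> < min d1 d2"
        using \<open>s > 0\<close> unfolding s_def by linarith
      finally show ?thesis .
    qed
    show ?thesis
    proof (intro exI[of _ s] conjI allI impI)
      fix t u assume tu: "t \<in> closed_segment 0 s" "u \<in> closed_segment 0 s"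
      show "norm (pds [i, j] f (x + t *\<^sub>R axis j 1 + u *\<^sub>R axis i 1) - ?a) \<le> e"
        using d1[of "x + t *\<^sub>R axis j 1 + u *\<^sub>R axis i 1"] near[OF tu, of j i] by (simp add: dist_norm)
      show "norm (pds [j, i] f (x + t *\<^sub>R axis i 1 + u *\<^sub>R axis j 1) - ?b) \<le> e"
        using d2[of "x + t *\<^sub>R axis i 1 + u *\<^sub>R axis j 1"] near[OF tu, of i j] by (simp add: dist_norm)
    qed (rule \<open>s > 0\<close>)
  qed
  have le: "norm (?a - ?b) \<le> 2 * e" if "e > 0" for e
  proof -
    from cont[OF that] obtain s where "s > 0"
      and s1: "\<And>t u. t \<in> closed_segment 0 s \<Longrightarrow> u \<in> closed_segment 0 s \<Longrightarrow>
        norm (pds [i, j] f (x + t *\<^sub>R axis j 1 + u *\<^sub>R axis i 1) - ?a) \<le> e"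
      and s2: "\<And>t u. t \<in> closed_segment 0 s \<Longrightarrow> u \<in> closed_segment 0 s \<Longrightarrow>
        norm (pds [j, i] f (x + t *\<^sub>R axis i 1 + u *\<^sub>R axis j 1) - ?b) \<le> e"
      by blast
    define D where "D = f (x + s *\<^sub>R axis i 1 + s *\<^sub>R axis j 1) - f (x + s *\<^sub>R axis i 1) - f (x + s *\<^sub>R axis j 1) + f x"
    have "norm (D - (s * s) *\<^sub>R ?b) \<le> e * \<bar>s\<bar> * \<bar>s\<bar>"
      unfolding D_def by (rule square_increment_bound[OF f s2])
    moreover have "norm (D - (s * s) *\<^sub>R ?a) \<le> e * \<bar>s\<bar> * \<bar>s\<bar>"
      using square_increment_bound[of f s i j x ?a e, OF f s1] by (simp add: D_def algebra_simps)
    ultimately have "norm ((D - (s * s) *\<^sub>R ?b) - (D - (s * s) *\<^sub>R ?a)) \<le> 2 * (e * \<bar>s\<bar> * \<bar>s\<bar>)"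
      using norm_triangle_ineq4[of "D - (s * s) *\<^sub>R ?b" "D - (s * s) *\<^sub>R ?a"] by linarith
    also have "(D - (s * s) *\<^sub>R ?b) - (D - (s * s) *\<^sub>R ?a) = (s * s) *\<^sub>R (?a - ?b)"
      by (simp add: algebra_simps)
    finally show ?thesis
      using \<open>s > 0\<close> by simp
  qed
  have "norm (?a - ?b) \<le> 0"
    by (rule field_le_epsilon) (use le[of "_ / 2"] in simp)
  then show "?a = ?b" by simp
qed

text \<open>Carries the innermost derivative to the outside by repeatedly exchanging
  neighbours.\<close>

lemma pds_snoc:
  assumes "smooth_on UNIV f"
  shows "pds (u @ [i]) f = pds (i # u) f"
proof (induction u)
  case (Cons j u)
  have "pds ((j # u) @ [i]) f = pds [j, i] (pds u f)"
    using Cons by simp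
  also have "\<dots> = pds [i, j] (pds u f)"
    by (rule pd_commute[OF smooth_on_pds[OF assms]])
  finally show ?case by simp
qed simp

lemma pds_permute:
  assumes "smooth_on UNIV f" "mset u = mset v"
  shows "pds u f = pds v f"
  using assms(2)
proof (induction u arbitrary: v)
  case (Cons i u)
  then have "i \<in> set v" by (metis list.set_intros(1) set_mset_mset)
  then obtain a b where v: "v = a @ i # b" by (meson split_list)
  have "pds v f = pds (a @ [i]) (pds b f)"
    by (simp add: v pds_append)
  also have "\<dots> = pd i (pds (a @ b) f)"
    unfolding pds_snoc[OF smooth_on_pds[OF assms(1)]] by (simp add: pds_append)
  also have "pds (a @ b) f = pds u f"
    using Cons.IH[of "a @ b"] Cons.prems v by simp
  finally show ?case by simp
qed simp

text \<open>The very choice made inside \<open>mpd\<close>, so that \<open>mpd_mword\<close> is an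
  unfolding, valid for every function and without reordering derivatives.\<close>

definition mword :: "'n::finite mindex \<Rightarrow> 'n list" where
  "mword \<alpha> = (SOME w. \<forall>i. count_list w i = \<alpha> i)"

lemma mpd_mword: "mpd \<alpha> f = pds (mword \<alpha>) f"
  by (simp add: mpd_def mword_def)

lemma count_list_mword: "count_list (mword \<alpha>) = (\<alpha> :: 'n::finite mindex)"
proof -
  obtain w where "mset w = (\<Sum>i\<in>UNIV. replicate_mset (\<alpha> i) i)"
    using ex_mset by blast
  then have "count_list w i = \<alpha> i" for i
    by (simp add: count_mset[symmetric] count_sum del: count_mset)
  then have "\<forall>i. count_list (mword \<alpha>) i = \<alpha> i"
    unfolding mword_def by (rule someI[of "\<lambda>w. \<forall>i. count_list w i = \<alpha> i", OF allI])
  then show ?thesis by blast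
qed

lemma mdeg_count_list: "mdeg (count_list w) = length w"
  by (simp add: mdeg_def sum_count_set)

lemma length_mword: "length (mword \<alpha>) = mdeg \<alpha>"
  using mdeg_count_list[of "mword \<alpha>"] by (simp add: count_list_mword)

text \<open>Symmetry of derivatives is used here: \<open>mpd\<close> knows one chosen word per
  multi-index, while the estimates meet arbitrary words.\<close>

lemma pds_eq_mpd:
  assumes "smooth_on UNIV f"
  shows "pds w f = mpd (count_list w) f"
  unfolding mpd_mword
  by (rule pds_permute[OF assms], rule multiset_eqI)
    (simp add: count_list_mword count_mset)

lemma mpd_zero_index:
  fixes f :: "'n::finite cfun"
  shows "mpd (\<lambda>_. 0) f = f"
proof -
  have "mword (\<lambda>_::'n::finite. 0) = []"
    using length_mword[of "\<lambda>_::'n::finite. 0"] by (simp add: mdeg_def)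
  then show ?thesis by (simp add: mpd_mword)
qed

subsection \<open>Test functions and distributions\<close>

lemma tsupp_outside: "x \<notin> tsupp f \<Longrightarrow> f x = 0"
  using closure_subset[of "{x. f x \<noteq> 0}"] by (auto simp: tsupp_def)

lemma closed_tsupp [simp]: "closed (tsupp f)"
  by (simp add: tsupp_def)

lemma tsupp_subset: "closed K \<Longrightarrow> (\<And>x. x \<notin> K \<Longrightarrow> f x = 0) \<Longrightarrow> tsupp f \<subseteq> K"
  unfolding tsupp_def by (rule closure_minimal) auto

lemma test_funI:
  assumes "smooth_on UNIV f" "compact K" "K \<subseteq> \<Omega>" "\<And>x. x \<notin> K \<Longrightarrow> f x = 0"
  shows "test_fun \<Omega> f"
proof -
  have "tsupp f \<subseteq> K"
    using assms by (intro tsupp_subset) (auto simp: compact_imp_closed)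
  moreover have "compact (tsupp f)"
    using compact_Int_closed[OF assms(2) closed_tsupp[of f]] calculation by (simp add: Int_absorb1)
  ultimately show ?thesis
    using assms by (auto simp: test_fun_def)
qed

lemma test_funD:
  assumes "test_fun \<Omega> \<tau>"
  shows "smooth_on UNIV \<tau>" "compact (tsupp \<tau>)" "tsupp \<tau> \<subseteq> \<Omega>"
  using assms by (auto simp: test_fun_def)

lemma test_fun_mono: "test_fun V \<tau> \<Longrightarrow> V \<subseteq> \<Omega> \<Longrightarrow> test_fun \<Omega> \<tau>"
  by (auto simp: test_fun_def)

text \<open>On the open complement of the closed support f coincides with 0, so its iterated
  derivatives there are those of 0.\<close>

lemma pds_outside_tsupp:
  assumes "x \<notin> tsupp f"
  shows "pds w f x = 0"
proof -
  have "pds w f x = pds w (\<lambda>_. 0) x"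
    using assms tsupp_outside
    by (intro smooth_on_cong(2)[of "- tsupp f"] smooth_on_subset[OF smooth_on_zero]) auto
  then show ?thesis by (simp add: pds_zero)
qed

lemma tsupp_pds: "tsupp (pds w f) \<subseteq> tsupp f"
  using pds_outside_tsupp by (intro tsupp_subset) auto

lemma test_fun_pds: "test_fun \<Omega> \<tau> \<Longrightarrow> test_fun \<Omega> (pds w \<tau>)"
  by (rule test_funI[of _ "tsupp \<tau>"])
    (auto simp: test_fun_def pds_outside_tsupp smooth_on_pds)

lemma test_fun_zero: "test_fun \<Omega> (\<lambda>_. 0)"
  by (rule test_funI[of _ "{}"]) (auto simp: smooth_on_zero)

lemma test_fun_lincomb:
  assumes "test_fun \<Omega> f" "test_fun \<Omega> g"
  shows "test_fun \<Omega> (\<lambda>x. a * f x + b * g x)"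
  by (rule test_funI[of _ "tsupp f \<union> tsupp g"])
    (use assms in \<open>auto simp: test_fun_def smooth_on_lincomb tsupp_outside\<close>)

lemma test_fun_diff:
  "test_fun \<Omega> f \<Longrightarrow> test_fun \<Omega> g \<Longrightarrow> test_fun \<Omega> (\<lambda>x. f x - g x)"
  using test_fun_lincomb[of \<Omega> f g 1 "-1"] by simp

text \<open>Compactness of the support comes from f; the role of c is to keep it inside \<Omega>.
  Used with cut-offs and with c = 1 on the whole space.\<close>

lemma test_fun_mult:
  assumes "smooth_on UNIV c" "tsupp c \<subseteq> \<Omega>" "test_fun UNIV f"
  shows "test_fun \<Omega> (\<lambda>x. c x * f x)"
proof (rule test_funI[of _ "tsupp c \<inter> tsupp f"])
  show "compact (tsupp c \<inter> tsupp f)"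
    using assms by (simp add: closed_Int_compact test_fun_def)
qed (use assms in \<open>auto simp: test_fun_def smooth_on_mult tsupp_outside\<close>)

lemma compact_reflected_sum:
  fixes S T :: "'a::real_normed_vector set"
  assumes "compact S" "compact T"
  shows "compact {x - y | x y. x \<in> S \<and> y \<in> T}"
proof -
  have "{x - y | x y. x \<in> S \<and> y \<in> T} = (\<lambda>(x, y). x - y) ` (S \<times> T)" by force
  then show ?thesis
    using assms by (auto intro!: compact_continuous_image compact_Times continuous_intros simp: case_prod_beta)
qed

lemma test_fun_affine:
  assumes "test_fun UNIV \<psi>" "c \<noteq> 0"
  shows "test_fun UNIV (\<lambda>t. \<psi> (a + c *\<^sub>R t))"
proof (rule test_funI[of _ "(\<lambda>y. (1 / c) *\<^sub>R (y - a)) ` tsupp \<psi>"])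
  show "compact ((\<lambda>y. (1 / c) *\<^sub>R (y - a)) ` tsupp \<psi>)"
    using assms by (intro compact_continuous_image continuous_intros) (simp add: test_fun_def)
  show "\<psi> (a + c *\<^sub>R t) = 0" if "t \<notin> (\<lambda>y. (1 / c) *\<^sub>R (y - a)) ` tsupp \<psi>" for t
  proof (rule tsupp_outside, rule notI)
    assume "a + c *\<^sub>R t \<in> tsupp \<psi>"
    then have "(1 / c) *\<^sub>R ((a + c *\<^sub>R t) - a) \<in> (\<lambda>y. (1 / c) *\<^sub>R (y - a)) ` tsupp \<psi>" by blast
    then show False using that assms by simp
  qed
qed (use assms in \<open>auto simp: test_fun_def smooth_on_affine\<close>)

lemma test_fun_reflect:
  assumes "test_fun UNIV \<psi>"
  shows "test_fun UNIV (\<lambda>t. \<psi> (x - t))"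
  using test_fun_affine[OF assms, of "-1" x] by simp

lemma smooth_on_reflect:
  assumes "smooth_on UNIV \<psi>"
  shows "smooth_on UNIV (\<lambda>t. \<psi> (x - t))"
    and "pds w (\<lambda>t. \<psi> (x - t)) t = (- 1) ^ length w * pds w \<psi> (x - t)"
  using smooth_on_affine[OF assms, where a = x and c = "-1"] by (simp_all add: scaleR_conv_of_real)

section \<open>Uniform bounds on derivatives of test functions\<close>

lemma finite_words: "finite {w :: 'n::finite list. length w \<le> m}"
  using finite_lists_length_le[of "UNIV :: 'n set" m] by simp

lemma pds_bounded_on_compact:
  assumes "smooth_on \<Omega> f" "compact K" "K \<subseteq> \<Omega>"
  obtains M where "M \<ge> 0" "\<And>w x. length w \<le> m \<Longrightarrow> x \<in> K \<Longrightarrow> norm (pds w f x) \<le> M"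
proof -
  have "bounded (\<Union>w\<in>{w. length w \<le> m}. pds w f ` K)"
    using assms by (intro bounded_UN finite_words ballI compact_imp_bounded compact_continuous_image)
      (auto intro: continuous_on_subset smooth_on_continuous)
  then obtain M where "\<And>y. y \<in> (\<Union>w\<in>{w. length w \<le> m}. pds w f ` K) \<Longrightarrow> norm y \<le> M"
    unfolding bounded_iff by blast
  then show ?thesis
    by (intro that[of "max M 0"]) (auto intro!: max.coboundedI1)
qed

lemma test_fun_bounded:
  assumes "test_fun \<Omega> \<tau>"
  obtains M where "M \<ge> 0" "\<And>w x. length w \<le> m \<Longrightarrow> norm (pds w \<tau> x) \<le> M"
proof -
  obtain M where "M \<ge> 0" "\<And>w x. length w \<le> m \<Longrightarrow> x \<in> tsupp \<tau> \<Longrightarrow> norm (pds w \<tau> x) \<le> M"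
    using pds_bounded_on_compact[of UNIV \<tau> "tsupp \<tau>" m] test_funD[OF assms] by blast
  then show ?thesis
    by (metis that norm_zero pds_outside_tsupp)
qed

text \<open>The total derivative is a sum of \<open>CARD('n)\<close> terms, each at most B *
  \<open>norm h\<close>.\<close>

lemma norm_le_lipschitz:
  fixes x y :: "real^'n::finite"
  assumes f: "smooth_on UNIV f" and B: "\<And>i z. norm (pds (i # w) f z) \<le> B"
  shows "norm (pds w f x - pds w f y) \<le> real CARD('n) * B * norm (x - y)"
proof (rule differentiable_bound[of UNIV])
  fix z :: "real^'n"
  show "(pds w f has_derivative (\<lambda>h. \<Sum>i\<in>UNIV. (h $ i) *\<^sub>R pds [i] (pds w f) z)) (at z within UNIV)"
    using smooth_on_has_derivative[OF open_UNIV smooth_on_pds[OF f], of z w] by simp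
  show "onorm (\<lambda>h. \<Sum>i\<in>UNIV. (h $ i) *\<^sub>R pds [i] (pds w f) z) \<le> real CARD('n) * B"
  proof (rule onorm_le)
    fix h :: "real^'n"
    have "norm (\<Sum>i\<in>UNIV. (h $ i) *\<^sub>R pds [i] (pds w f) z) \<le> (\<Sum>i\<in>(UNIV::'n set). norm h * B)"
    proof (rule sum_norm_le)
      show "norm ((h $ i) *\<^sub>R pds [i] (pds w f) z) \<le> norm h * B" for i
        using B[of i z] component_le_norm_cart[of h i] by (auto intro!: mult_mono)
    qed
    then show "norm (\<Sum>i\<in>UNIV. (h $ i) *\<^sub>R pds [i] (pds w f) z) \<le> real CARD('n) * B * norm h"
      by (simp add: mult.commute mult.left_commute)
  qed
qed auto

text \<open>
  Weaker than \<open>distribution\<close>, since \<open>\<tau>\<close> has to satisfy the bound along all words, not only along the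
  representatives chosen by \<open>mpd\<close>; in this form it passes to derivatives without reordering.
\<close>

definition wdist :: "(real^'n::finite) set \<Rightarrow> ('n cfun \<Rightarrow> complex) \<Rightarrow> bool" where
  "wdist \<Omega> T \<longleftrightarrow>
     (\<forall>\<tau>1 \<tau>2 a b. test_fun \<Omega> \<tau>1 \<longrightarrow> test_fun \<Omega> \<tau>2 \<longrightarrow>
        T (\<lambda>x. a * \<tau>1 x + b * \<tau>2 x) = a * T \<tau>1 + b * T \<tau>2) \<and>
     (\<forall>K. compact K \<longrightarrow> K \<subseteq> \<Omega> \<longrightarrow> (\<exists>C\<ge>0. \<exists>m. \<forall>\<tau> B. test_fun \<Omega> \<tau> \<longrightarrow> tsupp \<tau> \<subseteq> K \<longrightarrow>
        (\<forall>w x. length w \<le> m \<longrightarrow> norm (pds w \<tau> x) \<le> B) \<longrightarrow> norm (T \<tau>) \<le> C * B))"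

lemma wdist_linear:
  assumes "wdist \<Omega> T" "test_fun \<Omega> f" "test_fun \<Omega> g"
  shows "T (\<lambda>x. a * f x + b * g x) = a * T f + b * T g"
  using assms unfolding wdist_def by blast

lemma wdist_diff:
  assumes "wdist \<Omega> T" "test_fun \<Omega> f" "test_fun \<Omega> g"
  shows "T (\<lambda>x. f x - g x) = T f - T g"
  using wdist_linear[OF assms, of 1 "-1"] by simp

lemma wdist_zero: "wdist \<Omega> T \<Longrightarrow> T (\<lambda>_. 0) = 0"
  using wdist_linear[OF _ test_fun_zero test_fun_zero, of \<Omega> T 0 0] by simp

lemma wdist_bound:
  assumes "wdist \<Omega> T" "compact K" "K \<subseteq> \<Omega>"
  shows "\<exists>C\<ge>0. \<exists>m. \<forall>\<tau> B. test_fun \<Omega> \<tau> \<longrightarrow> tsupp \<tau> \<subseteq> K \<longrightarrow>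
      (\<forall>w x. length w \<le> m \<longrightarrow> norm (pds w \<tau> x) \<le> B) \<longrightarrow> norm (T \<tau>) \<le> C * B"
  using assms unfolding wdist_def by (elim conjE allE[of _ K] impE)

lemma distribution_imp_wdist:
  assumes "distribution \<Omega> T"
  shows "wdist \<Omega> T"
  unfolding wdist_def
proof (intro conjI allI impI)
  fix K assume K: "compact K" "K \<subseteq> \<Omega>"
  obtain C m where Cm: "\<forall>\<tau> B. test_fun \<Omega> \<tau> \<longrightarrow> tsupp \<tau> \<subseteq> K \<longrightarrow>
      (\<forall>\<alpha> x. mdeg \<alpha> \<le> m \<longrightarrow> norm (mpd \<alpha> \<tau> x) \<le> B) \<longrightarrow> norm (T \<tau>) \<le> C * B"
    using assms K unfolding distribution_def by blast
  show "\<exists>C\<ge>0. \<exists>m. \<forall>\<tau> B. test_fun \<Omega> \<tau> \<longrightarrow> tsupp \<tau> \<subseteq> K \<longrightarrow>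
        (\<forall>w x. length w \<le> m \<longrightarrow> norm (pds w \<tau> x) \<le> B) \<longrightarrow> norm (T \<tau>) \<le> C * B"
  proof (intro exI[of _ "max C 0"] exI[of _ m] conjI allI impI)
    fix \<tau> :: "'a cfun" and B
    assume \<tau>: "test_fun \<Omega> \<tau>" "tsupp \<tau> \<subseteq> K" and B: "\<forall>w x. length w \<le> m \<longrightarrow> norm (pds w \<tau> x) \<le> B"
    have "0 \<le> B" using B[rule_format, of "[]" 0] norm_ge_zero[of "\<tau> 0"] by (simp del: norm_ge_zero)
    have "norm (T \<tau>) \<le> C * B"
      by (rule Cm[rule_format, OF \<tau>]) (use B in \<open>simp add: mpd_mword length_mword\<close>)
    also have "\<dots> \<le> max C 0 * B"
      using \<open>0 \<le> B\<close> by (intro mult_right_mono) auto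
    finally show "norm (T \<tau>) \<le> max C 0 * B" .
  qed simp
qed (use assms in \<open>auto simp: distribution_def\<close>)

text \<open>With c as sign this covers the distributional derivatives. Words simply concatenate, so
  bounding words up to length m + \<open>length u\<close> for \<tau> bounds words up to length m for
  its derivative.\<close>

lemma wdist_pds:
  assumes "wdist \<Omega> T"
  shows "wdist \<Omega> (\<lambda>\<tau>. c * T (pds u \<tau>))"
  unfolding wdist_def
proof (intro conjI allI impI)
  fix f g :: "'a cfun" and a b
  assume fg: "test_fun \<Omega> f" "test_fun \<Omega> g"
  have "pds u (\<lambda>x. a * f x + b * g x) = (\<lambda>x. a * pds u f x + b * pds u g x)"
    using smooth_on_lincomb(2)[OF open_UNIV, of f g] fg by (auto simp: test_funD)
  then show "c * T (pds u (\<lambda>x. a * f x + b * g x)) = a * (c * T (pds u f)) + b * (c * T (pds u g))"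
    using wdist_linear[OF assms test_fun_pds[OF fg(1)] test_fun_pds[OF fg(2)]]
    by (simp add: algebra_simps)
next
  fix K assume K: "compact K" "K \<subseteq> \<Omega>"
  obtain C m where "C \<ge> 0" and Cm: "\<forall>\<tau> B. test_fun \<Omega> \<tau> \<longrightarrow> tsupp \<tau> \<subseteq> K \<longrightarrow>
      (\<forall>w x. length w \<le> m \<longrightarrow> norm (pds w \<tau> x) \<le> B) \<longrightarrow> norm (T \<tau>) \<le> C * B"
    using wdist_bound[OF assms K] by blast
  show "\<exists>C\<ge>0. \<exists>m. \<forall>\<tau> B. test_fun \<Omega> \<tau> \<longrightarrow> tsupp \<tau> \<subseteq> K \<longrightarrow>
        (\<forall>w x. length w \<le> m \<longrightarrow> norm (pds w \<tau> x) \<le> B) \<longrightarrow> norm (c * T (pds u \<tau>)) \<le> C * B"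
  proof (intro exI[of _ "norm c * C"] exI[of _ "m + length u"] conjI allI impI)
    fix \<tau> :: "'a cfun" and B
    assume \<tau>: "test_fun \<Omega> \<tau>" "tsupp \<tau> \<subseteq> K"
      and B: "\<forall>w x. length w \<le> m + length u \<longrightarrow> norm (pds w \<tau> x) \<le> B"
    have "norm (T (pds u \<tau>)) \<le> C * B"
    proof (rule Cm[rule_format, OF test_fun_pds[OF \<tau>(1)]])
      show "tsupp (pds u \<tau>) \<subseteq> K" using tsupp_pds \<tau> by blast
      show "norm (pds w (pds u \<tau>) x) \<le> B" if "length w \<le> m" for w x
        using B that by (simp flip: pds_append)
    qed
    then show "norm (c * T (pds u \<tau>)) \<le> norm c * C * B"
      by (simp add: norm_mult mult_left_mono mult.assoc)
  qed (use \<open>C \<ge> 0\<close> in simp)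
qed

text \<open>Lets \<eta> be smooth on the whole space and puts the burden of being supported in
  \<Omega> on c. The derivatives of c enter the constant through the Leibniz factor 2 ^ m * A.
  Vanishing off L is asked on the support of c alone, so for compactly supported c the set L can be
  that support.\<close>

lemma wdist_mult_bound:
  assumes T: "wdist \<Omega> T" and c: "smooth_on UNIV c" "tsupp c \<subseteq> \<Omega>" and "compact L"
  shows "\<exists>C\<ge>0. \<exists>m. \<forall>\<eta> B. smooth_on UNIV \<eta> \<longrightarrow> (\<forall>t. t \<in> tsupp c \<longrightarrow> t \<notin> L \<longrightarrow> \<eta> t = 0) \<longrightarrow>
      (\<forall>v t. length v \<le> m \<longrightarrow> norm (pds v \<eta> t) \<le> B) \<longrightarrow> norm (T (\<lambda>t. c t * \<eta> t)) \<le> C * B"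
proof -
  define K where "K = tsupp c \<inter> L"
  have K: "compact K" "K \<subseteq> \<Omega>"
    using c \<open>compact L\<close> by (auto simp: K_def closed_Int_compact)
  obtain C m where "C \<ge> 0" and Cm: "\<forall>\<tau> B. test_fun \<Omega> \<tau> \<longrightarrow> tsupp \<tau> \<subseteq> K \<longrightarrow>
      (\<forall>w x. length w \<le> m \<longrightarrow> norm (pds w \<tau> x) \<le> B) \<longrightarrow> norm (T \<tau>) \<le> C * B"
    using wdist_bound[OF T K] by blast
  obtain A where "A \<ge> 0" and A: "\<And>w x. length w \<le> m \<Longrightarrow> x \<in> K \<Longrightarrow> norm (pds w c x) \<le> A"
    using pds_bounded_on_compact[OF c(1) K(1)] by (metis UNIV_I subsetI)
  show ?thesis
  proof (intro exI[of _ "C * (2 ^ m * A)"] exI[of _ m] conjI allI impI)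
    fix \<eta> :: "'a cfun" and B
    assume \<eta>: "smooth_on UNIV \<eta>" "\<forall>t. t \<in> tsupp c \<longrightarrow> t \<notin> L \<longrightarrow> \<eta> t = 0"
      and B': "\<forall>v t. length v \<le> m \<longrightarrow> norm (pds v \<eta> t) \<le> B"
    note B = B'[rule_format]
    have "0 \<le> B" using order_trans[OF norm_ge_zero B[of "[]"]] by simp
    have K0: "c t * \<eta> t = 0" if "t \<notin> K" for t
      using that \<eta>(2) tsupp_outside[of t c] by (auto simp: K_def)
    have test: "test_fun \<Omega> (\<lambda>t. c t * \<eta> t)"
      by (rule test_funI[OF _ K K0]) (simp_all add: smooth_on_mult c \<eta>)
    have supp: "tsupp (\<lambda>t. c t * \<eta> t) \<subseteq> K"
      using K K0 by (intro tsupp_subset) (auto intro: compact_imp_closed)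
    have "norm (T (\<lambda>t. c t * \<eta> t)) \<le> C * (2 ^ m * A * B)"
    proof (rule Cm[rule_format, OF test supp])
      fix w :: "'a list" and x assume w: "length w \<le> m"
      show "norm (pds w (\<lambda>t. c t * \<eta> t) x) \<le> 2 ^ m * A * B"
      proof (cases "x \<in> K")
        case True
        have "norm (pds w (\<lambda>t. c t * \<eta> t) x) \<le> 2 ^ length w * A * B"
          using w True by (intro pds_mult_bound[OF open_UNIV c(1) \<eta>(1)] A B) auto
        also have "\<dots> \<le> 2 ^ m * A * B"
          using \<open>A \<ge> 0\<close> \<open>B \<ge> 0\<close> w by (intro mult_right_mono power_increasing) auto
        finally show ?thesis .
      next
        case False
        then have "pds w (\<lambda>t. c t * \<eta> t) x = 0"
          using supp by (intro pds_outside_tsupp) auto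
        then show ?thesis using \<open>A \<ge> 0\<close> \<open>B \<ge> 0\<close> by simp
      qed
    qed
    then show "norm (T (\<lambda>t. c t * \<eta> t)) \<le> C * (2 ^ m * A) * B"
      by (simp add: mult.assoc)
  qed (use \<open>C \<ge> 0\<close> \<open>A \<ge> 0\<close> in simp)
qed

text \<open>A quadratic remainder is what the seminorm bound of T delivers for a second-order Taylor
  remainder of the kernel.\<close>

lemma has_vector_derivative_quadratic:
  fixes f :: "real \<Rightarrow> 'b::real_normed_vector"
  assumes bound: "\<And>h. \<bar>h\<bar> \<le> 1 \<Longrightarrow> norm (f h - f 0 - h *\<^sub>R d) \<le> c * h\<^sup>2"
  shows "(f has_vector_derivative d) (at 0)"
  unfolding has_vector_derivative_def has_derivative_at_alt
proof (intro conjI allI impI)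
  show "bounded_linear (\<lambda>x. x *\<^sub>R d)" by (rule bounded_linear_scaleR_left)
  fix e :: real assume "e > 0"
  show "\<exists>\<delta>>0. \<forall>y. norm (y - 0) < \<delta> \<longrightarrow> norm (f y - f 0 - (y - 0) *\<^sub>R d) \<le> e * norm (y - 0)"
  proof (intro exI[of _ "min 1 (e / (\<bar>c\<bar> + 1))"] conjI allI impI)
    show "0 < min 1 (e / (\<bar>c\<bar> + 1))" using \<open>e > 0\<close> by simp
    fix y :: real assume y: "norm (y - 0) < min 1 (e / (\<bar>c\<bar> + 1))"
    then have "norm (f y - f 0 - y *\<^sub>R d) \<le> c * y\<^sup>2" by (intro bound) simp
    also have "\<dots> = c * \<bar>y\<bar> * \<bar>y\<bar>" by (simp add: power2_eq_square)
    also have "c * \<bar>y\<bar> \<le> (\<bar>c\<bar> + 1) * (e / (\<bar>c\<bar> + 1))"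
      using y by (intro mult_mono) auto
    also have "\<dots> = e" by simp
    finally show "norm (f y - f 0 - (y - 0) *\<^sub>R d) \<le> e * norm (y - 0)"
      by (simp add: mult_right_mono)
  qed
qed

text \<open>Differentiation under T. All derivatives up to order m of the kernel's difference
  quotient remainder are O(h^2) uniformly in t, and T turns this into a quadratic remainder of its
  values. The factor c is the cut-off for the embedding and the constant 1 for ordinary
  mollification.\<close>

lemma smooth_conv:
  fixes c \<psi> :: "'n::finite cfun"
  assumes T: "wdist \<Omega> T" and c: "smooth_on UNIV c" "tsupp c \<subseteq> \<Omega>" and \<psi>: "test_fun UNIV \<psi>"
  shows "smooth_on UNIV (\<lambda>x. T (\<lambda>t. c t * \<psi> (x - t)))"
    and "pds w (\<lambda>x. T (\<lambda>t. c t * \<psi> (x - t))) x = T (\<lambda>t. c t * pds w \<psi> (x - t))"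
proof -
  let ?F = "\<lambda>w x. T (\<lambda>t. c t * pds w \<psi> (x - t))"
  have test: "test_fun \<Omega> (\<lambda>t. c t * pds w \<psi> (x - t))" for w x
    by (rule test_fun_mult[OF c test_fun_reflect[OF test_fun_pds[OF \<psi>]]])
  have smooth_r: "smooth_on UNIV (\<lambda>t. pds w \<psi> (x - t))" for w x
    by (rule smooth_on_reflect(1)[OF smooth_on_pds[OF test_funD(1)[OF \<psi>]]])
  have pds_r: "pds v (\<lambda>t. pds w \<psi> (x - t)) t = (- 1) ^ length v * pds v (pds w \<psi>) (x - t)" for v w x t
    by (rule smooth_on_reflect(2)[OF smooth_on_pds[OF test_funD(1)[OF \<psi>]]])
  \<comment> \<open>\<open>L x0\<close> contains the supports of all kernels with x within distance
    1 of x0, so a single seminorm bound of T serves every increment with \<bar>h\<bar> \<le>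
    1.\<close>
  define L where "L x0 = {x - y | x y. x \<in> cball x0 1 \<and> y \<in> tsupp \<psi>}" for x0
  have L: "compact (L x0)" for x0
    unfolding L_def using \<psi> by (intro compact_reflected_sum) (auto simp: test_fun_def)
  have Lout: "pds w \<psi> (x - t) = 0" if "t \<notin> L x0" "x \<in> cball x0 1" for w x x0 t
  proof (rule pds_outside_tsupp)
    show "x - t \<notin> tsupp \<psi>"
    proof
      assume "x - t \<in> tsupp \<psi>"
      then have "x - (x - t) \<in> L x0"
        unfolding L_def using that(2) by (intro CollectI exI[of _ x] exI[of _ "x - t"]) simp
      then show False using that(1) by simp
    qed
  qed
  have cont: "continuous_on UNIV (?F w)" for w
  proof -
    have "isCont (?F w) x0" for x0
    proof -
      obtain C m where "C \<ge> 0" and C: "\<forall>\<eta> B. smooth_on UNIV \<eta> \<longrightarrow> (\<forall>t. t \<in> tsupp c \<longrightarrow> t \<notin> L x0 \<longrightarrow> \<eta> t = 0) \<longrightarrow>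
        (\<forall>v t. length v \<le> m \<longrightarrow> norm (pds v \<eta> t) \<le> B) \<longrightarrow> norm (T (\<lambda>t. c t * \<eta> t)) \<le> C * B"
        using wdist_mult_bound[OF T c L[of x0]] by blast
      obtain M where "M \<ge> 0" and M: "\<And>v x. length v \<le> Suc (m + length w) \<Longrightarrow> norm (pds v \<psi> x) \<le> M"
        by (rule test_fun_bounded[OF \<psi>, of "Suc (m + length w)"]) (rule that)
      let ?M = "C * (real CARD('n) * M)"
      have lip: "norm (?F w x - ?F w x0) \<le> ?M * norm (x - x0)" if "x \<in> cball x0 1" for x
      proof -
        have "?F w x - ?F w x0 = T (\<lambda>t. c t * pds w \<psi> (x - t) - c t * pds w \<psi> (x0 - t))"
          by (rule wdist_diff[OF T test test, symmetric])
        also have "\<dots> = T (\<lambda>t. c t * (pds w \<psi> (x - t) - pds w \<psi> (x0 - t)))"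
          by (simp add: right_diff_distrib)
        also have "norm \<dots> \<le> C * (real CARD('n) * M * norm (x - x0))"
        proof (rule C[rule_format])
          show "smooth_on UNIV (\<lambda>t. pds w \<psi> (x - t) - pds w \<psi> (x0 - t))"
            by (intro smooth_on_diff smooth_r open_UNIV)
          show "pds w \<psi> (x - t) - pds w \<psi> (x0 - t) = 0" if "t \<notin> L x0" for t
            using Lout[OF that] \<open>x \<in> cball x0 1\<close> by simp
          fix v :: "'n list" and t assume v: "length v \<le> m"
          have "pds v (\<lambda>t. pds w \<psi> (x - t) - pds w \<psi> (x0 - t)) t
              = (- 1) ^ length v * (pds (v @ w) \<psi> (x - t) - pds (v @ w) \<psi> (x0 - t))"
            unfolding smooth_on_diff(2)[OF open_UNIV smooth_r smooth_r UNIV_I] pds_r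
            by (simp add: pds_append right_diff_distrib)
          also have "norm \<dots> \<le> real CARD('n) * M * norm ((x - t) - (x0 - t))"
            unfolding norm_mult norm_power
            using norm_le_lipschitz[OF test_funD(1)[OF \<psi>] M, of "v @ w" "x - t" "x0 - t"] v by simp
          finally show "norm (pds v (\<lambda>t. pds w \<psi> (x - t) - pds w \<psi> (x0 - t)) t)
              \<le> real CARD('n) * M * norm (x - x0)" by simp
        qed
        finally show ?thesis by (simp add: mult.assoc)
      qed
      have "((\<lambda>x. ?M * norm (x - x0)) \<longlongrightarrow> 0) (at x0)"
        by (auto intro!: tendsto_eq_intros)
      moreover have "\<forall>\<^sub>F x in at x0. norm (?F w x - ?F w x0) \<le> ?M * norm (x - x0)"
        using eventually_at_ball[OF zero_less_one, of x0 UNIV]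
        by eventually_elim (auto intro!: lip)
      ultimately have "((\<lambda>x. ?F w x - ?F w x0) \<longlongrightarrow> 0) (at x0)"
        by (rule Lim_null_comparison[rotated])
      then show ?thesis
        unfolding isCont_def by (simp add: LIM_zero_iff)
    qed
    then show ?thesis by (simp add: continuous_at_imp_continuous_on)
  qed
  have der: "((\<lambda>h. ?F w (x0 + h *\<^sub>R axis i 1)) has_vector_derivative ?F (i # w) x0) (at 0)" for w i x0
  proof -
    obtain C m where "C \<ge> 0" and C: "\<forall>\<eta> B. smooth_on UNIV \<eta> \<longrightarrow> (\<forall>t. t \<in> tsupp c \<longrightarrow> t \<notin> L x0 \<longrightarrow> \<eta> t = 0) \<longrightarrow>
      (\<forall>v t. length v \<le> m \<longrightarrow> norm (pds v \<eta> t) \<le> B) \<longrightarrow> norm (T (\<lambda>t. c t * \<eta> t)) \<le> C * B"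
      using wdist_mult_bound[OF T c L[of x0]] by blast
    obtain M where "M \<ge> 0" and M: "\<And>v x. length v \<le> m + length w + 2 \<Longrightarrow> norm (pds v \<psi> x) \<le> M"
      by (rule test_fun_bounded[OF \<psi>, of "m + length w + 2"]) (rule that)
    have "norm (?F w (x0 + h *\<^sub>R axis i 1) - ?F w (x0 + 0 *\<^sub>R axis i 1) - h *\<^sub>R ?F (i # w) x0) \<le> C * M * h\<^sup>2"
      if h: "\<bar>h\<bar> \<le> 1" for h
    proof -
      let ?x = "x0 + h *\<^sub>R axis i 1"
      let ?\<eta> = "\<lambda>t. (1 * (pds w \<psi> (?x - t) - pds w \<psi> (x0 - t)) + (- of_real h) * pds (i # w) \<psi> (x0 - t))"
      have xin: "?x \<in> cball x0 1" using h by (simp add: dist_norm)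
      have "?F w ?x - ?F w x0 - h *\<^sub>R ?F (i # w) x0
          = 1 * T (\<lambda>t. c t * pds w \<psi> (?x - t) - c t * pds w \<psi> (x0 - t)) + (- of_real h) * ?F (i # w) x0"
        unfolding wdist_diff[OF T test test] by (simp add: scaleR_conv_of_real)
      also have "\<dots> = T (\<lambda>t. 1 * (c t * pds w \<psi> (?x - t) - c t * pds w \<psi> (x0 - t))
          + (- of_real h) * (c t * pds (i # w) \<psi> (x0 - t)))"
        by (rule wdist_linear[OF T test_fun_diff[OF test test] test, symmetric])
      also have "\<dots> = T (\<lambda>t. c t * ?\<eta> t)"
        by (simp add: algebra_simps)
      also have "norm \<dots> \<le> C * (M * h\<^sup>2)"
      proof (rule C[rule_format])
        show "smooth_on UNIV ?\<eta>"
          by (intro smooth_on_lincomb smooth_on_diff smooth_r open_UNIV)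
        show "?\<eta> t = 0" if "t \<notin> L x0" for t
          using Lout[OF that xin] Lout[OF that, of x0 w] Lout[OF that, of x0 "i # w"] by simp
        fix v :: "'n list" and t assume v: "length v \<le> m"
        \<comment> \<open>The letter i has to be outermost for the remainder to be an increment of
          \<open>pds (v @ w) \<psi>\<close> along axis i; this is where derivatives are
          exchanged.\<close>
        have comm: "pds v (pds (i # w) \<psi>) = pds (i # v @ w) \<psi>"
          using pds_snoc[OF smooth_on_pds[OF test_funD(1)[OF \<psi>]], of v i w]
          by (simp add: pds_append)
        have eq: "pds v ?\<eta> t
            = (- 1) ^ length v * (pds (v @ w) \<psi> (?x - t) - pds (v @ w) \<psi> (x0 - t) - h *\<^sub>R pds (i # v @ w) \<psi> (x0 - t))"
          unfolding smooth_on_lincomb(2)[OF open_UNIV smooth_on_diff(1)[OF open_UNIV smooth_r smooth_r] smooth_r UNIV_I]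
            smooth_on_diff(2)[OF open_UNIV smooth_r smooth_r UNIV_I] pds_r comm
          by (simp add: pds_append right_diff_distrib scaleR_conv_of_real algebra_simps)
        have bound: "norm (pds (v @ w) \<psi> ((x0 - t) + h *\<^sub>R axis i 1) - pds (v @ w) \<psi> (x0 - t)
            - h *\<^sub>R pds (i # v @ w) \<psi> (x0 - t)) \<le> (M * \<bar>h\<bar>) * \<bar>h\<bar>"
        proof (rule axis_segment_bound[OF test_funD(1)[OF \<psi>]])
          fix s assume s: "s \<in> closed_segment 0 h"
          \<comment> \<open>With d = 0 the increment bound is a Lipschitz estimate; fed into the
            outer increment bound it produces the second factor \<bar>h\<bar>.\<close>
          have "norm (pds (i # v @ w) \<psi> ((x0 - t) + s *\<^sub>R axis i 1) - pds (i # v @ w) \<psi> (x0 - t) - s *\<^sub>R 0) \<le> M * \<bar>s\<bar>"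
            by (rule axis_segment_bound[OF test_funD(1)[OF \<psi>]]) (use M[of "i # i # v @ w"] v in auto)
          also have "\<dots> \<le> M * \<bar>h\<bar>"
            using closed_segment_0_abs[OF s] \<open>M \<ge> 0\<close> by (simp add: mult_left_mono)
          finally show "norm (pds (i # v @ w) \<psi> ((x0 - t) + s *\<^sub>R axis i 1) - pds (i # v @ w) \<psi> (x0 - t)) \<le> M * \<bar>h\<bar>"
            by simp
        qed auto
        have shift: "?x - t = (x0 - t) + h *\<^sub>R axis i 1" by simp
        show "norm (pds v ?\<eta> t) \<le> M * h\<^sup>2"
          unfolding eq shift norm_mult norm_power using bound by (simp add: power2_eq_square mult.assoc)
      qed
      finally show ?thesis by (simp add: mult.assoc)
    qed
    then show ?thesis by (rule has_vector_derivative_quadratic)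
  qed
  show "smooth_on UNIV (\<lambda>x. T (\<lambda>t. c t * \<psi> (x - t)))"
    by (rule smooth_on_jet(1)[of UNIV ?F]) (use cont der in auto)
  show "pds w (\<lambda>x. T (\<lambda>t. c t * \<psi> (x - t))) x = ?F w x"
    by (rule smooth_on_jet(2)[of UNIV ?F]) (use cont der in auto)
qed

subsection \<open>Locally integrable functions, mollified indicators and the cut-off\<close>

lemma integral_zero_outside:
  fixes h :: "'a::euclidean_space \<Rightarrow> 'b::euclidean_space"
  assumes "K \<subseteq> \<Omega>" "\<And>x. x \<in> \<Omega> \<Longrightarrow> x \<notin> K \<Longrightarrow> h x = 0"
  shows "integral \<Omega> h = integral K h"
    and "h absolutely_integrable_on \<Omega> \<longleftrightarrow> h absolutely_integrable_on K"
proof -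
  have "(\<lambda>x. if x \<in> \<Omega> then h x else 0) = (\<lambda>x. if x \<in> K then h x else 0)"
    using assms by (auto simp: fun_eq_iff)
  then show "integral \<Omega> h = integral K h"
    "h absolutely_integrable_on \<Omega> \<longleftrightarrow> h absolutely_integrable_on K"
    using integral_restrict_UNIV[of \<Omega> h] integral_restrict_UNIV[of K h]
      absolutely_integrable_restrict_UNIV[of \<Omega> h] absolutely_integrable_restrict_UNIV[of K h]
    by simp_all
qed

lemma continuous_absolutely_integrable_compact:
  fixes f :: "'a::euclidean_space \<Rightarrow> 'b::euclidean_space"
  assumes "compact K" "continuous_on K f"
  shows "f absolutely_integrable_on K"
proof -
  obtain B where B: "\<And>x. x \<in> K \<Longrightarrow> norm (f x) \<le> B"
    using compact_imp_bounded[OF compact_continuous_image[OF assms(2,1)]]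
    by (auto simp: bounded_iff)
  have K: "K \<in> lmeasurable" by (rule lmeasurable_compact[OF assms(1)])
  show ?thesis
  proof (rule measurable_bounded_by_integrable_imp_absolutely_integrable)
    show "f \<in> borel_measurable (lebesgue_on K)"
      by (rule continuous_imp_measurable_on_sets_lebesgue) (use assms K in auto)
    show "(\<lambda>x. B) integrable_on K" by (rule integrable_on_const[OF K])
  qed (use B K in auto)
qed

lemma smooth_on_loc_int: "smooth_on \<Omega> f \<Longrightarrow> loc_int \<Omega> f"
  using continuous_on_subset smooth_on_continuous[of \<Omega> f "[]"]
  by (auto simp: loc_int_def intro!: continuous_absolutely_integrable_compact)

lemma loc_int_mult:
  assumes "loc_int \<Omega> f" "compact K" "K \<subseteq> \<Omega>" "continuous_on K \<tau>" "\<And>x. x \<in> \<Omega> \<Longrightarrow> x \<notin> K \<Longrightarrow> \<tau> x = 0"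
  shows "(\<lambda>x. f x * \<tau> x) absolutely_integrable_on K" "(\<lambda>x. f x * \<tau> x) absolutely_integrable_on \<Omega>"
    and "integral \<Omega> (\<lambda>x. f x * \<tau> x) = integral K (\<lambda>x. f x * \<tau> x)"
proof -
  have "(\<lambda>x. \<tau> x * f x) absolutely_integrable_on K"
  proof (rule absolutely_integrable_bounded_measurable_product[OF bilinear_times])
    show "\<tau> \<in> borel_measurable (lebesgue_on K)"
      by (rule continuous_imp_measurable_on_sets_lebesgue)
        (use assms lmeasurable_compact in auto)
    show "bounded (\<tau> ` K)"
      by (intro compact_imp_bounded compact_continuous_image assms)
  qed (use assms lmeasurable_compact[THEN fmeasurableD] in \<open>auto simp: loc_int_def\<close>)
  then show int: "(\<lambda>x. f x * \<tau> x) absolutely_integrable_on K" by (simp add: mult.commute)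
  show "integral \<Omega> (\<lambda>x. f x * \<tau> x) = integral K (\<lambda>x. f x * \<tau> x)"
    by (rule integral_zero_outside) (use assms in auto)
  show "(\<lambda>x. f x * \<tau> x) absolutely_integrable_on \<Omega>"
    using integral_zero_outside(2)[of K \<Omega> "\<lambda>x. f x * \<tau> x"] int assms by auto
qed

lemma loc_int_mult_test:
  assumes "loc_int \<Omega> f" "test_fun \<Omega> \<tau>"
  shows "(\<lambda>x. f x * \<tau> x) absolutely_integrable_on \<Omega>"
proof (rule loc_int_mult(2)[OF assms(1), of "tsupp \<tau>"])
  show "continuous_on (tsupp \<tau>) \<tau>"
    using smooth_on_continuous[OF test_funD(1)[OF assms(2)], of "[]"] by (auto intro: continuous_on_subset)
qed (use assms in \<open>auto simp: test_fun_def tsupp_outside\<close>)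

lemma distribution_Lemb:
  assumes f: "loc_int \<Omega> f"
  shows "distribution \<Omega> (Lemb \<Omega> f)"
  unfolding distribution_def
proof (intro conjI allI impI)
  fix \<tau>1 \<tau>2 a b
  assume *: "test_fun \<Omega> \<tau>1" "test_fun \<Omega> \<tau>2"
  have i: "(\<lambda>x. f x * \<tau>1 x) integrable_on \<Omega>" "(\<lambda>x. f x * \<tau>2 x) integrable_on \<Omega>"
    using loc_int_mult_test[OF f *(1)] loc_int_mult_test[OF f *(2)]
    by (auto dest: absolutely_integrable_on_def[THEN iffD1])
  have "(\<lambda>x. f x * (a * \<tau>1 x + b * \<tau>2 x)) = (\<lambda>x. a * (f x * \<tau>1 x) + b * (f x * \<tau>2 x))"
    by (simp add: algebra_simps fun_eq_iff)
  then show "Lemb \<Omega> f (\<lambda>x. a * \<tau>1 x + b * \<tau>2 x) = a * Lemb \<Omega> f \<tau>1 + b * Lemb \<Omega> f \<tau>2"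
    unfolding Lemb_def
    using i by (simp add: integral_add integrable_on_mult_right)
next
  fix K assume K: "compact K \<and> K \<subseteq> \<Omega>"
  have fK: "f absolutely_integrable_on K" using f K by (auto simp: loc_int_def)
  show "\<exists>C m. \<forall>\<tau> B. test_fun \<Omega> \<tau> \<longrightarrow> tsupp \<tau> \<subseteq> K \<longrightarrow>
        (\<forall>\<alpha> x. mdeg \<alpha> \<le> m \<longrightarrow> norm (mpd \<alpha> \<tau> x) \<le> B) \<longrightarrow> norm (Lemb \<Omega> f \<tau>) \<le> C * B"
  \<comment> \<open>A regular distribution has order 0: the L1 norm of f on K times the sup norm of
    \<tau> suffices.\<close>
  proof (intro exI[of _ "integral K (\<lambda>x. norm (f x))"] exI[of _ 0] allI impI)
    fix \<tau> B assume \<tau>: "test_fun \<Omega> \<tau>" "tsupp \<tau> \<subseteq> K"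
      and B: "\<forall>\<alpha> x. mdeg \<alpha> \<le> 0 \<longrightarrow> norm (mpd \<alpha> \<tau> x) \<le> B"
    have B': "norm (\<tau> x) \<le> B" for x
      using B[rule_format, of "\<lambda>_. 0" x] by (simp add: mdeg_def mpd_zero_index)
    have cont: "continuous_on K \<tau>"
      using smooth_on_continuous[OF test_funD(1)[OF \<tau>(1)], of "[]"] by (auto intro: continuous_on_subset)
    note m = loc_int_mult[OF f _ _ cont, OF conjunct1[OF K] conjunct2[OF K]]
    have z: "\<tau> x = 0" if "x \<notin> K" for x using \<tau> that by (auto intro: tsupp_outside)
    have "norm (Lemb \<Omega> f \<tau>) = norm (integral K (\<lambda>x. f x * \<tau> x))"
      unfolding Lemb_def using m(3) z by simp
    also have "\<dots> \<le> integral K (\<lambda>x. norm (f x) * B)"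
    proof (rule integral_norm_bound_integral)
      show "(\<lambda>x. f x * \<tau> x) integrable_on K"
        using m(1) z by (auto dest: absolutely_integrable_on_def[THEN iffD1])
      show "(\<lambda>x. norm (f x) * B) integrable_on K"
        using fK by (intro integrable_on_mult_left) (auto dest: absolutely_integrable_on_def[THEN iffD1])
      show "norm (f x * \<tau> x) \<le> norm (f x) * B" for x
        using B' by (simp add: norm_mult mult_left_mono)
    qed
    finally show "norm (Lemb \<Omega> f \<tau>) \<le> integral K (\<lambda>x. norm (f x)) * B"
      by simp
  qed
qed

lemmas wdist_Lemb = distribution_imp_wdist[OF distribution_Lemb]

lemma continuous_compact_support_integrable:
  fixes f :: "'a::euclidean_space \<Rightarrow> 'b::euclidean_space"
  assumes "continuous_on UNIV f" "compact K" "\<And>x. x \<notin> K \<Longrightarrow> f x = 0"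
  shows "f absolutely_integrable_on UNIV"
  using continuous_absolutely_integrable_compact[OF assms(2), of f] assms(1,3)
    integral_zero_outside(2)[of K UNIV f] continuous_on_subset by blast

lemma integral_reflect_translate:
  fixes f :: "'a::euclidean_space \<Rightarrow> 'b::euclidean_space"
  assumes "continuous_on UNIV f" "compact K" "\<And>x. x \<notin> K \<Longrightarrow> f x = 0"
  shows "integral UNIV (\<lambda>t. f (x - t)) = integral UNIV f"
proof -
  obtain a b where ab: "K \<subseteq> cbox a b"
    using compact_imp_bounded[OF assms(2)] bounded_subset_cbox_symmetric by metis
  define I where "I = integral (cbox a b) f"
  have f: "(f has_integral I) (cbox a b)"
    unfolding I_def using assms(1) continuous_on_subset
    by (intro integrable_integral integrable_continuous) blast
  have "((\<lambda>t. f ((- 1) *\<^sub>R t + x)) has_integral I) ((\<lambda>t. (1 / (- 1)) *\<^sub>R t + - ((1 / (- 1)) *\<^sub>R x)) ` cbox a b)"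
    using has_integral_affinity[OF f, of "-1" x] by simp
  then have "((\<lambda>t. f (x - t)) has_integral I) ((\<lambda>t. x - t) ` cbox a b)"
    by (simp add: image_def)
  then have "((\<lambda>t. f (x - t)) has_integral I) UNIV"
  proof (rule has_integral_on_superset)
    show "f (x - t) = 0" if "t \<notin> (\<lambda>t. x - t) ` cbox a b" for t
    proof (rule assms(3), rule notI)
      assume "x - t \<in> K"
      then have "x - (x - t) \<in> (\<lambda>t. x - t) ` cbox a b" using ab by blast
      with that show False by simp
    qed
  qed auto
  moreover have "(f has_integral I) UNIV"
    by (rule has_integral_on_superset[OF f]) (use ab assms(3) in auto)
  ultimately show ?thesis by (simp add: integral_unique)
qed

lemma test_fun_continuous: "test_fun \<Omega> \<phi> \<Longrightarrow> continuous_on S (pds w \<phi>)"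
  using smooth_on_continuous[of UNIV \<phi> w] by (auto simp: test_fun_def intro: continuous_on_subset)

lemma test_fun_continuous':
  "test_fun UNIV \<phi> \<Longrightarrow> continuous_on S g \<Longrightarrow> continuous_on S (\<lambda>x. \<phi> (g x))"
  using continuous_on_compose2[OF test_fun_continuous[of UNIV \<phi> UNIV "[]"], of S g] by simp

lemma test_fun_mult_integrable:
  fixes \<phi> :: "'n::finite cfun" and g :: "'n cfun"
  assumes "test_fun UNIV \<phi>" "continuous_on UNIV g"
  shows "(\<lambda>y. \<phi> y * g y) absolutely_integrable_on UNIV"
  by (rule continuous_compact_support_integrable[of _ "tsupp \<phi>"])
    (use assms test_fun_continuous'[OF assms(1) continuous_on_id] in
      \<open>auto simp: test_fun_def tsupp_outside intro!: continuous_on_mult\<close>)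

lemma test_fun_norm_integrable:
  assumes "test_fun UNIV \<phi>"
  shows "(\<lambda>y. norm (\<phi> y)) absolutely_integrable_on UNIV"
  by (rule continuous_compact_support_integrable[of _ "tsupp \<phi>"])
    (use assms test_fun_continuous'[OF assms continuous_on_id] in
      \<open>auto simp: test_fun_def tsupp_outside intro!: continuous_on_norm\<close>)

section \<open>The radius, mollified indicators and the cut-off\<close>

lemma Rad_bound:
  assumes "test_fun UNIV \<phi>" "Rad \<phi> < norm x"
  shows "\<phi> x = 0"
proof (rule ccontr)
  assume "\<phi> x \<noteq> 0"
  then have "\<phi> \<noteq> (\<lambda>_. 0)" by auto
  have "bounded (tsupp \<phi>)" using assms by (auto simp: test_fun_def compact_imp_bounded)
  then obtain B where "\<And>y. y \<in> tsupp \<phi> \<Longrightarrow> norm y \<le> B" by (auto simp: bounded_iff)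
  then have "bdd_above (norm ` {y. \<phi> y \<noteq> 0})"
    by (intro bdd_aboveI[of _ B]) (use tsupp_outside in auto)
  then have "norm x \<le> Rad \<phi>"
    unfolding Rad_def using \<open>\<phi> x \<noteq> 0\<close> \<open>\<phi> \<noteq> (\<lambda>_. 0)\<close> by (auto intro: cSup_upper)
  then show False using assms by simp
qed

text \<open>The set where a continuous function is nonzero is open, hence it is not just the origin;
  any other point in it bounds the supremum from below by a positive number.\<close>

lemma Rad_pos:
  assumes "test_fun UNIV \<phi>"
  shows "0 < Rad \<phi>"
proof (cases "\<phi> = (\<lambda>_. 0)")
  case True
  then show ?thesis by (simp add: Rad_def)
next
  case False
  have "\<exists>x. x \<noteq> 0 \<and> \<phi> x \<noteq> 0"
  proof (rule ccontr)
    assume "\<not> ?thesis"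
    then have "{x. \<phi> x \<noteq> 0} = {0}" using False by (auto simp: fun_eq_iff) metis
    moreover have "open {x. \<phi> x \<noteq> 0}"
      using test_fun_continuous'[OF assms, of UNIV "\<lambda>x. x"] by (intro open_Collect_neq) auto
    ultimately show False by (simp add: not_open_singleton)
  qed
  then obtain x where "x \<noteq> 0" "\<phi> x \<noteq> 0" by blast
  then have "norm x \<le> Rad \<phi>" using Rad_bound[OF assms, of x] by (meson not_less)
  then show ?thesis using \<open>x \<noteq> 0\<close> by (meson less_le_trans zero_less_norm_iff)
qed

lemma loc_int_indicator:
  assumes "S \<in> sets lebesgue"
  shows "loc_int UNIV (\<lambda>x. if x \<in> S then 1 else 0)"
  unfolding loc_int_def
proof (intro allI impI)
  fix K :: "(real^'a) set" assume K: "compact K \<and> K \<subseteq> UNIV"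
  have "S \<inter> K \<in> lmeasurable"
    using assms K by (metis Int_commute fmeasurable_Int_fmeasurable lmeasurable_compact)
  then have "(\<lambda>x. 1::complex) absolutely_integrable_on (S \<inter> K)" by simp
  then have "(\<lambda>x. if x \<in> S then 1 else 0 :: complex) absolutely_integrable_on (S \<inter> K)"
    by (subst set_integrable_cong[where f' = "\<lambda>_. 1"]) auto
  then show "(\<lambda>x. if x \<in> S then 1 else 0 :: complex) absolutely_integrable_on K"
    by (subst integral_zero_outside(2)[of "S \<inter> K"]) auto
qed

text \<open>u is the regular distribution of the indicator of S applied to the reflected kernel, so
  smoothness is \<open>smooth_conv\<close> with c = 1. The other parts compare S with the ball that
  carries the kernel. The set S is \<open>Omega_t\<close> for the cut-off, and a neighbourhood of a
  compact set when indicators are approximated.\<close>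

lemma mollified_indicator:
  assumes \<phi>: "test_fun UNIV \<phi>" and S: "S \<in> sets lebesgue"
  defines "u \<equiv> \<lambda>x. integral S (\<lambda>t. \<phi> (x - t))"
  shows "smooth_on UNIV u"
    and "\<And>x. cball x (Rad \<phi>) \<inter> S = {} \<Longrightarrow> u x = 0"
    and "\<And>x. cball x (Rad \<phi>) \<subseteq> S \<Longrightarrow> u x = integral UNIV \<phi>"
    and "\<And>x. norm (u x) \<le> integral UNIV (\<lambda>y. norm (\<phi> y))"
proof -
  let ?c = "\<lambda>x. if x \<in> S then 1 else 0 :: complex"
  have u: "u x = Lemb UNIV ?c (\<lambda>t. 1 * \<phi> (x - t))" for x
    unfolding u_def Lemb_def
    by (subst integral_restrict_UNIV[symmetric]) (auto intro!: arg_cong[of _ _ "integral UNIV"])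
  show "smooth_on UNIV u"
    unfolding u
    by (rule smooth_conv(1)[OF wdist_Lemb[OF loc_int_indicator[OF S]] smooth_on_one _ \<phi>]) simp
  have zero: "\<phi> (x - t) = 0" if "t \<notin> cball x (Rad \<phi>)" for x t
    using that by (intro Rad_bound[OF \<phi>]) (simp add: dist_norm)
  show "u x = 0" if "cball x (Rad \<phi>) \<inter> S = {}" for x
  proof -
    have "u x = integral S (\<lambda>t. 0)"
      unfolding u_def by (rule integral_cong) (use zero that in blast)
    then show ?thesis by simp
  qed
  have refl: "integral UNIV (\<lambda>t. \<phi> (x - t)) = integral UNIV \<phi>"
    "integral UNIV (\<lambda>t. norm (\<phi> (x - t))) = integral UNIV (\<lambda>t. norm (\<phi> t))" for x
    by (rule integral_reflect_translate[of _ "tsupp \<phi>"];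
        use \<phi> test_fun_continuous'[OF \<phi> continuous_on_id] in
        \<open>auto simp: test_fun_def tsupp_outside intro!: continuous_on_norm\<close>)+
  show "u x = integral UNIV \<phi>" if "cball x (Rad \<phi>) \<subseteq> S" for x
  proof -
    have "integral UNIV (\<lambda>t. \<phi> (x - t)) = u x"
      unfolding u_def by (rule integral_zero_outside) (use that zero in \<open>blast+\<close>)
    then show ?thesis by (simp add: refl)
  qed
  show "norm (u x) \<le> integral UNIV (\<lambda>y. norm (\<phi> y))" for x
  proof -
    note \<phi>x = test_fun_reflect[OF \<phi>, of x]
    have "norm (u x) \<le> integral UNIV (\<lambda>t. norm (\<phi> (x - t)))"
      unfolding u Lemb_def
    proof (rule integral_norm_bound_integral)
      show "(\<lambda>t. ?c t * (1 * \<phi> (x - t))) integrable_on UNIV"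
        using loc_int_mult_test[OF loc_int_indicator[OF S] \<phi>x]
        by (auto dest: absolutely_integrable_on_def[THEN iffD1])
      show "(\<lambda>t. norm (\<phi> (x - t))) integrable_on UNIV"
        using test_fun_norm_integrable[OF \<phi>x] by (auto dest: absolutely_integrable_on_def[THEN iffD1])
    qed auto
    then show ?thesis by (simp add: refl)
  qed
qed

lemma open_Omega_t: "open \<Omega> \<Longrightarrow> open (Omega_t \<Omega> \<phi>)"
proof -
  assume \<Omega>: "open \<Omega>"
  have "Omega_t \<Omega> \<phi> = \<Omega> \<inter> (if frontier \<Omega> = {} then UNIV else {x. 2 * Rad \<phi> < infdist x (frontier \<Omega>)})
      \<inter> {x. norm x < 1 / Rad \<phi>}"
    by (auto simp: Omega_t_def)
  moreover have "open {x. 2 * Rad \<phi> < infdist x (frontier \<Omega>)}" "open {x :: real^'a. norm x < 1 / Rad \<phi>}"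
    by (intro open_Collect_less continuous_intros)+
  ultimately show ?thesis using \<Omega> by (simp add: open_Int)
qed

text \<open>A point where the cut-off is nonzero lies within R = \<open>Rad \<phi>\<close> of some t
  in \<open>Omega_t\<close>. Since t is farther than 2 * R from the frontier, the point keeps
  distance R from the complement of \<Omega>. No membership in any \<open>Dn n\<close>
  enters.\<close>

lemma Cut_smooth:
  assumes "open \<Omega>" "test_fun UNIV \<phi>"
  shows "smooth_on UNIV (Cut \<Omega> \<phi>)" and "test_fun \<Omega> (Cut \<Omega> \<phi>)"
proof -
  have S: "Omega_t \<Omega> \<phi> \<in> sets lebesgue"
    using open_Omega_t[OF assms(1)] by (auto intro: borel_open sets_completionI_sets)
  show smooth: "smooth_on UNIV (Cut \<Omega> \<phi>)"
    using mollified_indicator(1)[OF assms(2) S] by (simp add: Cut_def[abs_def])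
  let ?R = "Rad \<phi>"
  \<comment> \<open>Written as an intersection over the points outside \<Omega>, so that \<Omega> =
    UNIV needs no separate case.\<close>
  define K where "K = cball 0 (1 / ?R + ?R) \<inter> (\<Inter>y\<in>-\<Omega>. {x. ?R \<le> dist x y})"
  have R: "0 < ?R" by (rule Rad_pos[OF assms(2)])
  show "test_fun \<Omega> (Cut \<Omega> \<phi>)"
  proof (rule test_funI[OF smooth])
    show "compact K"
      unfolding K_def by (intro compact_Int_closed compact_cball closed_INT ballI closed_Collect_le continuous_intros)
    show "K \<subseteq> \<Omega>" unfolding K_def using R by force
    fix x assume x: "x \<notin> K"
    have "cball x ?R \<inter> Omega_t \<Omega> \<phi> = {}"
    proof (rule ccontr)
      assume "cball x ?R \<inter> Omega_t \<Omega> \<phi> \<noteq> {}"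
      then obtain t where t: "dist x t \<le> ?R" "t \<in> Omega_t \<Omega> \<phi>" by auto
      have "norm x \<le> 1 / ?R + ?R"
        using t norm_triangle_ineq[of t "x - t"] by (auto simp: Omega_t_def dist_norm)
      moreover have "?R \<le> dist x y" if "y \<notin> \<Omega>" for y
      proof -
        \<comment> \<open>A segment leaving \<Omega> crosses the frontier, which bounds the distance
          to the complement by the distance to the frontier and excludes the case of an empty
          frontier.\<close>
        have "closed_segment t y \<inter> frontier \<Omega> \<noteq> {}"
          using t(2) that by (intro connected_Int_frontier) (auto simp: Omega_t_def)
        then obtain z where z: "z \<in> closed_segment t y" "z \<in> frontier \<Omega>" by blast
        then have "2 * ?R < infdist t (frontier \<Omega>)" using t(2) by (auto simp: Omega_t_def)
        also have "\<dots> \<le> dist t z" using z(2) by (rule infdist_le)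
        also have "\<dots> \<le> dist t y" using z(1) by (metis dist_commute segment_bound(1) dist_norm)
        also have "\<dots> \<le> ?R + dist x y" using t(1) dist_triangle[of t y x] by (simp add: dist_commute)
        finally show ?thesis by simp
      qed
      ultimately have "x \<in> K" by (auto simp: K_def)
      with x show False by simp
    qed
    then show "Cut \<Omega> \<phi> x = 0"
      unfolding Cut_def by (rule mollified_indicator(2)[OF assms(2) S])
  qed
qed

lemma DnD:
  fixes \<phi> :: "'n::finite cfun"
  assumes "\<phi> \<in> Dn n" "n \<ge> 1"
  shows "test_fun UNIV \<phi>" "\<phi> (- x) = \<phi> x" "0 < Rad \<phi>" "Rad \<phi> \<le> 1 / real n" "Rad \<phi> \<le> 1"
    "integral UNIV \<phi> = 1" "integral UNIV (\<lambda>x. norm (\<phi> x)) \<le> 2"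
    "\<And>\<alpha>. 1 \<le> mdeg \<alpha> \<Longrightarrow> mdeg \<alpha> \<le> n \<Longrightarrow> integral UNIV (\<lambda>x. complex_of_real (mmono \<alpha> x) * \<phi> x) = 0"
    "\<And>\<alpha> x. mdeg \<alpha> \<le> n \<Longrightarrow> norm (mpd \<alpha> \<phi> x) \<le> inverse (Rad \<phi>) ^ (2 * (mdeg \<alpha> + CARD('n)))"
proof -
  have n: "1 / real n \<le> 1" using assms by simp
  show t: "test_fun UNIV \<phi>" using assms by (simp add: Dn_def)
  show "0 < Rad \<phi>" by (rule Rad_pos[OF t])
  have "Rad \<phi> \<le> 1 / real n" "integral UNIV (\<lambda>x. norm (\<phi> x)) \<le> 1 + 1 / real n"
    using assms by (auto simp: Dn_def)
  then show "Rad \<phi> \<le> 1" "integral UNIV (\<lambda>x. norm (\<phi> x)) \<le> 2" using n by linarith+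
qed (use assms in \<open>auto simp: Dn_def\<close>)

lemma Dn_antimono_Rad:
  assumes "\<phi> \<in> Dn n" "e > 0" "n \<ge> 1" "real n > 1 / e"
  shows "Rad \<phi> < e"
proof -
  have "Rad \<phi> \<le> 1 / real n" by (rule DnD(4)[OF assms(1,3)])
  also have "\<dots> < e" using assms by (simp add: field_simps)
  finally show ?thesis .
qed

lemma compact_neighbourhood:
  fixes K :: "'a::euclidean_space set"
  assumes "compact K" "open \<Omega>" "K \<subseteq> \<Omega>"
  obtains \<delta> where "\<delta> > 0" "compact {x + y | x y. x \<in> K \<and> y \<in> cball 0 \<delta>}"
    "{x + y | x y. x \<in> K \<and> y \<in> cball 0 \<delta>} \<subseteq> \<Omega>"
proof -
  obtain e where e: "e > 0" "(\<Union>x\<in>K. cball x e) \<subseteq> \<Omega>"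
    using compact_subset_open_imp_cball_epsilon_subset[OF assms] by blast
  have "{x + y | x y. x \<in> K \<and> y \<in> cball 0 e} \<subseteq> (\<Union>x\<in>K. cball x e)"
    by (auto simp: dist_norm)
  then show ?thesis
    using that[OF e(1)] e(2) compact_sums[OF assms(1) compact_cball[of 0 e]] by blast
qed

text \<open>If the ball of radius \<open>Rad \<phi>\<close> around x lies in \<open>Omega_t\<close>,
  the cut-off at x collects the full mass of \<phi>, which is 1 on \<open>Dn n\<close>.\<close>

lemma Cut_eq_1:
  assumes "open \<Omega>" "compact K" "K \<subseteq> \<Omega>"
  obtains n where "n \<ge> 1" "\<And>\<phi> x. \<phi> \<in> Dn n \<Longrightarrow> x \<in> K \<Longrightarrow> Cut \<Omega> \<phi> x = 1"
proof -
  obtain e where e: "e > 0" "(\<Union>x\<in>K. cball x e) \<subseteq> \<Omega>"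
    using compact_subset_open_imp_cball_epsilon_subset[OF assms(2,1,3)] by blast
  obtain B where B: "B > 0" "\<And>x. x \<in> K \<Longrightarrow> norm x \<le> B"
    using compact_imp_bounded[OF assms(2)] bounded_pos by blast
  \<comment> \<open>The bound 4 / e keeps the frontier away: a frontier point within 3R of t would
    be within 4R < e of x and so inside \<Omega>. The bound B + 1 gives \<open>norm t\<close> \<le>
    B + R < n \<le> 1 / R.\<close>
  define n where "n = Suc (nat \<lceil>max (4 / e) (B + 1)\<rceil>)"
  have n: "real n > 4 / e" "real n > B + 1" "n \<ge> 1" unfolding n_def by linarith+
  show ?thesis
  proof (rule that[OF n(3)])
    fix \<phi> :: "'a cfun" and x assume \<phi>: "\<phi> \<in> Dn n" and x: "x \<in> K"
    let ?R = "Rad \<phi>"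
    note D = DnD[OF \<phi> n(3)]
    have R: "?R < e / 4" by (rule Dn_antimono_Rad[OF \<phi> _ n(3)]) (use n e in auto)
    have "real n \<le> 1 / ?R" using D(3,4) n(3) by (simp add: field_simps)
    have "cball x ?R \<subseteq> Omega_t \<Omega> \<phi>"
    proof
      fix t assume t: "t \<in> cball x ?R"
      have "norm t \<le> B + ?R"
        using B(2)[OF x] t norm_triangle_ineq[of x "t - x"] by (simp add: dist_norm norm_minus_commute)
      then have "norm t < 1 / ?R" using n(2) D(5) \<open>real n \<le> 1 / ?R\<close> by linarith
      moreover have "t \<in> \<Omega>" using t e x R D(3) by fastforce
      moreover have "2 * ?R < infdist t (frontier \<Omega>)" if "frontier \<Omega> \<noteq> {}"
      proof -
        \<comment> \<open>3R in place of 2R, so that the inequality is still strict after the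
          infimum over the frontier is taken.\<close>
        have "3 * ?R \<le> dist t y" if "y \<in> frontier \<Omega>" for y
        proof (rule ccontr)
          assume "\<not> 3 * ?R \<le> dist t y"
          then have "dist x y \<le> e" using t R dist_triangle[of x y t] by simp
          then have "y \<in> \<Omega>" by (intro subsetD[OF e(2)] UN_I[OF x]) simp
          then show False using that assms(1) by (simp add: frontier_def interior_open)
        qed
        then have "3 * ?R \<le> infdist t (frontier \<Omega>)"
          using that by (simp add: infdist_def cINF_greatest)
        then show ?thesis using D(3) by simp
      qed
      ultimately show "t \<in> Omega_t \<Omega> \<phi>" by (auto simp: Omega_t_def)
    qed
    moreover have S: "Omega_t \<Omega> \<phi> \<in> sets lebesgue"
      using open_Omega_t[OF assms(1)] by (auto intro: borel_open sets_completionI_sets)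
    ultimately show "Cut \<Omega> \<phi> x = 1"
      unfolding Cut_def using mollified_indicator(3)[OF D(1) S] D(6) by simp
  qed
qed

subsection \<open>The mollification estimate\<close>

definition mon :: "'n::finite list \<Rightarrow> real^'n \<Rightarrow> real" where
  "mon w z = (\<Prod>i\<leftarrow>w. z $ i)"

lemma mon_simps [simp]: "mon [] z = 1" "mon (i # w) z = z $ i * mon w z"
  by (simp_all add: mon_def)

lemma mon_uminus: "mon w (- z) = (- 1) ^ length w * mon w z"
  by (induction w) auto

lemma mon_bound: "\<bar>mon w z\<bar> \<le> norm z ^ length w"
proof (induction w)
  case (Cons i w)
  then show ?case
    using component_le_norm_cart[of z i] by (auto simp: abs_mult intro!: mult_mono)
qed simp

text \<open>Links the word monomials of the Taylor expansion with the multi-index moments prescribed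
  in \<open>Dn\<close>.\<close>

lemma mon_eq_mmono: "mon w z = mmono (count_list w) z"
proof (induction w)
  case Nil
  then show ?case by (simp add: mmono_def)
next
  case (Cons i w)
  have "mmono (count_list (i # w)) z = (\<Prod>j\<in>UNIV. (if i = j then z $ j else 1) * (z $ j) ^ count_list w j)"
    unfolding mmono_def by (intro prod.cong) auto
  also have "\<dots> = z $ i * mmono (count_list w) z"
    by (simp add: prod.distrib mmono_def)
  finally show ?case using Cons by (simp del: count_list.simps)
qed

lemma finite_words_eq: "finite {w :: 'n::finite list. length w = k}"
  using finite_lists_length_eq[of "UNIV :: 'n set" k] by simp

lemma card_words_eq: "card {w :: 'n::finite list. length w = k} = CARD('n) ^ k"
  using card_lists_length_eq[of "UNIV :: 'n set" k] by simp

lemma sum_words_Suc: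
  "(\<Sum>w | length w = Suc k. F w) = (\<Sum>w | length w = k. \<Sum>i\<in>(UNIV :: 'n::finite set). F (i # w))"
proof -
  have "{w :: 'n list. length w = Suc k} = (\<lambda>(w, i). i # w) ` ({w. length w = k} \<times> UNIV)"
    by (auto simp: length_Suc_conv image_iff)
  then have "(\<Sum>w | length w = Suc k. F w) = (\<Sum>(w, i)\<in>{w. length w = k} \<times> (UNIV :: 'n set). F (i # w))"
    by (simp add: sum.reindex inj_on_def case_prod_beta')
  then show ?thesis by (simp add: sum.cartesian_product)
qed

lemma pds_line_derivative:
  assumes "smooth_on UNIV f"
  shows "((\<lambda>s. pds w f (x + s *\<^sub>R z)) has_vector_derivative
    (\<Sum>i\<in>UNIV. (z $ i) *\<^sub>R pds (i # w) f (x + s *\<^sub>R z))) (at s)"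
proof -
  let ?D = "\<lambda>h. \<Sum>i\<in>UNIV. (h $ i) *\<^sub>R pds [i] (pds w f) (x + s *\<^sub>R z)"
  have "(pds w f \<circ> (\<lambda>s. x + s *\<^sub>R z) has_derivative ?D \<circ> (\<lambda>h. h *\<^sub>R z)) (at s)"
    by (rule diff_chain_at)
      (auto intro!: derivative_eq_intros smooth_on_has_derivative[of UNIV] smooth_on_pds assms simp del: pds_simps)
  moreover have "?D \<circ> (\<lambda>h. h *\<^sub>R z) = (\<lambda>h. h *\<^sub>R ?D z)"
    by (simp add: fun_eq_iff scaleR_sum_right)
  ultimately show ?thesis by (simp add: has_vector_derivative_def comp_def)
qed

text \<open>One-dimensional Taylor formula with integral remainder for s \<mapsto> f (x + s z). Its
  k-th derivative is a sum over all words of length k, whence \<open>CARD('n) ^ p\<close> in the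
  remainder; the weight (1 - s)^(p - 1) / (p - 1)! is estimated by 1.\<close>

lemma word_taylor:
  fixes x z :: "real^'n::finite"
  assumes f: "smooth_on UNIV f" and "p > 0" and M: "\<And>w x. length w = p \<Longrightarrow> norm (pds w f x) \<le> M"
  shows "norm (f (x + z) - (\<Sum>k<p. (1 / fact k) *\<^sub>R (\<Sum>w | length w = k. mon w z *\<^sub>R pds w f x)))
    \<le> real CARD('n) ^ p * M * norm z ^ p"
proof -
  define Df where "Df k s = (\<Sum>w | length w = k. mon w z *\<^sub>R pds w f (x + s *\<^sub>R z))" for k s
  have D: "(Df k has_vector_derivative Df (Suc k) s) (at s within {0..1})" for k s
  proof -
    have "((\<lambda>s. \<Sum>w | length w = k. mon w z *\<^sub>R pds w f (x + s *\<^sub>R z)) has_vector_derivative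
      (\<Sum>w | length w = k. mon w z *\<^sub>R (\<Sum>i\<in>UNIV. (z $ i) *\<^sub>R pds (i # w) f (x + s *\<^sub>R z)))) (at s within {0..1})"
      by (rule has_vector_derivative_sum)
        (rule bounded_linear.has_vector_derivative[OF bounded_linear_scaleR_right
          has_vector_derivative_at_within[OF pds_line_derivative[OF f]]])
    also have "(\<Sum>w | length w = k. mon w z *\<^sub>R (\<Sum>i\<in>UNIV. (z $ i) *\<^sub>R pds (i # w) f (x + s *\<^sub>R z))) = Df (Suc k) s"
      by (simp add: Df_def sum_words_Suc scaleR_sum_right mult.commute del: pds_simps)
    finally show ?thesis unfolding Df_def[abs_def] .
  qed
  let ?r = "\<lambda>s. ((1 - s) ^ (p - 1) / fact (p - 1)) *\<^sub>R Df p s"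
  let ?B = "real CARD('n) ^ p * M * norm z ^ p"
  have M0: "0 \<le> M"
    \<comment> \<open>Any word of length p yields M \<ge> 0; \<open>replicate p undefined\<close> is
      one.\<close>
    using order_trans[OF norm_ge_zero M[of "replicate p undefined"]] by simp
  have Dp: "norm (Df p s) \<le> ?B" for s
  proof -
    have "norm (Df p s) \<le> (\<Sum>w | length (w :: 'n list) = p. norm z ^ p * M)"
      unfolding Df_def
    proof (rule sum_norm_le)
      fix w :: "'n list" assume "w \<in> {w. length w = p}"
      then show "norm (mon w z *\<^sub>R pds w f (x + s *\<^sub>R z)) \<le> norm z ^ p * M"
        using M[of w "x + s *\<^sub>R z"] mon_bound[of w z] by (auto intro!: mult_mono)
    qed
    then show ?thesis by (simp add: card_words_eq mult_ac)
  qed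
  have T: "Df 0 1 = (\<Sum>i<p. ((1 - 0) ^ i / fact i) *\<^sub>R Df i 0) + integral {0..1} ?r"
    by (rule Taylor_integral[where Df = Df and p = p, OF \<open>p > 0\<close> refl]) (use D in auto)
  have int: "?r integrable_on {0..1}"
    by (rule Taylor_integrable[where Df = Df and p = p, OF \<open>p > 0\<close> refl]) (use D in auto)
  have "norm (integral {0..1} ?r) \<le> integral {0..1::real} (\<lambda>_. ?B)"
  proof (rule integral_norm_bound_integral[OF int])
    fix s :: real assume s: "s \<in> {0..1}"
    have "\<bar>(1 - s) ^ (p - 1) / fact (p - 1)\<bar> \<le> 1 / 1"
      unfolding abs_divide using s by (intro frac_le) (auto simp: power_le_one abs_le_iff fact_ge_1)
    then have "norm (?r s) \<le> 1 * ?B"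
      unfolding norm_scaleR using Dp by (intro mult_mono) auto
    then show "norm (?r s) \<le> ?B" by simp
  qed auto
  also have "\<dots> = ?B" by simp
  finally show ?thesis
    using T by (simp add: Df_def[abs_def])
qed

lemma continuous_on_mmono [continuous_intros]: "continuous_on S (mmono \<alpha>)"
  unfolding mmono_def[abs_def] by (intro continuous_intros)

text \<open>Of the constant, the factor 2 bounds the integral of the norm of \<phi>, and the rest is
  the Taylor remainder on the ball of radius \<open>Rad \<phi>\<close> that carries \<phi>.\<close>

lemma Dn_mollify_estimate:
  fixes \<phi> f :: "'n::finite cfun"
  assumes \<phi>: "\<phi> \<in> Dn n" and "0 < p" "p \<le> n" and f: "smooth_on UNIV f"
    and M: "\<And>w x. length w = p \<Longrightarrow> norm (pds w f x) \<le> M"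
  shows "norm (integral UNIV (\<lambda>y. \<phi> y * f (x - y)) - f x) \<le> 2 * real CARD('n) ^ p * M * Rad \<phi> ^ p"
proof -
  have "n \<ge> 1" using assms by simp
  note D = DnD[OF \<phi> this]
  \<comment> \<open>The Taylor polynomial at increment - y, since the convolution evaluates f at x -
    y.\<close>
  define P where "P y = (\<Sum>k<p. (1 / fact k) *\<^sub>R (\<Sum>w | length w = k. mon w (- y) *\<^sub>R pds w f x))" for y
  define c where "c w = complex_of_real (1 / fact (length w)) * (- 1) ^ length w * pds w f x" for w
  have P: "P y = (\<Sum>k<p. \<Sum>w | length w = k. c w * of_real (mmono (count_list w) y))" for y
    unfolding P_def by (intro sum.cong refl)
      (auto simp: c_def mon_uminus scaleR_conv_of_real sum_distrib_left mult_ac simp flip: mon_eq_mmono intro!: sum.cong)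
  have contf: "continuous_on UNIV (\<lambda>y. f (x - y))"
    by (intro continuous_on_compose2[OF smooth_on_continuous[OF f, of "[]", simplified]] continuous_intros) auto
  have contP: "continuous_on UNIV P"
    unfolding P[abs_def] by (intro continuous_intros)
  have i1: "(\<lambda>y. \<phi> y * f (x - y)) integrable_on UNIV" "(\<lambda>y. \<phi> y * P y) integrable_on UNIV"
    using test_fun_mult_integrable[OF D(1) contf] test_fun_mult_integrable[OF D(1) contP]
    by (auto dest: absolutely_integrable_on_def[THEN iffD1])
  \<comment> \<open>A nonempty word has degree below p \<le> n, so its moment vanishes; the empty
    word contributes the mass 1. Hence integrating \<phi> against P leaves just f x.\<close>
  have mono: "((\<lambda>y. \<phi> y * of_real (mmono (count_list w) y)) has_integral (if w = [] then 1 else 0)) UNIV"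
    if "length w < p" for w
  proof -
    have "(\<lambda>y. \<phi> y * of_real (mmono (count_list w) y)) integrable_on UNIV"
      using test_fun_mult_integrable[OF D(1), of "\<lambda>y. of_real (mmono (count_list w) y)"]
      by (auto dest: absolutely_integrable_on_def[THEN iffD1] intro!: continuous_intros)
    moreover have "integral UNIV (\<lambda>y. \<phi> y * of_real (mmono (count_list w) y)) = (if w = [] then 1 else 0)"
    proof (cases "w = []")
      case True
      then show ?thesis using D(6) by (simp flip: mon_eq_mmono)
    next
      case False
      then have "1 \<le> length w" by (cases w) auto
      then show ?thesis
        using D(8)[of "count_list w"] that \<open>p \<le> n\<close> False by (simp add: mdeg_count_list mult.commute)
    qed
    ultimately show ?thesis unfolding has_integral_iff by blast
  qed
  have "((\<lambda>y. \<Sum>k<p. \<Sum>w | length w = k. c w * (\<phi> y * of_real (mmono (count_list w) y)))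
      has_integral (\<Sum>k<p. \<Sum>w | length w = k. c w * (if w = [] then 1 else 0))) UNIV"
  proof (rule has_integral_sum[OF finite_lessThan], rule has_integral_sum[OF finite_words_eq])
    fix k and w :: "'n list" assume "k \<in> {..<p}" "w \<in> {w. length w = k}"
    then have "length w < p" by simp
    then show "((\<lambda>y. c w * (\<phi> y * of_real (mmono (count_list w) y))) has_integral c w * (if w = [] then 1 else 0)) UNIV"
      by (intro has_integral_mult_right mono)
  qed
  also have "(\<lambda>y. \<Sum>k<p. \<Sum>w | length w = k. c w * (\<phi> y * of_real (mmono (count_list w) y))) = (\<lambda>y. \<phi> y * P y)"
    by (simp add: P sum_distrib_left mult_ac)
  also have "(\<Sum>k<p. \<Sum>w | length w = k. c w * (if w = [] then 1 else 0)) = (\<Sum>k<p. if k = 0 then f x else 0)"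
  proof (rule sum.cong[OF refl])
    fix k
    show "(\<Sum>w | length w = k. c w * (if w = [] then 1 else 0)) = (if k = 0 then f x else 0)"
      by (cases "k = 0") (auto simp: c_def intro!: sum.neutral)
  qed
  also have "\<dots> = f x" using \<open>0 < p\<close> by (simp add: sum.delta)
  finally have IP: "integral UNIV (\<lambda>y. \<phi> y * P y) = f x" by (rule integral_unique)
  let ?B = "real CARD('n) ^ p * M * Rad \<phi> ^ p"
  have M0: "0 \<le> M"
    using order_trans[OF norm_ge_zero M[of "replicate p undefined"]] by simp
  have "norm (integral UNIV (\<lambda>y. \<phi> y * f (x - y) - \<phi> y * P y)) \<le> integral UNIV (\<lambda>y. norm (\<phi> y) * ?B)"
  proof (rule integral_norm_bound_integral)
    show "(\<lambda>y. \<phi> y * f (x - y) - \<phi> y * P y) integrable_on UNIV"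
      by (intro integrable_diff i1)
    show "(\<lambda>y. norm (\<phi> y) * ?B) integrable_on UNIV"
      using test_fun_norm_integrable[OF D(1)]
      by (intro integrable_on_mult_left) (auto dest: absolutely_integrable_on_def[THEN iffD1])
    fix y
    show "norm (\<phi> y * f (x - y) - \<phi> y * P y) \<le> norm (\<phi> y) * ?B"
    proof (cases "norm y \<le> Rad \<phi>")
      case True
      have "norm (f (x + - y) - P y) \<le> real CARD('n) ^ p * M * norm (- y) ^ p"
        unfolding P_def by (rule word_taylor[OF f \<open>0 < p\<close> M])
      also have "\<dots> \<le> ?B" using True M0 by (intro mult_left_mono power_mono) auto
      finally show ?thesis
        by (simp add: norm_mult mult_left_mono flip: right_diff_distrib)
    next
      case False
      then have "\<phi> y = 0" by (intro Rad_bound[OF D(1)]) simp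
      then show ?thesis by simp
    qed
  qed
  also have "integral UNIV (\<lambda>y. norm (\<phi> y) * ?B) = integral UNIV (\<lambda>y. norm (\<phi> y)) * ?B" by simp
  also have "\<dots> \<le> 2 * ?B"
    using D(3,7) M0 by (intro mult_right_mono) auto
  finally show ?thesis
    by (simp add: integral_diff[OF i1] IP mult.assoc)
qed

text \<open>The convolution is read as the distribution of \<phi> acting on the reflected f, so that
  derivatives fall on f, whose bounds do not depend on \<phi>.\<close>

lemma mollify_smooth:
  fixes \<phi> f :: "'n::finite cfun"
  assumes \<phi>: "test_fun UNIV \<phi>" and f: "test_fun UNIV f"
  shows "smooth_on UNIV (\<lambda>x. integral UNIV (\<lambda>y. \<phi> y * f (x - y)))"
    and "pds w (\<lambda>x. integral UNIV (\<lambda>y. \<phi> y * f (x - y))) x = integral UNIV (\<lambda>y. \<phi> y * pds w f (x - y))"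
  using smooth_conv[OF wdist_Lemb[OF smooth_on_loc_int[OF test_funD(1)[OF \<phi>]]] smooth_on_one _ f]
  by (simp_all add: Lemb_def)

lemma mollify_commute:
  fixes \<phi> f :: "'n::finite cfun"
  assumes \<phi>: "test_fun UNIV \<phi>" and f: "test_fun UNIV f"
  shows "integral UNIV (\<lambda>y. \<phi> y * f (x - y)) = integral UNIV (\<lambda>y. f y * \<phi> (x - y))"
proof -
  have "integral UNIV (\<lambda>t. \<phi> (x - t) * f (x - (x - t))) = integral UNIV (\<lambda>y. \<phi> y * f (x - y))"
    by (rule integral_reflect_translate[where K = "tsupp \<phi>"])
      (use \<phi> f in \<open>auto simp: test_fun_def[of _ \<phi>] tsupp_outside
        intro!: continuous_on_mult test_fun_continuous' continuous_intros\<close>)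
  then show ?thesis by (simp add: mult.commute)
qed

subsection \<open>Moving a distribution out of an integral\<close>

text \<open>On each cell the error is at most the oscillation of g times the measure of the cell.
  The bound sees g only through its oscillation at scale \<delta>, so one division can serve a whole
  family of integrands.\<close>

lemma riemann_sum_bound:
  fixes g :: "'a::euclidean_space \<Rightarrow> complex"
  assumes g: "continuous_on (cbox a b) g" and p: "p tagged_division_of cbox a b" and fine: "(\<lambda>x. ball x \<delta>) fine p"
    and e: "\<And>x y. x \<in> cbox a b \<Longrightarrow> y \<in> cbox a b \<Longrightarrow> dist x y < \<delta> \<Longrightarrow> norm (g x - g y) \<le> e" and "0 \<le> e"
  shows "norm ((\<Sum>(x, K)\<in>p. measure lborel K *\<^sub>R g x) - integral (cbox a b) g) \<le> e * measure lborel (cbox a b)"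
proof -
  have int: "g integrable_on cbox a b" by (rule integrable_continuous[OF g])
  have "(\<Sum>(x, K)\<in>p. measure lborel K *\<^sub>R g x) - integral (cbox a b) g = (\<Sum>(x, K)\<in>p. measure lborel K *\<^sub>R g x - integral K g)"
    unfolding integral_combine_tagged_division_topdown[OF int p]
    by (simp add: sum_subtractf case_prod_beta)
  also have "norm \<dots> \<le> (\<Sum>(x, K)\<in>p. e * measure lborel K)"
  proof (rule sum_norm_le)
    fix q assume "q \<in> p"
    then obtain x K where q: "q = (x, K)" "(x, K) \<in> p" by (cases q) auto
    from tagged_division_ofD(2-4)[OF p q(2)] obtain c d
      where K: "x \<in> K" "K \<subseteq> cbox a b" "K = cbox c d" by auto
    have KB: "K \<subseteq> ball x \<delta>" using fine q(2) by (auto simp: fine_def)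
    have "g integrable_on K" using int K by (metis integrable_on_subcbox)
    then have "((\<lambda>y. g x - g y) has_integral (measure lborel K *\<^sub>R g x - integral K g)) (cbox c d)"
      unfolding K(3) by (intro has_integral_diff has_integral_const integrable_integral)
    then have "norm (measure lborel K *\<^sub>R g x - integral K g) \<le> e * measure lborel (cbox c d)"
      by (rule has_integral_bound[OF \<open>0 \<le> e\<close>]) (use K KB in \<open>auto intro!: e simp: subset_iff\<close>)
    then show "norm (case q of (x, K) \<Rightarrow> measure lborel K *\<^sub>R g x - integral K g) \<le> (case q of (x, K) \<Rightarrow> e * measure lborel K)"
      using K(3) q(1) by simp
  qed
  also have "\<dots> = e * (\<Sum>(x, K)\<in>p. measure lborel K)"
    by (simp add: sum_distrib_left case_prod_beta)
  also have "\<dots> = e * measure lborel (cbox a b)"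
    using additive_content_tagged_division[OF p] by simp
  finally show ?thesis .
qed

lemma smooth_on_sum:
  assumes "finite I" "\<And>i. i \<in> I \<Longrightarrow> smooth_on UNIV (f i)"
  shows "smooth_on UNIV (\<lambda>x. \<Sum>i\<in>I. a i * f i x)
    \<and> (\<forall>w x. pds w (\<lambda>x. \<Sum>i\<in>I. a i * f i x) x = (\<Sum>i\<in>I. a i * pds w (f i) x))"
  using assms
proof (induction I)
  case empty
  then show ?case by (simp add: smooth_on_zero pds_zero)
next
  case (insert i I)
  then have "smooth_on UNIV (\<lambda>x. a i * f i x + 1 * (\<Sum>i\<in>I. a i * f i x))"
    "pds w (\<lambda>x. a i * f i x + 1 * (\<Sum>i\<in>I. a i * f i x)) x
      = a i * pds w (f i) x + 1 * pds w (\<lambda>x. \<Sum>i\<in>I. a i * f i x) x" for w x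
    by (intro smooth_on_lincomb[OF open_UNIV]; simp)+
  then show ?case using insert by simp
qed

lemma wdist_sum:
  assumes T: "wdist \<Omega> T" and "finite I" "\<And>i. i \<in> I \<Longrightarrow> test_fun \<Omega> (f i)"
  shows "test_fun \<Omega> (\<lambda>x. \<Sum>i\<in>I. a i * f i x) \<and> T (\<lambda>x. \<Sum>i\<in>I. a i * f i x) = (\<Sum>i\<in>I. a i * T (f i))"
  using assms(2,3)
proof (induction I)
  case empty
  then show ?case using wdist_zero[OF T] by (simp add: test_fun_zero)
next
  case (insert i I)
  then show ?case
    using wdist_linear[OF T, of "f i" "\<lambda>x. \<Sum>i\<in>I. a i * f i x" "a i" 1]
      test_fun_lincomb[of \<Omega> "f i" "\<lambda>x. \<Sum>i\<in>I. a i * f i x" "a i" 1] by simp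
qed

lemma smooth_on_translate:
  assumes "smooth_on UNIV f"
  shows "smooth_on UNIV (\<lambda>t. f (t - x))" and "pds w (\<lambda>t. f (t - x)) t = pds w f (t - x)"
  using smooth_on_affine[OF assms, where a = "- x" and c = 1] by simp_all

text \<open>The difference of products is split one factor at a time. The resulting constant
  involves neither t nor the particular word v.\<close>

lemma test_fun_mult_lipschitz:
  fixes \<tau> \<phi> :: "'n::finite cfun"
  assumes "smooth_on UNIV \<tau>" "smooth_on UNIV \<phi>"
    and \<tau>: "\<And>w x. length w \<le> 1 \<Longrightarrow> norm (pds w \<tau> x) \<le> A"
    and \<phi>: "\<And>w x. length w \<le> Suc m \<Longrightarrow> norm (pds w \<phi> x) \<le> B" and v: "length v \<le> m"
  shows "norm (\<tau> x * pds v \<phi> (t - x) - \<tau> y * pds v \<phi> (t - y)) \<le> 2 * real CARD('n) * A * B * norm (x - y)"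
proof -
  have A: "0 \<le> A" using order_trans[OF norm_ge_zero \<tau>[of "[]"]] by simp
  have B: "0 \<le> B" using order_trans[OF norm_ge_zero \<phi>[of "[]"]] by simp
  let ?d = "real CARD('n)"
  have "\<tau> x * pds v \<phi> (t - x) - \<tau> y * pds v \<phi> (t - y)
      = (pds [] \<tau> x - pds [] \<tau> y) * pds v \<phi> (t - x) + \<tau> y * (pds v \<phi> (t - x) - pds v \<phi> (t - y))"
    by (simp add: algebra_simps)
  also have "norm \<dots> \<le> norm (pds [] \<tau> x - pds [] \<tau> y) * norm (pds v \<phi> (t - x))
      + norm (\<tau> y) * norm (pds v \<phi> (t - x) - pds v \<phi> (t - y))"
    by (metis norm_mult norm_triangle_ineq)
  also have "\<dots> \<le> (?d * A * norm (x - y)) * B + A * (?d * B * norm ((t - x) - (t - y)))"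
  proof (intro add_mono mult_mono)
    show "norm (pds [] \<tau> x - pds [] \<tau> y) \<le> ?d * A * norm (x - y)"
      by (rule norm_le_lipschitz[OF assms(1)]) (rule \<tau>, simp)
    show "norm (pds v \<phi> (t - x) - pds v \<phi> (t - y)) \<le> ?d * B * norm ((t - x) - (t - y))"
      by (rule norm_le_lipschitz[OF assms(2)]) (rule \<phi>, use v in simp)
  qed (use \<tau>[of "[]" y] \<phi>[of v "t - x"] v A B in auto)
  also have "\<dots> = 2 * ?d * A * B * norm (x - y)"
    by (simp add: norm_minus_commute algebra_simps)
  finally show ?thesis .
qed

text \<open>A single tagged division works for all derivatives and all \<open>t\<close> at once, because the integrands
  share a Lipschitz constant.\<close>

lemma wdist_integral:
  fixes c \<phi> \<tau> :: "'n::finite cfun"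
  assumes T: "wdist \<Omega> T" and c: "test_fun \<Omega> c" and \<phi>: "test_fun UNIV \<phi>" and \<tau>: "test_fun UNIV \<tau>"
  shows "integral UNIV (\<lambda>x. T (\<lambda>t. c t * \<phi> (t - x)) * \<tau> x)
    = T (\<lambda>t. c t * integral UNIV (\<lambda>x. \<tau> x * \<phi> (t - x)))"
proof -
  note c' = test_funD(1,3)[OF c] and s\<phi> = test_funD(1)[OF \<phi>] and s\<tau> = test_funD(1)[OF \<tau>]
  let ?F = "\<lambda>x. T (\<lambda>t. c t * \<phi> (t - x))"
  let ?H = "\<lambda>t. integral UNIV (\<lambda>x. \<tau> x * \<phi> (t - x))"
  obtain a b where ab: "tsupp \<tau> \<subseteq> cbox a b"
    using compact_imp_bounded[OF test_funD(2)[OF \<tau>]] bounded_subset_cbox_symmetric by metis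
  have box: "integral UNIV (\<lambda>x. g x * \<tau> x) = integral (cbox a b) (\<lambda>x. g x * \<tau> x)" for g
    by (rule integral_zero_outside) (use ab tsupp_outside[of _ \<tau>] in auto)
  have refl: "test_fun UNIV (\<lambda>u. \<phi> (- u))"
    using test_fun_reflect[OF \<phi>, of 0] by simp
  have "smooth_on UNIV ?F"
    using smooth_conv(1)[OF T c' refl] by simp
  then have contF: "continuous_on UNIV (\<lambda>x. ?F x * \<tau> x)"
    using smooth_on_continuous[of UNIV ?F "[]"] test_fun_continuous[OF \<tau>, of UNIV "[]"]
    by (intro continuous_on_mult) auto
  have testF: "test_fun \<Omega> (\<lambda>t. c t * \<phi> (t - x))" for x
    by (rule test_fun_mult[OF c']) (use test_fun_affine[OF \<phi>, of 1 "- x"] in simp)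
  have H: "smooth_on UNIV ?H" "pds v ?H t = integral UNIV (\<lambda>x. \<tau> x * pds v \<phi> (t - x))" for v t
    by (rule mollify_smooth[OF \<tau> \<phi>])+
  \<comment> \<open>With \<open>tsupp c\<close> as the compact set the support condition on \<eta>
    is vacuous, so the Riemann error may be spread over the whole space.\<close>
  obtain C m where "C \<ge> 0" and C: "\<forall>\<eta> B. smooth_on UNIV \<eta> \<longrightarrow> (\<forall>t. t \<in> tsupp c \<longrightarrow> t \<notin> tsupp c \<longrightarrow> \<eta> t = 0) \<longrightarrow>
      (\<forall>v t. length v \<le> m \<longrightarrow> norm (pds v \<eta> t) \<le> B) \<longrightarrow> norm (T (\<lambda>t. c t * \<eta> t)) \<le> C * B"
    using wdist_mult_bound[OF T c' test_funD(2)[OF c]] by blast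
  obtain A where A: "A \<ge> 0" "\<And>w x. length w \<le> 1 \<Longrightarrow> norm (pds w \<tau> x) \<le> A"
    by (rule test_fun_bounded[OF \<tau>, of 1]) (rule that)
  obtain B where B: "B \<ge> 0" "\<And>w x. length w \<le> Suc m \<Longrightarrow> norm (pds w \<phi> x) \<le> B"
    by (rule test_fun_bounded[OF \<phi>, of "Suc m"]) (rule that)
  define \<Lambda> where "\<Lambda> = 2 * real CARD('n) * A * B"
  have "\<Lambda> \<ge> 0" using A(1) B(1) by (simp add: \<Lambda>_def)
  let ?V = "measure lborel (cbox a b)"
  have main: "norm (integral UNIV (\<lambda>x. ?F x * \<tau> x) - T (\<lambda>t. c t * ?H t)) \<le> e * (?V + C * ?V)" if "e > 0" for e
  proof -
    have "uniformly_continuous_on (cbox a b) (\<lambda>x. ?F x * \<tau> x)"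
      by (intro compact_uniformly_continuous compact_cbox continuous_on_subset[OF contF]) simp
    then obtain \<delta>1 where "\<delta>1 > 0" and \<delta>1: "\<And>x y. x \<in> cbox a b \<Longrightarrow> y \<in> cbox a b \<Longrightarrow> dist y x < \<delta>1 \<Longrightarrow>
        dist (?F y * \<tau> y) (?F x * \<tau> x) < e"
      unfolding uniformly_continuous_on_def using \<open>e > 0\<close> by meson
    \<comment> \<open>\<delta>1 serves the scalar integrand under T, e / (\<Lambda> + 1) serves all
      derivatives of the kernel; the + 1 covers \<Lambda> = 0.\<close>
    define \<delta> where "\<delta> = min \<delta>1 (e / (\<Lambda> + 1))"
    have "\<delta> > 0" using \<open>\<delta>1 > 0\<close> \<open>e > 0\<close> \<open>\<Lambda> \<ge> 0\<close> by (simp add: \<delta>_def)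
    obtain p where p: "p tagged_division_of cbox a b" "(\<lambda>x. ball x \<delta>) fine p"
      using fine_division_exists[OF gauge_ball[OF \<open>\<delta> > 0\<close>]] by metis
    have "finite p" using p(1) by (rule tagged_division_of_finite)
    define q where "q z = complex_of_real (measure lborel (snd z)) * \<tau> (fst z)" for z :: "(real^'n) \<times> (real^'n) set"
    have bF: "norm ((\<Sum>(x, K)\<in>p. measure lborel K *\<^sub>R (?F x * \<tau> x)) - integral (cbox a b) (\<lambda>x. ?F x * \<tau> x)) \<le> e * ?V"
    proof (rule riemann_sum_bound[OF continuous_on_subset[OF contF] p])
      show "norm (?F x * \<tau> x - ?F y * \<tau> y) \<le> e" if "x \<in> cbox a b" "y \<in> cbox a b" "dist x y < \<delta>" for x y
        using \<delta>1[OF that(2,1)] that(3) by (simp add: \<delta>_def dist_norm less_imp_le)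
    qed (use \<open>e > 0\<close> in auto)
    \<comment> \<open>Riemann sum minus integral, as a function of t. By linearity T turns the sum
      into a Riemann sum for the integrand on the left-hand side.\<close>
    let ?\<eta> = "\<lambda>t. (\<Sum>z\<in>p. q z * \<phi> (t - fst z)) - ?H t"
    have sm: "smooth_on UNIV (\<lambda>t. \<phi> (t - x))" for x by (rule smooth_on_translate[OF s\<phi>])
    note sum = smooth_on_sum[OF \<open>finite p\<close>, of "\<lambda>z t. \<phi> (t - fst z)", OF sm]
    have b\<eta>: "norm (T (\<lambda>t. c t * ?\<eta> t)) \<le> C * (e * ?V)"
    proof (rule C[rule_format])
      show "smooth_on UNIV ?\<eta>" by (intro smooth_on_diff open_UNIV H sum[THEN conjunct1])
      fix v :: "'n list" and t assume v: "length v \<le> m"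
      let ?g = "\<lambda>x. \<tau> x * pds v \<phi> (t - x)"
      have "pds v ?\<eta> t = (\<Sum>z\<in>p. q z * pds v \<phi> (t - fst z)) - integral UNIV ?g"
        unfolding smooth_on_diff(2)[OF open_UNIV sum[THEN conjunct1] H(1) UNIV_I]
        by (simp add: sum H(2) smooth_on_translate[OF s\<phi>])
      also have "integral UNIV ?g = integral (cbox a b) ?g"
        using box[of "\<lambda>x. pds v \<phi> (t - x)"] by (simp add: mult.commute)
      also have "(\<Sum>z\<in>p. q z * pds v \<phi> (t - fst z)) = (\<Sum>(x, K)\<in>p. measure lborel K *\<^sub>R ?g x)"
        by (simp add: q_def case_prod_beta scaleR_conv_of_real mult.assoc)
      also have "norm ((\<Sum>(x, K)\<in>p. measure lborel K *\<^sub>R ?g x) - integral (cbox a b) ?g) \<le> e * ?V"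
      proof (rule riemann_sum_bound[OF _ p])
        show "continuous_on (cbox a b) ?g"
          using test_fun_continuous[OF \<tau>, of "cbox a b" "[]"]
          by (intro continuous_intros continuous_on_compose2[OF test_fun_continuous[OF \<phi>, of UNIV v]]) auto
        show "norm (?g x - ?g y) \<le> e" if "x \<in> cbox a b" "y \<in> cbox a b" "dist x y < \<delta>" for x y
        proof -
          have "norm (?g x - ?g y) \<le> \<Lambda> * norm (x - y)"
            unfolding \<Lambda>_def by (rule test_fun_mult_lipschitz[OF s\<tau> s\<phi> A(2) B(2) v])
          also have "\<dots> \<le> (\<Lambda> + 1) * (e / (\<Lambda> + 1))"
            using that(3) \<open>\<Lambda> \<ge> 0\<close> by (intro mult_mono) (auto simp: \<delta>_def dist_norm)
          also have "\<dots> = e" using \<open>\<Lambda> \<ge> 0\<close> by simp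
          finally show ?thesis .
        qed
      qed (use \<open>e > 0\<close> in auto)
      finally show "norm (pds v ?\<eta> t) \<le> e * ?V" .
    qed blast
    note ws = wdist_sum[OF T \<open>finite p\<close>, of "\<lambda>z t. c t * \<phi> (t - fst z)" q, OF testF]
    have cH: "test_fun \<Omega> (\<lambda>t. c t * ?H t)"
      by (rule test_funI[of _ "tsupp c"]) (use c c' H(1) in \<open>auto simp: smooth_on_mult test_fun_def tsupp_outside\<close>)
    have "T (\<lambda>t. c t * ?\<eta> t) = T (\<lambda>t. (\<Sum>z\<in>p. q z * (c t * \<phi> (t - fst z))) - c t * ?H t)"
      by (simp add: right_diff_distrib sum_distrib_left mult.left_commute)
    also have "\<dots> = (\<Sum>z\<in>p. q z * ?F (fst z)) - T (\<lambda>t. c t * ?H t)"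
      using wdist_diff[OF T _ cH] ws by simp
    also have "(\<Sum>z\<in>p. q z * ?F (fst z)) = (\<Sum>(x, K)\<in>p. measure lborel K *\<^sub>R (?F x * \<tau> x))"
      by (simp add: q_def case_prod_beta scaleR_conv_of_real mult_ac)
    finally have "integral UNIV (\<lambda>x. ?F x * \<tau> x) - T (\<lambda>t. c t * ?H t)
       = T (\<lambda>t. c t * ?\<eta> t) - ((\<Sum>(x, K)\<in>p. measure lborel K *\<^sub>R (?F x * \<tau> x)) - integral (cbox a b) (\<lambda>x. ?F x * \<tau> x))"
      using box[of ?F] by simp
    also have "norm \<dots> \<le> C * (e * ?V) + e * ?V"
      by (rule order_trans[OF norm_triangle_ineq4 add_mono[OF b\<eta> bF]])
    finally show ?thesis by (simp add: algebra_simps)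
  qed
  define D where "D = norm (integral UNIV (\<lambda>x. ?F x * \<tau> x) - T (\<lambda>t. c t * ?H t))"
  have W: "0 \<le> ?V + C * ?V" using \<open>C \<ge> 0\<close> by simp
  have "D \<le> 0"
  proof (rule field_le_epsilon)
    fix e :: real assume "e > 0"
    have "D \<le> (e / (?V + C * ?V + 1)) * (?V + C * ?V)"
      unfolding D_def by (rule main) (use \<open>e > 0\<close> W in simp)
    also have "\<dots> \<le> e" using \<open>e > 0\<close> W by (simp add: field_simps)
    finally show "D \<le> 0 + e" by simp
  qed
  then show ?thesis by (simp add: D_def)
qed

subsection \<open>Functions annihilating all test functions\<close>

text \<open>The indicator of \<open>C\<close> is the bounded pointwise limit of mollified indicators of shrinking
  neighbourhoods; elements of \<open>D\<^sub>n\<close> serve as mollifiers, so no bump function has to be constructed.\<close>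

lemma integral_compact_vanishing:
  fixes h :: "'n::finite cfun"
  assumes "open \<Omega>" and h: "loc_int \<Omega> h" and Dn: "\<And>n. n \<ge> 1 \<Longrightarrow> \<exists>\<phi>. \<phi> \<in> (Dn n :: 'n cfun set)"
    and zero: "\<And>\<tau>. test_fun \<Omega> \<tau> \<Longrightarrow> integral \<Omega> (\<lambda>x. h x * \<tau> x) = 0"
    and C: "compact C" "C \<subseteq> \<Omega>"
  shows "integral C h = 0"
proof (cases "C = {}")
  case False
  obtain \<delta> where "\<delta> > 0" and K': "compact {x + y | x y. x \<in> C \<and> y \<in> cball 0 \<delta>}"
    "{x + y | x y. x \<in> C \<and> y \<in> cball 0 \<delta>} \<subseteq> \<Omega>"
    by (rule compact_neighbourhood[OF C(1) assms(1) C(2)]) (rule that)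
  define K where "K = {x + y | x y. x \<in> C \<and> y \<in> cball 0 \<delta>}"
  note K = K'[folded K_def]
  have hK: "h absolutely_integrable_on K" using h K by (auto simp: loc_int_def)
  have K_infdist: "x \<in> K" if "infdist x C \<le> \<delta>" for x
  proof -
    obtain c where "c \<in> C" "infdist x C = dist x c"
      using infdist_attains_inf[OF compact_imp_closed[OF C(1)] False] by blast
    then have "x = c + (x - c) \<and> c \<in> C \<and> x - c \<in> cball 0 \<delta>"
      using that by (simp add: dist_norm norm_minus_commute)
    then show ?thesis unfolding K_def by blast
  qed
  have "C \<subseteq> K"
    using \<open>\<delta> > 0\<close> by (auto intro!: K_infdist)
  \<comment> \<open>Guarantees 3 * r n < \<delta> for all n, so that every u n is supported in
    K.\<close>
  define N where "N = Suc (nat \<lceil>3 / \<delta>\<rceil>)"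
  define r where "r n = 1 / real (n + N)" for n
  have N: "3 / \<delta> < real N" "N \<ge> 1" unfolding N_def by linarith+
  have r: "r n > 0" "3 * r n < \<delta>" for n
    using N \<open>\<delta> > 0\<close> unfolding r_def
    by (auto simp: field_simps) (smt (verit) mult_nonneg_nonneg of_nat_0_le_iff)
  obtain \<psi> where \<psi>: "\<psi> n \<in> (Dn (n + N) :: 'n cfun set)" for n
    using Dn[of "_ + N"] N(2) by (metis trans_le_add2)
  have D: "test_fun UNIV (\<psi> n)" "Rad (\<psi> n) \<le> r n" "integral UNIV (\<psi> n) = 1" "integral UNIV (\<lambda>x. norm (\<psi> n x)) \<le> 2" for n
    using DnD[OF \<psi>[of n]] N(2) by (auto simp: r_def)
  \<comment> \<open>Smearing the 2r-neighbourhood with a kernel of radius at most r gives a function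
    equal to 1 on C and 0 at distance 3r and beyond.\<close>
  define G where "G n = {x. infdist x C < 2 * r n}" for n
  have G: "G n \<in> sets lebesgue" for n
    unfolding G_def
    by (auto intro!: borel_open sets_completionI_sets open_Collect_less continuous_on_infdist continuous_intros)
  define u where "u n x = integral (G n) (\<lambda>t. \<psi> n (x - t))" for n x
  have M: "smooth_on UNIV (u n)" "cball x (Rad (\<psi> n)) \<inter> G n = {} \<Longrightarrow> u n x = 0"
    "cball x (Rad (\<psi> n)) \<subseteq> G n \<Longrightarrow> u n x = integral UNIV (\<psi> n)"
    "norm (u n x) \<le> integral UNIV (\<lambda>y. norm (\<psi> n y))" for n x
    unfolding u_def by (fact mollified_indicator[OF D(1)[of n] G[of n]])+
  have u1: "u n x = 1" if "x \<in> C" for n x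
  proof -
    have "cball x (Rad (\<psi> n)) \<subseteq> G n"
    proof
      fix y assume "y \<in> cball x (Rad (\<psi> n))"
      then have "dist y x \<le> r n" using D(2)[of n] by (simp add: dist_commute)
      then have "infdist y C \<le> r n" using infdist_le2[OF that] by blast
      then show "y \<in> G n" using r(1)[of n] by (simp add: G_def)
    qed
    then show ?thesis using M(3) D(3) by simp
  qed
  have u0: "u n x = 0" if "infdist x C \<ge> 3 * r n" for n x
  proof (rule M(2), rule ccontr)
    assume "cball x (Rad (\<psi> n)) \<inter> G n \<noteq> {}"
    then obtain t where "dist x t \<le> Rad (\<psi> n)" "infdist t C < 2 * r n" by (auto simp: G_def)
    then show False using infdist_triangle[of x C t] D(2)[of n] that by simp
  qed
  \<comment> \<open>The mollifiers may change sign, so u n need not lie between 0 and 1; domination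
    rests on their L1 bound.\<close>
  have u2: "norm (u n x) \<le> 2" for n x using M(4)[of n x] D(4)[of n] by simp
  have outK: "u n x = 0" if "x \<notin> K" for n x
    using that K_infdist[of x] r(2)[of n] by (intro u0) linarith
  have test: "test_fun \<Omega> (u n)" for n
    by (rule test_funI[OF M(1) K outK])
  have int0: "integral K (\<lambda>x. h x * u n x) = 0" for n
    using zero[OF test[of n]] integral_zero_outside(1)[OF K(2), of "\<lambda>x. h x * u n x"] outK by simp
  have intn: "(\<lambda>x. h x * u n x) integrable_on K" for n
    using integral_zero_outside(2)[OF K(2), of "\<lambda>x. h x * u n x"] outK loc_int_mult_test[OF h test]
    by (auto dest: absolutely_integrable_on_def[THEN iffD1])
  have lim: "(\<lambda>n. h x * u n x) \<longlonglongrightarrow> (if x \<in> C then h x else 0)" for x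
  proof (cases "x \<in> C")
    case True
    then show ?thesis by (simp add: u1)
  next
    case x: False
    have "infdist x C > 0"
      using x C(1) False by (metis compact_imp_closed in_closed_iff_infdist_zero infdist_nonneg less_eq_real_def)
    have "(\<lambda>n. 3 * r n) \<longlonglongrightarrow> 0"
      unfolding r_def by (rule LIMSEQ_ignore_initial_segment[of "\<lambda>n. 3 * (1 / real n)", OF tendsto_mult_right_zero[OF lim_1_over_n]])
    then have "\<forall>\<^sub>F n in sequentially. 3 * r n < infdist x C"
      by (rule order_tendstoD(2)) fact
    then have "\<forall>\<^sub>F n in sequentially. h x * u n x = 0"
      by eventually_elim (simp add: u0)
    then show ?thesis using x by (simp add: tendsto_eventually)
  qed
  have "(\<lambda>n. integral K (\<lambda>x. h x * u n x)) \<longlonglongrightarrow> integral K (\<lambda>x. if x \<in> C then h x else 0)"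
  proof (rule dominated_convergence(2)[OF intn])
    show "(\<lambda>x. norm (h x) * 2) integrable_on K"
      using hK by (intro integrable_on_mult_left) (auto dest: absolutely_integrable_on_def[THEN iffD1])
    show "norm (h x * u k x) \<le> norm (h x) * 2" for k x
      using u2 by (simp add: norm_mult mult_left_mono)
  qed (rule lim)
  then have "integral K (\<lambda>x. if x \<in> C then h x else 0) = 0"
    unfolding int0 using LIMSEQ_unique tendsto_const by blast
  also have "integral K (\<lambda>x. if x \<in> C then h x else 0) = integral C (\<lambda>x. if x \<in> C then h x else 0)"
    by (rule integral_zero_outside(1)[OF \<open>C \<subseteq> K\<close>]) auto
  also have "\<dots> = integral C h" by (rule integral_cong) simp
  finally show ?thesis .
qed simp

text \<open>By inner regularity a closed T inside the set exhausts it up to measure e. T is compact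
  and r > 0 on T has integral 0 there, so T is a null set and the whole set has measure at most
  e.\<close>

lemma negligible_positive_part:
  fixes r :: "'a::euclidean_space \<Rightarrow> real"
  assumes K: "compact K" and r: "r absolutely_integrable_on K"
    and zero: "\<And>C. compact C \<Longrightarrow> C \<subseteq> K \<Longrightarrow> integral C r = 0"
  shows "negligible {x \<in> K. r x > 0}"
proof -
  let ?A = "{x \<in> K. r x > 0}"
  have KL: "K \<in> sets lebesgue" using lmeasurable_compact[OF K] by (rule fmeasurableD)
  have "r \<in> borel_measurable (lebesgue_on K)"
    using r by (rule absolutely_integrable_imp_borel_measurable) (rule KL)
  then have "{x \<in> space (lebesgue_on K). 0 < r x} \<in> sets (lebesgue_on K)"
    by measurable
  then have A: "?A \<in> sets lebesgue"
    using KL by (simp add: sets_restrict_space_iff)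
  have "emeasure lebesgue ?A \<le> 0"
  proof (rule ennreal_le_epsilon)
    fix e :: real assume "e > 0"
    obtain T where T: "closed T" "T \<subseteq> ?A" "?A - T \<in> lmeasurable" "emeasure lebesgue (?A - T) < ennreal e"
      by (rule sets_lebesgue_inner_closed[OF A \<open>e > 0\<close>])
    have "compact T" using compact_Int_closed[OF K T(1)] T(2) by (simp add: Int_absorb1 subset_iff Int_absorb2)
    then have TL: "T \<in> sets lebesgue" using lmeasurable_compact fmeasurableD by blast
    have rT: "r absolutely_integrable_on T"
      by (rule set_integrable_subset[OF r TL]) (use T in auto)
    have "(LINT x|lebesgue. indicat_real T x *\<^sub>R r x) = 0"
      using set_lebesgue_integral_eq_integral(2)[OF rT] zero[OF \<open>compact T\<close>] T(2)
      by (auto simp: set_lebesgue_integral_def)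
    then have "AE x in lebesgue. indicat_real T x *\<^sub>R r x = 0"
      using integral_nonneg_eq_0_iff_AE[of lebesgue "\<lambda>x. indicat_real T x *\<^sub>R r x"] rT T(2)
      by (fastforce simp: set_integrable_def indicator_def less_imp_le)
    then have "AE x in lebesgue. x \<notin> T"
      by eventually_elim (use T(2) in \<open>auto simp: indicator_def\<close>)
    then have "emeasure lebesgue T = 0"
      using AE_iff_null_sets[OF TL] by auto
    have "emeasure lebesgue ?A = emeasure lebesgue (T \<union> (?A - T))"
      using T(2) by (intro arg_cong[of _ _ "emeasure lebesgue"]) blast
    also have "\<dots> \<le> emeasure lebesgue T + emeasure lebesgue (?A - T)"
      by (rule emeasure_subadditive[OF TL]) (use A TL in auto)
    also have "\<dots> \<le> 0 + ennreal e"
      using T(4) \<open>emeasure lebesgue T = 0\<close> by simp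
    finally show "emeasure lebesgue ?A \<le> 0 + ennreal e" .
  qed
  then show ?thesis
    using A by (simp add: negligible_iff_emeasure0)
qed

text \<open>The real case is applied to plus and minus the real and imaginary parts, on countably
  many compact sets exhausting \<Omega>.\<close>

lemma negligible_if_compact_integrals_vanish:
  fixes h :: "'n::finite cfun"
  assumes "open \<Omega>" "loc_int \<Omega> h" and zero: "\<And>C. compact C \<Longrightarrow> C \<subseteq> \<Omega> \<Longrightarrow> integral C h = 0"
  shows "negligible {x \<in> \<Omega>. h x \<noteq> 0}"
proof -
  obtain K :: "nat \<Rightarrow> (real^'n) set" where K: "\<And>n. compact (K n)" "\<And>n. K n \<subseteq> \<Omega>" "\<Union> (range K) = \<Omega>"
    using open_Union_compact_subsets[OF assms(1)] by metis
  have lin: "negligible {x \<in> K n. f (h x) > 0}" if f: "bounded_linear f" for n and f :: "complex \<Rightarrow> real"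
  proof (rule negligible_positive_part[OF K(1)])
    have int: "h absolutely_integrable_on C" if "compact C" "C \<subseteq> \<Omega>" for C
      using that assms(2) by (auto simp: loc_int_def)
    show "(\<lambda>x. f (h x)) absolutely_integrable_on K n"
      using absolutely_integrable_linear[OF int[OF K(1,2)] f] by (simp add: comp_def)
    show "integral C (\<lambda>x. f (h x)) = 0" if "compact C" "C \<subseteq> K n" for C
    proof -
      have C: "C \<subseteq> \<Omega>" using that K(2) by blast
      have "integral C (f \<circ> h) = f (integral C h)"
        using int[OF that(1) C] f by (intro integral_linear) (auto dest: absolutely_integrable_on_def[THEN iffD1])
      then show ?thesis
        using zero[OF that(1) C] linear_0[OF bounded_linear.linear[OF f]] by (simp add: comp_def)
    qed
  qed
  have "negligible (\<Union>n. {x \<in> K n. Re (h x) > 0} \<union> {x \<in> K n. - Re (h x) > 0} \<union>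
      {x \<in> K n. Im (h x) > 0} \<union> {x \<in> K n. - Im (h x) > 0})"
    using lin[OF bounded_linear_Re] lin[OF bounded_linear_minus[OF bounded_linear_Re]]
      lin[OF bounded_linear_Im] lin[OF bounded_linear_minus[OF bounded_linear_Im]]
    by (intro negligible_countable_Union) (auto intro!: negligible_Un)
  then show ?thesis
  proof (rule negligible_subset, intro subsetI)
    fix x assume "x \<in> {x \<in> \<Omega>. h x \<noteq> 0}"
    then obtain n where "x \<in> K n" "h x \<noteq> 0" using K(3) by blast
    then have "x \<in> {x \<in> K n. Re (h x) > 0} \<union> {x \<in> K n. - Re (h x) > 0} \<union>
      {x \<in> K n. Im (h x) > 0} \<union> {x \<in> K n. - Im (h x) > 0}"
      by (auto simp: complex_eq_iff neq_iff)
    then show "x \<in> (\<Union>n. {x \<in> K n. Re (h x) > 0} \<union> {x \<in> K n. - Re (h x) > 0} \<union>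
      {x \<in> K n. Im (h x) > 0} \<union> {x \<in> K n. - Im (h x) > 0})" by blast
  qed
qed

subsection \<open>Moderate and negligible nets\<close>

lemma admissible_eventually:
  assumes "admissible_U U" "n \<ge> 1"
  shows "eventually (\<lambda>\<phi>. \<phi> \<in> Dn n) U"
  using assms by (simp add: admissible_U_def in_U_def)

lemma admissible_Rad_small:
  assumes "admissible_U U" "e > 0"
  shows "eventually (\<lambda>\<phi>. Rad \<phi> < e) U"
proof -
  let ?n = "Suc (nat \<lceil>1 / e\<rceil>)"
  have "1 / e < real ?n" by linarith
  then show ?thesis
    using admissible_eventually[OF assms(1), of ?n] assms(2)
    by (auto elim!: eventually_mono intro!: Dn_antimono_Rad)
qed

lemma admissible_basic:
  assumes "admissible_U U"
  shows "eventually (\<lambda>\<phi>. test_fun UNIV \<phi> \<and> 0 < Rad \<phi> \<and> Rad \<phi> \<le> 1) U"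
  using admissible_eventually[OF assms, of 1] by (rule eventually_mono) (auto dest: DnD)

text \<open>One spare power of \<open>Rad \<phi>\<close> beats any constant. The strict inequality
  is the one that \<open>negl_num\<close> asks for.\<close>

lemma admissible_absorb:
  assumes "admissible_U U"
  shows "eventually (\<lambda>\<phi>. C * Rad \<phi> ^ Suc p < Rad \<phi> ^ p) U"
proof -
  have "0 < 1 / (\<bar>C\<bar> + 1)" by simp
  from admissible_Rad_small[OF assms this] admissible_basic[OF assms]
  show ?thesis
  proof eventually_elim
    case (elim \<phi>)
    have "C * Rad \<phi> \<le> \<bar>C\<bar> * Rad \<phi>" using elim by (intro mult_right_mono) auto
    also have "\<dots> < 1" using elim by (simp add: field_simps)
    finally have "(C * Rad \<phi>) * Rad \<phi> ^ p < 1 * Rad \<phi> ^ p"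
      using elim by (intro mult_strict_right_mono) auto
    then show ?case by (simp add: mult.assoc)
  qed
qed

lemma admissible_absorb_inverse:
  assumes "admissible_U U"
  shows "eventually (\<lambda>\<phi>. C * inverse (Rad \<phi>) ^ m \<le> inverse (Rad \<phi>) ^ Suc m) U"
  using admissible_absorb[OF assms, of C 0] admissible_basic[OF assms]
proof eventually_elim
  case (elim \<phi>)
  then have "C \<le> inverse (Rad \<phi>)" by (simp add: field_simps)
  then show ?case using elim by (auto intro!: mult_right_mono)
qed

text \<open>The radius becomes arbitrarily small along U, and U is proper, so a positive a could not
  stay below C * \<open>Rad \<phi>\<close>.\<close>

lemma admissible_le_0:
  assumes "admissible_U U" "eventually (\<lambda>\<phi>. a \<le> C * Rad \<phi>) U"
  shows "a \<le> (0::real)"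
proof (rule ccontr)
  assume "\<not> a \<le> 0"
  then have "a > 0" by simp
  have "eventually (\<lambda>\<phi>. False) U"
    using assms(2) admissible_absorb[OF assms(1), of "C / a" 0]
    by eventually_elim (use \<open>a > 0\<close> in \<open>simp add: field_simps\<close>)
  then show False using assms(1) by (simp add: admissible_U_def eventually_False)
qed

text \<open>Moderateness along all words. The pieces into which Leibniz splits the word chosen by
  \<open>mpd\<close> need not be words chosen by \<open>mpd\<close>, while the set of all words is
  closed under splitting and concatenation; likewise for \<open>wnegl\<close>.\<close>

definition wmod :: "('n::finite cfun) filter \<Rightarrow> (real^'n) set \<Rightarrow> ('n cfun \<Rightarrow> 'n cfun) \<Rightarrow> bool" where
  "wmod U \<Omega> f \<longleftrightarrow> (\<forall>\<phi>. test_fun UNIV \<phi> \<longrightarrow> smooth_on \<Omega> (f \<phi>)) \<and>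
     (\<forall>K w. compact K \<longrightarrow> K \<subseteq> \<Omega> \<longrightarrow>
        (\<exists>m. eventually (\<lambda>\<phi>. \<forall>x\<in>K. norm (pds w (f \<phi>) x) \<le> inverse (Rad \<phi>) ^ m) U))"

definition wnegl :: "('n::finite cfun) filter \<Rightarrow> (real^'n) set \<Rightarrow> ('n cfun \<Rightarrow> 'n cfun) \<Rightarrow> bool" where
  "wnegl U \<Omega> f \<longleftrightarrow> (\<forall>\<phi>. test_fun UNIV \<phi> \<longrightarrow> smooth_on \<Omega> (f \<phi>)) \<and>
     (\<forall>K w p. compact K \<longrightarrow> K \<subseteq> \<Omega> \<longrightarrow>
        eventually (\<lambda>\<phi>. \<forall>x\<in>K. norm (pds w (f \<phi>) x) \<le> Rad \<phi> ^ p) U)"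

lemma wmod_imp_mod_fun: "wmod U \<Omega> f \<Longrightarrow> mod_fun U \<Omega> f"
  by (auto simp: wmod_def mod_fun_def mpd_mword)

lemma wnegl_imp_negl_fun: "wnegl U \<Omega> f \<Longrightarrow> negl_fun U \<Omega> f"
  by (auto simp: wnegl_def negl_fun_def mpd_mword)

lemma wnegl_smooth: "wnegl U \<Omega> f \<Longrightarrow> test_fun UNIV \<phi> \<Longrightarrow> smooth_on \<Omega> (f \<phi>)"
  by (simp add: wnegl_def)

lemma wmod_smooth: "wmod U \<Omega> f \<Longrightarrow> test_fun UNIV \<phi> \<Longrightarrow> smooth_on \<Omega> (f \<phi>)"
  by (simp add: wmod_def)

lemma wnegl_bound:
  "wnegl U \<Omega> f \<Longrightarrow> compact K \<Longrightarrow> K \<subseteq> \<Omega> \<Longrightarrow> eventually (\<lambda>\<phi>. \<forall>x\<in>K. norm (pds w (f \<phi>) x) \<le> Rad \<phi> ^ p) U"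
  by (simp add: wnegl_def)

lemma wnegl_pds: "wnegl U \<Omega> f \<Longrightarrow> wnegl U \<Omega> (\<lambda>\<phi>. pds u (f \<phi>))"
  unfolding wnegl_def by (auto intro: smooth_on_pds simp flip: pds_append)

lemma wnegl_cong:
  assumes "open \<Omega>" "admissible_U U" "wnegl U \<Omega> f" and eq: "\<And>\<phi> x. test_fun UNIV \<phi> \<Longrightarrow> x \<in> \<Omega> \<Longrightarrow> f \<phi> x = g \<phi> x"
  shows "wnegl U \<Omega> g"
  unfolding wnegl_def
proof (intro conjI allI impI)
  show "smooth_on \<Omega> (g \<phi>)" if "test_fun UNIV \<phi>" for \<phi>
    by (rule smooth_on_cong(1)[OF assms(1) wnegl_smooth[OF assms(3) that] eq[OF that]])
  fix K w p assume K: "compact K" "K \<subseteq> \<Omega>"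
  show "eventually (\<lambda>\<phi>. \<forall>x\<in>K. norm (pds w (g \<phi>) x) \<le> Rad \<phi> ^ p) U"
    using wnegl_bound[OF assms(3) K, of w p] admissible_basic[OF assms(2)]
  proof eventually_elim
    case (elim \<phi>)
    then have "pds w (g \<phi>) x = pds w (f \<phi>) x" if "x \<in> K" for x
      using smooth_on_cong(2)[OF assms(1) wnegl_smooth[OF assms(3)] eq] that K(2) by blast
    then show ?case using elim by simp
  qed
qed

lemma wnegl_lincomb:
  assumes \<Omega>: "open \<Omega>" and U: "admissible_U U" and f: "wnegl U \<Omega> f" and g: "wnegl U \<Omega> g"
  shows "wnegl U \<Omega> (\<lambda>\<phi> x. a * f \<phi> x + b * g \<phi> x)"
  unfolding wnegl_def
proof (intro conjI allI impI)
  show "smooth_on \<Omega> (\<lambda>x. a * f \<phi> x + b * g \<phi> x)" if "test_fun UNIV \<phi>" for \<phi>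
    by (rule smooth_on_lincomb[OF \<Omega> wnegl_smooth[OF f that] wnegl_smooth[OF g that]])
  fix K w p assume K: "compact K" "K \<subseteq> \<Omega>"
  show "eventually (\<lambda>\<phi>. \<forall>x\<in>K. norm (pds w (\<lambda>x. a * f \<phi> x + b * g \<phi> x) x) \<le> Rad \<phi> ^ p) U"
    using wnegl_bound[OF f K, of w "Suc p"] wnegl_bound[OF g K, of w "Suc p"]
      admissible_basic[OF U] admissible_absorb[OF U, of "norm a + norm b" p]
  proof eventually_elim
    case (elim \<phi>)
    show ?case
    proof
      fix x assume x: "x \<in> K"
      have "pds w (\<lambda>x. a * f \<phi> x + b * g \<phi> x) x = a * pds w (f \<phi>) x + b * pds w (g \<phi>) x"
        using elim x K by (intro smooth_on_lincomb[OF \<Omega>] wnegl_smooth[OF f] wnegl_smooth[OF g]) auto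
      also have "norm \<dots> \<le> norm a * norm (pds w (f \<phi>) x) + norm b * norm (pds w (g \<phi>) x)"
        by (metis norm_mult norm_triangle_ineq)
      also have "\<dots> \<le> norm a * Rad \<phi> ^ Suc p + norm b * Rad \<phi> ^ Suc p"
        using elim x by (intro add_mono mult_left_mono) auto
      also have "\<dots> \<le> Rad \<phi> ^ p" using elim by (simp add: distrib_right)
      finally show "norm (pds w (\<lambda>x. a * f \<phi> x + b * g \<phi> x) x) \<le> Rad \<phi> ^ p" .
    qed
  qed
qed

text \<open>The ideal property. Finitely many words occur in the Leibniz rule, so g has a common
  order q on K; taking f to order q + Suc p leaves p powers after division by the growth of g and
  one more for the number of terms.\<close>

lemma wnegl_mult:
  assumes \<Omega>: "open \<Omega>" and U: "admissible_U U" and f: "wnegl U \<Omega> f" and g: "wmod U \<Omega> g"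
  shows "wnegl U \<Omega> (\<lambda>\<phi> x. f \<phi> x * g \<phi> x)"
  unfolding wnegl_def
proof (intro conjI allI impI)
  show "smooth_on \<Omega> (\<lambda>x. f \<phi> x * g \<phi> x)" if "test_fun UNIV \<phi>" for \<phi>
    by (rule smooth_on_mult[OF \<Omega> wnegl_smooth[OF f that] wmod_smooth[OF g that]])
  fix K and w :: "'a list" and p assume K: "compact K" "K \<subseteq> \<Omega>"
  let ?W = "{u :: 'a list. length u \<le> length w}"
  have "\<forall>u. \<exists>m. eventually (\<lambda>\<phi>. \<forall>x\<in>K. norm (pds u (g \<phi>) x) \<le> inverse (Rad \<phi>) ^ m) U"
    using g K by (simp add: wmod_def)
  from choice[OF this] obtain m
    where m: "\<And>u. eventually (\<lambda>\<phi>. \<forall>x\<in>K. norm (pds u (g \<phi>) x) \<le> inverse (Rad \<phi>) ^ m u) U"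
    by blast
  define q where "q = Max (m ` ?W)"
  have q: "m u \<le> q" if "u \<in> ?W" for u
    unfolding q_def using that finite_words by (intro Max_ge) auto
  have "eventually (\<lambda>\<phi>. \<forall>u\<in>?W. \<forall>x\<in>K. norm (pds u (g \<phi>) x) \<le> inverse (Rad \<phi>) ^ m u) U"
    by (intro eventually_ball_finite finite_words ballI m)
  moreover have "eventually (\<lambda>\<phi>. \<forall>u\<in>?W. \<forall>x\<in>K. norm (pds u (f \<phi>) x) \<le> Rad \<phi> ^ (q + Suc p)) U"
    by (intro eventually_ball_finite finite_words ballI wnegl_bound[OF f K])
  ultimately show "eventually (\<lambda>\<phi>. \<forall>x\<in>K. norm (pds w (\<lambda>x. f \<phi> x * g \<phi> x) x) \<le> Rad \<phi> ^ p) U"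
    using admissible_basic[OF U] admissible_absorb[OF U, of "2 ^ length w" p]
  proof eventually_elim
    case (elim \<phi>)
    show ?case
    proof
      fix x assume x: "x \<in> K"
      have "norm (pds w (\<lambda>x. f \<phi> x * g \<phi> x) x) \<le> 2 ^ length w * Rad \<phi> ^ (q + Suc p) * inverse (Rad \<phi>) ^ q"
      proof (rule pds_mult_bound[OF \<Omega>])
        show "smooth_on \<Omega> (f \<phi>)" "smooth_on \<Omega> (g \<phi>)" "x \<in> \<Omega>"
          using elim wnegl_smooth[OF f] wmod_smooth[OF g] x K by auto
        show "norm (pds u (f \<phi>) x) \<le> Rad \<phi> ^ (q + Suc p)" if "length u \<le> length w" for u
          using elim that x by auto
        show "norm (pds u (g \<phi>) x) \<le> inverse (Rad \<phi>) ^ q" if "length u \<le> length w" for u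
        proof -
          have "norm (pds u (g \<phi>) x) \<le> inverse (Rad \<phi>) ^ m u" using elim that x by auto
          also have "\<dots> \<le> inverse (Rad \<phi>) ^ q"
            using elim q that by (intro power_increasing) (auto simp: one_le_inverse)
          finally show ?thesis .
        qed
      qed
      also have "\<dots> = 2 ^ length w * Rad \<phi> ^ Suc p"
        using elim by (simp add: power_add field_simps)
      also have "\<dots> \<le> Rad \<phi> ^ p" using elim by simp
      finally show "norm (pds w (\<lambda>x. f \<phi> x * g \<phi> x) x) \<le> Rad \<phi> ^ p" .
    qed
  qed
qed

lemma compact_neighbourhood_open:
  fixes K :: "'a::euclidean_space set"
  assumes "compact K" "open \<Omega>" "K \<subseteq> \<Omega>"
  obtains W K' where "open W" "K \<subseteq> W" "W \<subseteq> K'" "compact K'" "K' \<subseteq> \<Omega>"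
proof -
  obtain \<delta> where \<delta>: "\<delta> > 0" "compact {x + y | x y. x \<in> K \<and> y \<in> cball 0 \<delta>}"
    "{x + y | x y. x \<in> K \<and> y \<in> cball 0 \<delta>} \<subseteq> \<Omega>"
    by (rule compact_neighbourhood[OF assms]) (rule that)
  show ?thesis
  proof (rule that[of "\<Union>x\<in>K. ball x \<delta>"])
    show "(\<Union>x\<in>K. ball x \<delta>) \<subseteq> {x + y | x y. x \<in> K \<and> y \<in> cball 0 \<delta>}"
    proof
      fix z assume "z \<in> (\<Union>x\<in>K. ball x \<delta>)"
      then obtain x where "x \<in> K" "dist x z < \<delta>" by auto
      then have "z = x + (z - x) \<and> x \<in> K \<and> z - x \<in> cball 0 \<delta>"
        by (simp add: dist_norm norm_minus_commute)
      then show "z \<in> {x + y | x y. x \<in> K \<and> y \<in> cball 0 \<delta>}" by blast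
    qed
  qed (use \<delta> in auto)
qed

text \<open>Vanishing on K alone does not control derivatives at points of K. The hypothesis is
  therefore used on a compact neighbourhood, whose enclosed open set W makes all derivatives on K
  vanish.\<close>

lemma wnegl_if_eventually_zero:
  assumes \<Omega>: "open \<Omega>" and U: "admissible_U U" and smooth: "\<And>\<phi>. test_fun UNIV \<phi> \<Longrightarrow> smooth_on \<Omega> (f \<phi>)"
    and zero: "\<And>K. compact K \<Longrightarrow> K \<subseteq> \<Omega> \<Longrightarrow> eventually (\<lambda>\<phi>. \<forall>x\<in>K. f \<phi> x = 0) U"
  shows "wnegl U \<Omega> f"
  unfolding wnegl_def
proof (intro conjI allI impI smooth)
  fix K w p assume K: "compact K" "K \<subseteq> \<Omega>"
  obtain W K' where W: "open W" "K \<subseteq> W" "W \<subseteq> K'" "compact K'" "K' \<subseteq> \<Omega>"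
    by (rule compact_neighbourhood_open[OF K(1) \<Omega> K(2)])
  show "eventually (\<lambda>\<phi>. \<forall>x\<in>K. norm (pds w (f \<phi>) x) \<le> Rad \<phi> ^ p) U"
    using zero[OF W(4,5)] admissible_basic[OF U]
  proof eventually_elim
    case (elim \<phi>)
    have "pds w (f \<phi>) x = pds w (\<lambda>_. 0) x" if "x \<in> K" for x
      by (rule smooth_on_cong(2)[OF W(1) smooth_on_subset[OF smooth_on_zero]]) (use elim W that in auto)
    then show ?case using elim by (simp add: pds_zero)
  qed
qed

subsection \<open>The embeddings\<close>

lemma Emb_smooth:
  assumes "open \<Omega>" "wdist \<Omega> T" "test_fun UNIV \<phi>"
  shows "smooth_on UNIV (Emb \<Omega> T \<phi>)"
    and "pds w (Emb \<Omega> T \<phi>) x = T (\<lambda>t. Cut \<Omega> \<phi> t * pds w \<phi> (x - t))"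
  using smooth_conv[OF assms(2) Cut_smooth(1)[OF assms(1,3)] test_funD(3)[OF Cut_smooth(2)[OF assms(1,3)]] assms(3)]
  by (simp_all add: Emb_def conv_def[abs_def])

text \<open>The cut-off disappears from the kernel once it equals 1 on a compact L that contains
  every t within \<open>Rad \<phi>\<close> of K. All words are treated at once, because the
  derivatives of \<phi> are supported in the same ball as \<phi>.\<close>

lemma Cut_local:
  assumes \<Omega>: "open \<Omega>" and U: "admissible_U U" and K: "compact K" "K \<subseteq> \<Omega>"
  obtains L where "compact L" "K \<subseteq> L" "L \<subseteq> \<Omega>"
    "eventually (\<lambda>\<phi>. \<forall>t\<in>L. Cut \<Omega> \<phi> t = 1) U"
    "eventually (\<lambda>\<phi>. \<forall>x\<in>K. \<forall>t. norm (x - t) \<le> Rad \<phi> \<longrightarrow> t \<in> L) U"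
    "eventually (\<lambda>\<phi>. \<forall>x\<in>K. \<forall>w. (\<lambda>t. Cut \<Omega> \<phi> t * pds w \<phi> (x - t)) = (\<lambda>t. pds w \<phi> (x - t)) \<and>
       test_fun \<Omega> (\<lambda>t. pds w \<phi> (x - t)) \<and> tsupp (\<lambda>t. pds w \<phi> (x - t)) \<subseteq> L) U"
proof -
  obtain \<delta> where \<delta>: "\<delta> > 0" "compact {x + y | x y. x \<in> K \<and> y \<in> cball 0 \<delta>}"
    "{x + y | x y. x \<in> K \<and> y \<in> cball 0 \<delta>} \<subseteq> \<Omega>"
    by (rule compact_neighbourhood[OF K(1) \<Omega> K(2)]) (rule that)
  define L where "L = {x + y | x y. x \<in> K \<and> y \<in> cball 0 \<delta>}"
  note L = \<delta>(2,3)[folded L_def]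
  have inL: "t \<in> L" if "x \<in> K" "norm (x - t) \<le> \<delta>" for x t
  proof -
    have "t = x + (t - x) \<and> x \<in> K \<and> t - x \<in> cball 0 \<delta>"
      using that by (simp add: norm_minus_commute)
    then show ?thesis unfolding L_def by blast
  qed
  obtain n where n: "n \<ge> 1" "\<And>\<phi> x. \<phi> \<in> Dn n \<Longrightarrow> x \<in> L \<Longrightarrow> Cut \<Omega> \<phi> x = 1"
    by (rule Cut_eq_1[OF \<Omega> L]) (rule that)
  have e1: "eventually (\<lambda>\<phi>. \<forall>t\<in>L. Cut \<Omega> \<phi> t = 1) U"
    using admissible_eventually[OF U n(1)] by (rule eventually_mono) (use n(2) in auto)
  have e2: "eventually (\<lambda>\<phi>. \<forall>x\<in>K. \<forall>t. norm (x - t) \<le> Rad \<phi> \<longrightarrow> t \<in> L) U"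
    using admissible_Rad_small[OF U \<delta>(1)] by (rule eventually_mono) (auto intro!: inL)
  have "eventually (\<lambda>\<phi>. \<forall>x\<in>K. \<forall>w. (\<lambda>t. Cut \<Omega> \<phi> t * pds w \<phi> (x - t)) = (\<lambda>t. pds w \<phi> (x - t)) \<and>
       test_fun \<Omega> (\<lambda>t. pds w \<phi> (x - t)) \<and> tsupp (\<lambda>t. pds w \<phi> (x - t)) \<subseteq> L) U"
    using e1 e2 admissible_basic[OF U]
  proof eventually_elim
    case (elim \<phi>)
    then have \<phi>: "test_fun UNIV \<phi>" by simp
    have z: "pds w \<phi> (x - t) = 0" if "x \<in> K" "t \<notin> L" for x t w
    proof (rule pds_outside_tsupp)
      have "tsupp \<phi> \<subseteq> cball 0 (Rad \<phi>)"
        by (rule tsupp_subset) (auto intro!: Rad_bound[OF \<phi>])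
      moreover have "x - t \<notin> cball 0 (Rad \<phi>)" using elim(2) that by auto
      ultimately show "x - t \<notin> tsupp \<phi>" by blast
    qed
    show ?case
    proof (intro ballI allI conjI)
      fix x w assume x: "x \<in> K"
      show "(\<lambda>t. Cut \<Omega> \<phi> t * pds w \<phi> (x - t)) = (\<lambda>t. pds w \<phi> (x - t))"
      proof
        fix t show "Cut \<Omega> \<phi> t * pds w \<phi> (x - t) = pds w \<phi> (x - t)"
          using elim(1) z[OF x, of t w] by (cases "t \<in> L") auto
      qed
      show "test_fun \<Omega> (\<lambda>t. pds w \<phi> (x - t))"
        using z[OF x] L
        by (intro test_funI[of _ L] smooth_on_reflect(1)[OF smooth_on_pds[OF test_funD(1)[OF \<phi>]]]) auto
      show "tsupp (\<lambda>t. pds w \<phi> (x - t)) \<subseteq> L"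
        using z[OF x] L by (intro tsupp_subset compact_imp_closed) auto
    qed
  qed
  moreover have "K \<subseteq> L" using inL \<delta>(1) by force
  ultimately show ?thesis using that L e1 e2 by blast
qed

lemma wmod_Emb:
  assumes \<Omega>: "open \<Omega>" and U: "admissible_U U" and T: "wdist \<Omega> T"
  shows "wmod U \<Omega> (Emb \<Omega> T)"
  unfolding wmod_def
proof (intro conjI allI impI)
  show "smooth_on \<Omega> (Emb \<Omega> T \<phi>)" if "test_fun UNIV \<phi>" for \<phi>
    using Emb_smooth(1)[OF \<Omega> T that] by (rule smooth_on_subset) simp
  fix K and w :: "'a list" assume K: "compact K" "K \<subseteq> \<Omega>"
  obtain L where L: "compact L" "L \<subseteq> \<Omega>"
    and ev: "eventually (\<lambda>\<phi>. \<forall>x\<in>K. \<forall>w. (\<lambda>t. Cut \<Omega> \<phi> t * pds w \<phi> (x - t)) = (\<lambda>t. pds w \<phi> (x - t)) \<and>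
       test_fun \<Omega> (\<lambda>t. pds w \<phi> (x - t)) \<and> tsupp (\<lambda>t. pds w \<phi> (x - t)) \<subseteq> L) U"
    by (rule Cut_local[OF \<Omega> U K])
  obtain C m where C: "C \<ge> 0" "\<forall>\<tau> B. test_fun \<Omega> \<tau> \<longrightarrow> tsupp \<tau> \<subseteq> L \<longrightarrow>
      (\<forall>w x. length w \<le> m \<longrightarrow> norm (pds w \<tau> x) \<le> B) \<longrightarrow> norm (T \<tau>) \<le> C * B"
    using wdist_bound[OF T L] by blast
  \<comment> \<open>Order m of T on L plus the derivatives w falling on \<phi>; the + 1 secures n
    \<ge> 1. \<open>?q\<close> is the exponent given by \<open>Dn\<close>, and the
    \<open>Suc\<close> below absorbs C.\<close>
  let ?n = "m + length w + 1"
  let ?q = "2 * (m + length w + CARD('a))"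
  show "\<exists>m. eventually (\<lambda>\<phi>. \<forall>x\<in>K. norm (pds w (Emb \<Omega> T \<phi>) x) \<le> inverse (Rad \<phi>) ^ m) U"
  proof (intro exI[of _ "Suc ?q"])
    have n1: "?n \<ge> 1" by simp
    show "eventually (\<lambda>\<phi>. \<forall>x\<in>K. norm (pds w (Emb \<Omega> T \<phi>) x) \<le> inverse (Rad \<phi>) ^ Suc ?q) U"
      using ev admissible_eventually[OF U n1] admissible_absorb_inverse[OF U, of C ?q]
    proof eventually_elim
      case (elim \<phi>)
      note D = DnD[OF elim(2) n1]
      show ?case
      proof
        fix x assume x: "x \<in> K"
        have "norm (T (\<lambda>t. pds w \<phi> (x - t))) \<le> C * inverse (Rad \<phi>) ^ ?q"
        proof (rule C(2)[rule_format])
          fix v :: "'a list" and t assume v: "length v \<le> m"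
          have "norm (pds v (\<lambda>t. pds w \<phi> (x - t)) t) = norm (mpd (count_list (v @ w)) \<phi> (x - t))"
            unfolding smooth_on_reflect(2)[OF smooth_on_pds[OF test_funD(1)[OF D(1)]]]
              pds_append[symmetric] pds_eq_mpd[OF test_funD(1)[OF D(1)], of "v @ w"]
            by (simp add: norm_mult norm_power)
          also have "\<dots> \<le> inverse (Rad \<phi>) ^ (2 * (mdeg (count_list (v @ w)) + CARD('a)))"
            by (rule D(9)) (use v in \<open>simp only: mdeg_count_list length_append\<close>)
          also have "\<dots> \<le> inverse (Rad \<phi>) ^ ?q"
            unfolding mdeg_count_list using v D(3,5) by (intro power_increasing) (auto simp: one_le_inverse)
          finally show "norm (pds v (\<lambda>t. pds w \<phi> (x - t)) t) \<le> inverse (Rad \<phi>) ^ ?q" .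
        qed (use elim x in auto)
        then show "norm (pds w (Emb \<Omega> T \<phi>) x) \<le> inverse (Rad \<phi>) ^ Suc ?q"
          using elim x by (simp add: Emb_smooth(2)[OF \<Omega> T D(1)])
      qed
    qed
  qed
qed

lemma wmod_sig:
  assumes U: "admissible_U U" and f: "smooth_on \<Omega> f"
  shows "wmod U \<Omega> (sig f)"
  unfolding wmod_def
proof (intro conjI allI impI)
  show "smooth_on \<Omega> (sig f \<phi>)" for \<phi> using f by (simp add: sig_def)
  fix K and w :: "'a list" assume K: "compact K" "K \<subseteq> \<Omega>"
  obtain M where "M \<ge> 0" "\<And>v x. length v \<le> length w \<Longrightarrow> x \<in> K \<Longrightarrow> norm (pds v f x) \<le> M"
    by (rule pds_bounded_on_compact[OF f K, of "length w"]) (rule that)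
  then have M: "\<And>x. x \<in> K \<Longrightarrow> norm (pds w f x) \<le> M" by simp
  have "eventually (\<lambda>\<phi>. \<forall>x\<in>K. norm (pds w (sig f \<phi>) x) \<le> inverse (Rad \<phi>) ^ 1) U"
    using admissible_absorb_inverse[OF U, of M 0]
    by eventually_elim (use M in \<open>force simp: sig_def\<close>)
  then show "\<exists>m. eventually (\<lambda>\<phi>. \<forall>x\<in>K. norm (pds w (sig f \<phi>) x) \<le> inverse (Rad \<phi>) ^ m) U" by blast
qed

text \<open>f is arbitrary outside \<Omega>, yet the product is smooth on \<Omega> and zero off the
  support of c, and these two open sets cover the space.\<close>

lemma test_fun_cutoff_mult:
  assumes \<Omega>: "open \<Omega>" and f: "smooth_on \<Omega> f" and c: "test_fun \<Omega> c"
  shows "test_fun \<Omega> (\<lambda>x. c x * f x)"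
proof (rule test_funI[of _ "tsupp c"])
  have 1: "smooth_on \<Omega> (\<lambda>x. c x * f x)"
    using \<Omega> f smooth_on_subset[OF test_funD(1)[OF c]] by (intro smooth_on_mult) auto
  have 2: "smooth_on (- tsupp c) (\<lambda>x. c x * f x)"
    by (rule smooth_on_cong(1)[of _ "\<lambda>_. 0"]) (auto simp: tsupp_outside intro: smooth_on_subset[OF smooth_on_zero])
  have "\<Omega> \<union> - tsupp c = UNIV" using test_funD(3)[OF c] by auto
  then show "smooth_on UNIV (\<lambda>x. c x * f x)"
    using smooth_on_Un[OF \<Omega> _ 1 2] by (simp add: open_Compl)
qed (use c in \<open>auto simp: test_fun_def tsupp_outside\<close>)

text \<open>The mollification estimate needs globally bounded derivatives, which f may lack near the
  boundary. Near K the regularization sees f only on a compact L, where f may be replaced by a test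
  function g.\<close>

lemma Emb_smooth_fun:
  assumes \<Omega>: "open \<Omega>" and U: "admissible_U U" and f: "smooth_on \<Omega> f"
  shows "wnegl U \<Omega> (\<lambda>\<phi> x. Emb \<Omega> (Lemb \<Omega> f) \<phi> x - f x)"
  unfolding wnegl_def
proof (intro conjI allI impI)
  note T = wdist_Lemb[OF smooth_on_loc_int[OF f]]
  show "smooth_on \<Omega> (\<lambda>x. Emb \<Omega> (Lemb \<Omega> f) \<phi> x - f x)" if "test_fun UNIV \<phi>" for \<phi>
    using Emb_smooth(1)[OF \<Omega> T that] f \<Omega> by (intro smooth_on_diff) (auto intro: smooth_on_subset)
  fix K and w :: "'a list" and p assume K: "compact K" "K \<subseteq> \<Omega>"
  \<comment> \<open>Derivatives at points of K require the replacement of f by g to be an identity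
    on an open set, here W.\<close>
  obtain W K' where W: "open W" "K \<subseteq> W" "W \<subseteq> K'" "compact K'" "K' \<subseteq> \<Omega>"
    by (rule compact_neighbourhood_open[OF K(1) \<Omega> K(2)])
  obtain L where L: "compact L" "K' \<subseteq> L" "L \<subseteq> \<Omega>"
    and cut1: "eventually (\<lambda>\<phi>. \<forall>t\<in>L. Cut \<Omega> \<phi> t = 1) U"
    and near: "eventually (\<lambda>\<phi>. \<forall>x\<in>K'. \<forall>t. norm (x - t) \<le> Rad \<phi> \<longrightarrow> t \<in> L) U"
    and ev: "eventually (\<lambda>\<phi>. \<forall>x\<in>K'. \<forall>w. (\<lambda>t. Cut \<Omega> \<phi> t * pds w \<phi> (x - t)) = (\<lambda>t. pds w \<phi> (x - t)) \<and>
       test_fun \<Omega> (\<lambda>t. pds w \<phi> (x - t)) \<and> tsupp (\<lambda>t. pds w \<phi> (x - t)) \<subseteq> L) U"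
    by (rule Cut_local[OF \<Omega> U W(4,5)])
  \<comment> \<open>The ultrafilter itself supplies a test function equal to 1 on \<open>L\<close>.\<close>
  have "U \<noteq> bot" using U by (simp add: admissible_U_def)
  then obtain \<phi>0 where \<phi>0: "\<And>t. t \<in> L \<Longrightarrow> Cut \<Omega> \<phi>0 t = 1" "test_fun UNIV \<phi>0"
    using eventually_happens'[OF _ eventually_conj[OF cut1 admissible_basic[OF U]]] by blast
  define g where "g = (\<lambda>x. Cut \<Omega> \<phi>0 x * f x)"
  have g\<Omega>: "test_fun \<Omega> g"
    unfolding g_def by (rule test_fun_cutoff_mult[OF \<Omega> f Cut_smooth(2)[OF \<Omega> \<phi>0(2)]])
  have g: "test_fun UNIV g" by (rule test_fun_mono[OF g\<Omega>]) simp
  have gf: "g t = f t" if "t \<in> L" for t using \<phi>0 that by (simp add: g_def)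
  \<comment> \<open>\<open>length w\<close> derivatives for the one being estimated and Suc p for
    the Taylor remainder; M is fixed before \<phi>.\<close>
  obtain M where M: "\<And>v x. length v \<le> Suc p + length w \<Longrightarrow> norm (pds v g x) \<le> M"
    by (rule test_fun_bounded[OF g, of "Suc p + length w"]) (rule that)
  have n1: "Suc p \<ge> 1" by simp
  show "eventually (\<lambda>\<phi>. \<forall>x\<in>K. norm (pds w (\<lambda>x. Emb \<Omega> (Lemb \<Omega> f) \<phi> x - f x) x) \<le> Rad \<phi> ^ p) U"
    using near ev admissible_eventually[OF U n1]
      admissible_absorb[OF U, of "2 * real CARD('a) ^ Suc p * M" p]
  proof eventually_elim
    case (elim \<phi>)
    note D = DnD[OF elim(3) n1]
    let ?m = "\<lambda>x. integral UNIV (\<lambda>y. \<phi> y * g (x - y))"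
    have eq: "Emb \<Omega> (Lemb \<Omega> f) \<phi> x - f x = ?m x - g x" if x: "x \<in> W" for x
    proof -
      have xK: "x \<in> K'" using x W by auto
      then have "Emb \<Omega> (Lemb \<Omega> f) \<phi> x = Lemb \<Omega> f (\<lambda>t. \<phi> (x - t))"
        using elim(2)[rule_format, of x "[]"] by (simp add: Emb_def conv_def)
      also have "\<dots> = integral \<Omega> (\<lambda>t. g t * \<phi> (x - t))"
        unfolding Lemb_def
      proof (rule integral_cong)
        fix t
        show "f t * \<phi> (x - t) = g t * \<phi> (x - t)"
          using elim(1) xK gf[of t] Rad_bound[OF D(1), of "x - t"] by (cases "norm (x - t) \<le> Rad \<phi>") auto
      qed
      also have "\<dots> = integral UNIV (\<lambda>t. g t * \<phi> (x - t))"
        using test_funD(3)[OF g\<Omega>] tsupp_outside[of _ g]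
        by (intro integral_zero_outside(1)[symmetric]) auto
      also have "\<dots> = ?m x" by (rule mollify_commute[OF D(1) g, symmetric])
      finally show ?thesis using xK L gf by auto
    qed
    note sg = test_funD(1)[OF g] and sm = mollify_smooth(1)[OF D(1) g]
    show ?case
    proof
      fix x assume "x \<in> K"
      then have x: "x \<in> W" using W by auto
      have "pds w (\<lambda>x. Emb \<Omega> (Lemb \<Omega> f) \<phi> x - f x) x = pds w (\<lambda>x. ?m x - g x) x"
        by (rule smooth_on_cong(2)[OF W(1) smooth_on_subset[OF smooth_on_diff(1)[OF open_UNIV sm sg]] _ x])
          (use eq in auto)
      also have "\<dots> = integral UNIV (\<lambda>y. \<phi> y * pds w g (x - y)) - pds w g x"
        by (simp add: smooth_on_diff(2)[OF open_UNIV sm sg] mollify_smooth(2)[OF D(1) g])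
      also have "norm \<dots> \<le> 2 * real CARD('a) ^ Suc p * M * Rad \<phi> ^ Suc p"
      proof (rule Dn_mollify_estimate[OF elim(3)])
        show "norm (pds v (pds w g) z) \<le> M" if "length v = Suc p" for v z
          using M[of "v @ w" z] that by (simp add: pds_append)
      qed (auto intro: smooth_on_pds sg)
      also have "\<dots> \<le> Rad \<phi> ^ p" using elim(4) by simp
      finally show "norm (pds w (\<lambda>x. Emb \<Omega> (Lemb \<Omega> f) \<phi> x - f x) x) \<le> Rad \<phi> ^ p" .
    qed
  qed
qed

text \<open>The pairing equals T applied to the mollified \<tau>: the cut-off is 1 on L, which
  contains the support of the mollified \<tau>. The difference is then T applied to \<tau> minus its
  mollification, whose derivatives up to the order m of T on L are small.\<close>

lemma Emb_pairing:
  assumes \<Omega>: "open \<Omega>" and U: "admissible_U U" and T: "wdist \<Omega> T" and \<tau>: "test_fun \<Omega> \<tau>"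
  shows "negl_num U (\<lambda>\<phi>. T \<tau> - pairing \<Omega> (Emb \<Omega> T) \<tau> \<phi>)"
  unfolding negl_num_def
proof (intro allI impI)
  fix p :: nat assume "p \<ge> 1"
  have \<tau>U: "test_fun UNIV \<tau>" by (rule test_fun_mono[OF \<tau>]) simp
  obtain L where L: "compact L" "tsupp \<tau> \<subseteq> L" "L \<subseteq> \<Omega>"
    and cut1: "eventually (\<lambda>\<phi>. \<forall>t\<in>L. Cut \<Omega> \<phi> t = 1) U"
    and near: "eventually (\<lambda>\<phi>. \<forall>x\<in>tsupp \<tau>. \<forall>t. norm (x - t) \<le> Rad \<phi> \<longrightarrow> t \<in> L) U"
    by (rule Cut_local[OF \<Omega> U test_funD(2,3)[OF \<tau>]])
  obtain C m where C: "C \<ge> 0" "\<forall>\<tau> B. test_fun \<Omega> \<tau> \<longrightarrow> tsupp \<tau> \<subseteq> L \<longrightarrow>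
      (\<forall>w x. length w \<le> m \<longrightarrow> norm (pds w \<tau> x) \<le> B) \<longrightarrow> norm (T \<tau>) \<le> C * B"
    using wdist_bound[OF T L(1,3)] by blast
  obtain M where M: "\<And>v x. length v \<le> Suc p + m \<Longrightarrow> norm (pds v \<tau> x) \<le> M"
    by (rule test_fun_bounded[OF \<tau>, of "Suc p + m"]) (rule that)
  have n1: "Suc p \<ge> 1" by simp
  show "eventually (\<lambda>\<phi>. norm (T \<tau> - pairing \<Omega> (Emb \<Omega> T) \<tau> \<phi>) < Rad \<phi> ^ p) U"
    using cut1 near admissible_eventually[OF U n1]
      admissible_absorb[OF U, of "C * (2 * real CARD('a) ^ Suc p * M)" p]
  proof eventually_elim
    case (elim \<phi>)
    note D = DnD[OF elim(3) n1]
    let ?m = "\<lambda>x. integral UNIV (\<lambda>y. \<phi> y * \<tau> (x - y))"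
    \<comment> \<open>Integrating the kernel \<phi> (x - t) against \<tau> over x gives a
      convolution with the reflected \<phi>; evenness makes it the mollification of \<tau> by
      \<phi>.\<close>
    have even: "\<phi> (x - t) = \<phi> (t - x)" for x t
      using D(2)[of "t - x"] by simp
    note sm = mollify_smooth(1)[OF D(1) \<tau>U]
    have out: "?m t = 0" if "t \<notin> L" for t
    proof -
      have "\<tau> y * \<phi> (t - y) = 0" for y
      proof (cases "y \<in> tsupp \<tau>")
        case True
        then have "Rad \<phi> < norm (y - t)" using elim(2) that by force
        then show ?thesis using Rad_bound[OF D(1), of "t - y"] by (simp add: norm_minus_commute)
      qed (simp add: tsupp_outside)
      then have "(\<lambda>y. \<tau> y * \<phi> (t - y)) = (\<lambda>_. 0)" by (rule ext)
      then show ?thesis by (simp add: mollify_commute[OF D(1) \<tau>U])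
    qed
    have "pairing \<Omega> (Emb \<Omega> T) \<tau> \<phi> = integral UNIV (\<lambda>x. Emb \<Omega> T \<phi> x * \<tau> x)"
      unfolding pairing_def using test_funD(3)[OF \<tau>] tsupp_outside[of _ \<tau>]
      by (intro integral_zero_outside(1)[symmetric]) auto
    also have "\<dots> = integral UNIV (\<lambda>x. T (\<lambda>t. Cut \<Omega> \<phi> t * \<phi> (t - x)) * \<tau> x)"
      by (simp add: Emb_def conv_def even)
    also have "\<dots> = T (\<lambda>t. Cut \<Omega> \<phi> t * integral UNIV (\<lambda>x. \<tau> x * \<phi> (t - x)))"
      by (rule wdist_integral[OF T Cut_smooth(2)[OF \<Omega> D(1)] D(1) \<tau>U])
    also have "(\<lambda>t. Cut \<Omega> \<phi> t * integral UNIV (\<lambda>x. \<tau> x * \<phi> (t - x))) = ?m"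
    proof
      fix t
      show "Cut \<Omega> \<phi> t * integral UNIV (\<lambda>x. \<tau> x * \<phi> (t - x)) = ?m t"
        using elim(1) out[of t] by (cases "t \<in> L") (simp_all flip: mollify_commute[OF D(1) \<tau>U])
    qed
    finally have pair: "pairing \<Omega> (Emb \<Omega> T) \<tau> \<phi> = T ?m" .
    have tm: "test_fun \<Omega> ?m" by (rule test_funI[OF sm L(1,3) out])
    have "norm (T (\<lambda>x. \<tau> x - ?m x)) \<le> C * (2 * real CARD('a) ^ Suc p * M * Rad \<phi> ^ Suc p)"
    proof (rule C(2)[rule_format])
      show "test_fun \<Omega> (\<lambda>x. \<tau> x - ?m x)" by (rule test_fun_diff[OF \<tau> tm])
      show "tsupp (\<lambda>x. \<tau> x - ?m x) \<subseteq> L"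
        using out L(1,2) tsupp_outside[of _ \<tau>] by (intro tsupp_subset) (auto intro: compact_imp_closed)
      fix v :: "'a list" and x assume v: "length v \<le> m"
      have "pds v (\<lambda>x. \<tau> x - ?m x) x = pds v \<tau> x - integral UNIV (\<lambda>y. \<phi> y * pds v \<tau> (x - y))"
        by (simp add: smooth_on_diff(2)[OF open_UNIV test_funD(1)[OF \<tau>] sm] mollify_smooth(2)[OF D(1) \<tau>U])
      also have "norm \<dots> \<le> 2 * real CARD('a) ^ Suc p * M * Rad \<phi> ^ Suc p"
        unfolding norm_minus_commute[of "pds v \<tau> x"]
      proof (rule Dn_mollify_estimate[OF elim(3)])
        show "norm (pds u (pds v \<tau>) z) \<le> M" if "length u = Suc p" for u z
          using M[of "u @ v" z] that v by (simp add: pds_append)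
      qed (auto intro: smooth_on_pds test_funD(1)[OF \<tau>])
      finally show "norm (pds v (\<lambda>x. \<tau> x - ?m x) x) \<le> 2 * real CARD('a) ^ Suc p * M * Rad \<phi> ^ Suc p" .
    qed
    then show ?case
      using elim(4) by (simp add: pair wdist_diff[OF T \<tau> tm] mult.assoc)
  qed
qed

section \<open>Injectivity on distributions\<close>

lemma negl_fun_eventually:
  assumes "negl_fun U \<Omega> f" "compact K" "K \<subseteq> \<Omega>"
  shows "eventually (\<lambda>\<phi>. \<forall>x\<in>K. norm (f \<phi> x) \<le> Rad \<phi>) U"
proof -
  have "eventually (\<lambda>\<phi>. \<forall>x\<in>K. norm (mpd (\<lambda>_. 0) (f \<phi>) x) \<le> Rad \<phi> ^ 1) U"
    using assms unfolding negl_fun_def by blast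
  then show ?thesis by (simp add: mpd_zero_index)
qed

text \<open>Both values are recovered from the pairings up to an infinitesimal, and equivalent nets
  have infinitely close pairings; two complex numbers that are infinitely close are equal.\<close>

lemma Emb_inject:
  assumes \<Omega>: "open \<Omega>" and U: "admissible_U U" and T: "wdist \<Omega> T" and S: "wdist \<Omega> S"
    and eq: "fun_eq U \<Omega> (Emb \<Omega> T) (Emb \<Omega> S)" and \<tau>: "test_fun \<Omega> \<tau>"
  shows "T \<tau> = S \<tau>"
proof -
  let ?I = "integral UNIV (\<lambda>x. norm (\<tau> x))"
  have \<tau>U: "test_fun UNIV \<tau>" by (rule test_fun_mono[OF \<tau>]) simp
  have small: "eventually (\<lambda>\<phi>. norm (R \<tau> - pairing \<Omega> (Emb \<Omega> R) \<tau> \<phi>) < Rad \<phi>) U" if "wdist \<Omega> R" for R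
    using Emb_pairing[OF \<Omega> U that \<tau>] unfolding negl_num_def by (auto dest: spec[of _ 1])
  \<comment> \<open>The 2 stands for the two pairing errors, \<open>?I\<close> for the difference of
    the nets on the support of \<tau>.\<close>
  have "eventually (\<lambda>\<phi>. norm (T \<tau> - S \<tau>) \<le> (2 + ?I) * Rad \<phi>) U"
    using small[OF T] small[OF S] admissible_basic[OF U]
      negl_fun_eventually[OF eq[unfolded fun_eq_def] test_funD(2,3)[OF \<tau>]]
  proof eventually_elim
    case (elim \<phi>)
    then have \<phi>: "test_fun UNIV \<phi>" by simp
    have P: "pairing \<Omega> (Emb \<Omega> R) \<tau> \<phi> = integral UNIV (\<lambda>x. \<tau> x * Emb \<Omega> R \<phi> x)" for R
      unfolding pairing_def mult.commute[of "\<tau> _"] using test_funD(3)[OF \<tau>] tsupp_outside[of _ \<tau>]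
      by (intro integral_zero_outside(1)[symmetric]) auto
    have int: "(\<lambda>x. \<tau> x * Emb \<Omega> R \<phi> x) integrable_on UNIV" if "wdist \<Omega> R" for R
      using test_fun_mult_integrable[OF \<tau>U smooth_on_continuous[OF Emb_smooth(1)[OF \<Omega> that \<phi>], of "[]", simplified]]
      by (auto dest: absolutely_integrable_on_def[THEN iffD1])
    have "norm (integral UNIV (\<lambda>x. \<tau> x * Emb \<Omega> T \<phi> x - \<tau> x * Emb \<Omega> S \<phi> x)) \<le> integral UNIV (\<lambda>x. norm (\<tau> x) * Rad \<phi>)"
    proof (rule integral_norm_bound_integral)
      show "(\<lambda>x. \<tau> x * Emb \<Omega> T \<phi> x - \<tau> x * Emb \<Omega> S \<phi> x) integrable_on UNIV"
        by (intro integrable_diff int T S)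
      show "(\<lambda>x. norm (\<tau> x) * Rad \<phi>) integrable_on UNIV"
        using test_fun_norm_integrable[OF \<tau>U]
        by (intro integrable_on_mult_left) (auto dest: absolutely_integrable_on_def[THEN iffD1])
      show "norm (\<tau> x * Emb \<Omega> T \<phi> x - \<tau> x * Emb \<Omega> S \<phi> x) \<le> norm (\<tau> x) * Rad \<phi>" for x
        using elim(4) tsupp_outside[of x \<tau>]
        by (cases "x \<in> tsupp \<tau>") (auto simp: norm_mult mult_left_mono simp flip: right_diff_distrib)
    qed
    then have "norm (pairing \<Omega> (Emb \<Omega> T) \<tau> \<phi> - pairing \<Omega> (Emb \<Omega> S) \<tau> \<phi>) \<le> ?I * Rad \<phi>"
      by (simp add: P integral_diff int T S)
    moreover have "T \<tau> - S \<tau> = (T \<tau> - pairing \<Omega> (Emb \<Omega> T) \<tau> \<phi>) - (S \<tau> - pairing \<Omega> (Emb \<Omega> S) \<tau> \<phi>)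
        + (pairing \<Omega> (Emb \<Omega> T) \<tau> \<phi> - pairing \<Omega> (Emb \<Omega> S) \<tau> \<phi>)" by simp
    ultimately have "norm (T \<tau> - S \<tau>) \<le> (Rad \<phi> + Rad \<phi>) + ?I * Rad \<phi>"
      using elim(1,2) by (metis (no_types, lifting) add_mono less_imp_le norm_triangle_le norm_triangle_le_diff)
    then show ?case by (simp add: algebra_simps)
  qed
  then have "norm (T \<tau> - S \<tau>) \<le> 0" by (rule admissible_le_0[OF U])
  then show ?thesis by simp
qed

section \<open>Algebraic operations, derivatives and restrictions\<close>

lemma fun_eq_if_wnegl:
  "wnegl U \<Omega> (\<lambda>\<phi> x. f \<phi> x - g \<phi> x) \<Longrightarrow> fun_eq U \<Omega> f g"
  by (simp add: fun_eq_def wnegl_imp_negl_fun)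

lemma fun_eq_if_eq:
  assumes \<Omega>: "open \<Omega>" and U: "admissible_U U"
    and eq: "\<And>\<phi> x. test_fun UNIV \<phi> \<Longrightarrow> x \<in> \<Omega> \<Longrightarrow> f \<phi> x = g \<phi> x"
  shows "fun_eq U \<Omega> f g"
proof (rule fun_eq_if_wnegl, rule wnegl_if_eventually_zero[OF \<Omega> U])
  show "smooth_on \<Omega> (\<lambda>x. f \<phi> x - g \<phi> x)" if "test_fun UNIV \<phi>" for \<phi>
    by (rule smooth_on_cong(1)[OF \<Omega> smooth_on_subset[OF smooth_on_zero]]) (use eq that in auto)
  show "eventually (\<lambda>\<phi>. \<forall>x\<in>K. f \<phi> x - g \<phi> x = 0) U" if "K \<subseteq> \<Omega>" for K
    using admissible_basic[OF U] by eventually_elim (use eq that in auto)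
qed

lemma test_fun_Emb_kernel:
  assumes "open \<Omega>" "test_fun UNIV \<phi>"
  shows "test_fun \<Omega> (\<lambda>t. Cut \<Omega> \<phi> t * \<phi> (x - t))"
  using Cut_smooth(2)[OF assms] by (intro test_fun_mult test_fun_reflect assms test_funD)

lemma Emb_cong:
  assumes "open \<Omega>" "test_fun UNIV \<phi>" "\<And>\<tau>. test_fun \<Omega> \<tau> \<Longrightarrow> T \<tau> = S \<tau>"
  shows "Emb \<Omega> T \<phi> x = Emb \<Omega> S \<phi> x"
  using assms(3)[OF test_fun_Emb_kernel[OF assms(1,2)]] by (simp add: Emb_def conv_def)

lemma Lemb_lincomb:
  assumes "loc_int \<Omega> f" "loc_int \<Omega> g" "test_fun \<Omega> \<tau>"
  shows "Lemb \<Omega> (\<lambda>x. a * f x + b * g x) \<tau> = a * Lemb \<Omega> f \<tau> + b * Lemb \<Omega> g \<tau>"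
proof -
  have i: "(\<lambda>x. f x * \<tau> x) integrable_on \<Omega>" "(\<lambda>x. g x * \<tau> x) integrable_on \<Omega>"
    using loc_int_mult_test[OF assms(1,3)] loc_int_mult_test[OF assms(2,3)]
    by (auto dest: absolutely_integrable_on_def[THEN iffD1])
  have "(\<lambda>x. (a * f x + b * g x) * \<tau> x) = (\<lambda>x. a * (f x * \<tau> x) + b * (g x * \<tau> x))"
    by (simp add: algebra_simps fun_eq_iff)
  then show ?thesis
    unfolding Lemb_def using i by (simp add: integral_add integrable_on_mult_right)
qed

lemma Emb_Lemb_lincomb:
  assumes "open \<Omega>" "admissible_U U" "loc_int \<Omega> f" "loc_int \<Omega> g"
  shows "fun_eq U \<Omega> (Emb \<Omega> (Lemb \<Omega> (\<lambda>x. a * f x + b * g x)))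
    (\<lambda>\<phi> x. a * Emb \<Omega> (Lemb \<Omega> f) \<phi> x + b * Emb \<Omega> (Lemb \<Omega> g) \<phi> x)"
  using test_fun_Emb_kernel[OF assms(1)]
  by (intro fun_eq_if_eq[OF assms(1,2)]) (simp add: Emb_def conv_def Lemb_lincomb[OF assms(3,4)])

text \<open>Writing E for the embedding of functions, E f E g - f g = (E f - f) E g + (E g - g) f.
  Each summand is a negligible net times a moderate one, and E (f g) - f g is negligible as
  well.\<close>

lemma Emb_Lemb_mult:
  assumes \<Omega>: "open \<Omega>" and U: "admissible_U U" and f: "smooth_on \<Omega> f" and g: "smooth_on \<Omega> g"
  shows "fun_eq U \<Omega> (Emb \<Omega> (Lemb \<Omega> (\<lambda>x. f x * g x)))
    (\<lambda>\<phi> x. Emb \<Omega> (Lemb \<Omega> f) \<phi> x * Emb \<Omega> (Lemb \<Omega> g) \<phi> x)"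
proof -
  let ?E = "\<lambda>f. Emb \<Omega> (Lemb \<Omega> f)"
  note nf = Emb_smooth_fun[OF \<Omega> U f] and ng = Emb_smooth_fun[OF \<Omega> U g]
    and nfg = Emb_smooth_fun[OF \<Omega> U smooth_on_mult(1)[OF \<Omega> f g]]
  have "wnegl U \<Omega> (\<lambda>\<phi> x. (?E f \<phi> x - f x) * ?E g \<phi> x)"
    by (rule wnegl_mult[OF \<Omega> U nf wmod_Emb[OF \<Omega> U wdist_Lemb[OF smooth_on_loc_int[OF g]]]])
  moreover have "wnegl U \<Omega> (\<lambda>\<phi> x. (?E g \<phi> x - g x) * f x)"
    using wnegl_mult[OF \<Omega> U ng wmod_sig[OF U f]] by (simp add: sig_def)
  ultimately have "wnegl U \<Omega> (\<lambda>\<phi> x. 1 * ((?E f \<phi> x - f x) * ?E g \<phi> x) + 1 * ((?E g \<phi> x - g x) * f x))"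
    by (rule wnegl_lincomb[OF \<Omega> U])
  from wnegl_lincomb[OF \<Omega> U nfg this, of 1 "-1"] show ?thesis
    by (intro fun_eq_if_wnegl) (simp add: algebra_simps)
qed

text \<open>With E for the embedding and D for the derivative, E (D f) - D (E f) is the difference
  of E (D f) - D f and D (E f - f), both negligible. This avoids integration by parts.\<close>

lemma Emb_Lemb_mpd:
  fixes f :: "'n::finite cfun"
  assumes \<Omega>: "open \<Omega>" and U: "admissible_U U" and f: "smooth_on \<Omega> f"
  shows "fun_eq U \<Omega> (Emb \<Omega> (Lemb \<Omega> (mpd \<alpha> f))) (\<lambda>\<phi>. mpd \<alpha> (Emb \<Omega> (Lemb \<Omega> f) \<phi>))"
proof (rule fun_eq_if_wnegl)
  let ?E = "\<lambda>f. Emb \<Omega> (Lemb \<Omega> f)" and ?d = "pds (mword \<alpha>) :: 'n cfun \<Rightarrow> _"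
  have n: "wnegl U \<Omega> (\<lambda>\<phi> x. 1 * (?E (?d f) \<phi> x - ?d f x) + (- 1) * ?d (\<lambda>x. ?E f \<phi> x - f x) x)"
    by (intro wnegl_lincomb[OF \<Omega> U] Emb_smooth_fun[OF \<Omega> U] wnegl_pds smooth_on_pds f)
  show "wnegl U \<Omega> (\<lambda>\<phi> x. ?E (mpd \<alpha> f) \<phi> x - mpd \<alpha> (?E f \<phi>) x)"
  proof (rule wnegl_cong[OF \<Omega> U n])
    fix \<phi> :: "'n cfun" and x assume \<phi>: "test_fun UNIV \<phi>" and x: "x \<in> \<Omega>"
    have E: "smooth_on \<Omega> (?E f \<phi>)"
      using Emb_smooth(1)[OF \<Omega> wdist_Lemb[OF smooth_on_loc_int[OF f]] \<phi>] by (rule smooth_on_subset) simp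
    show "1 * (?E (?d f) \<phi> x - ?d f x) + (- 1) * ?d (\<lambda>x. ?E f \<phi> x - f x) x
        = ?E (mpd \<alpha> f) \<phi> x - mpd \<alpha> (?E f \<phi>) x"
      unfolding smooth_on_diff(2)[OF \<Omega> E f x] mpd_mword by simp
  qed
qed

lemma fun_eq_pointwise:
  assumes "fun_eq U \<Omega> f g" "x \<in> \<Omega>"
  shows "eventually (\<lambda>\<phi>. norm (f \<phi> x - g \<phi> x) \<le> Rad \<phi>) U"
  using negl_fun_eventually[OF assms(1)[unfolded fun_eq_def], of "{x}"] assms(2) by simp

lemma sig_inject:
  assumes "admissible_U U" "fun_eq U \<Omega> (sig f) (sig g)" "x \<in> \<Omega>"
  shows "f x = g x"
proof -
  have "norm (f x - g x) \<le> 0"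
    using fun_eq_pointwise[OF assms(2,3)]
    by (intro admissible_le_0[OF assms(1), where C = 1]) (simp add: sig_def)
  then show ?thesis by simp
qed

text \<open>At each x the net is within \<open>Rad \<phi>\<close> of the function itself, so
  equality holds at every point of \<Omega>, which is stronger than equality almost
  everywhere.\<close>

lemma Emb_Lemb_smooth_inject:
  assumes \<Omega>: "open \<Omega>" and U: "admissible_U U" and f: "smooth_on \<Omega> f" and g: "smooth_on \<Omega> g"
    and eq: "fun_eq U \<Omega> (Emb \<Omega> (Lemb \<Omega> f)) (Emb \<Omega> (Lemb \<Omega> g))" and x: "x \<in> \<Omega>"
  shows "f x = g x"
proof -
  have near: "eventually (\<lambda>\<phi>. norm (Emb \<Omega> (Lemb \<Omega> k) \<phi> x - k x) \<le> Rad \<phi>) U" if "smooth_on \<Omega> k" for k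
    using wnegl_bound[OF Emb_smooth_fun[OF \<Omega> U that], of "{x}" "[]" 1] x by simp
  have "eventually (\<lambda>\<phi>. norm (f x - g x) \<le> 3 * Rad \<phi>) U"
    using near[OF f] near[OF g] fun_eq_pointwise[OF eq x]
  proof eventually_elim
    case (elim \<phi>)
    let ?E = "\<lambda>k. Emb \<Omega> (Lemb \<Omega> k) \<phi> x"
    have "norm (f x - g x) = norm ((?E f - ?E g) - (?E f - f x) + (?E g - g x))" by simp
    moreover have "norm ((?E f - ?E g) - (?E f - f x) + (?E g - g x))
        \<le> norm (?E f - ?E g) + norm (?E f - f x) + norm (?E g - g x)"
      by (rule order_trans[OF norm_triangle_ineq add_right_mono[OF norm_triangle_ineq4]])
    ultimately show ?case using elim by linarith
  qed
  then have "norm (f x - g x) \<le> 0" by (rule admissible_le_0[OF U])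
  then show ?thesis by simp
qed

text \<open>Near a compact set the cut-off is gone, so no Leibniz terms arise. The sign in
  \<open>dderiv\<close> then cancels the one produced by differentiating the reflected
  kernel.\<close>

lemma Emb_dderiv:
  assumes \<Omega>: "open \<Omega>" and U: "admissible_U U" and T: "wdist \<Omega> T"
  shows "fun_eq U \<Omega> (Emb \<Omega> (dderiv \<alpha> T)) (\<lambda>\<phi>. mpd \<alpha> (Emb \<Omega> T \<phi>))"
proof (rule fun_eq_if_wnegl, rule wnegl_if_eventually_zero[OF \<Omega> U])
  let ?d = "pds (mword \<alpha>)"
  have dT: "dderiv \<alpha> T = (\<lambda>\<tau>. (- 1) ^ mdeg \<alpha> * T (?d \<tau>))"
    by (simp add: dderiv_def[abs_def] mpd_mword)
  show "smooth_on \<Omega> (\<lambda>x. Emb \<Omega> (dderiv \<alpha> T) \<phi> x - mpd \<alpha> (Emb \<Omega> T \<phi>) x)" if "test_fun UNIV \<phi>" for \<phi>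
  proof (rule smooth_on_subset[OF smooth_on_diff(1)[OF open_UNIV]])
    show "smooth_on UNIV (Emb \<Omega> (dderiv \<alpha> T) \<phi>)"
      unfolding dT by (rule Emb_smooth(1)[OF \<Omega> wdist_pds[OF T] that])
    show "smooth_on UNIV (mpd \<alpha> (Emb \<Omega> T \<phi>))"
      unfolding mpd_mword by (rule smooth_on_pds[OF Emb_smooth(1)[OF \<Omega> T that]])
  qed simp
  fix K assume K: "compact K" "K \<subseteq> \<Omega>"
  obtain L where
    ev: "eventually (\<lambda>\<phi>. \<forall>x\<in>K. \<forall>w. (\<lambda>t. Cut \<Omega> \<phi> t * pds w \<phi> (x - t)) = (\<lambda>t. pds w \<phi> (x - t)) \<and>
       test_fun \<Omega> (\<lambda>t. pds w \<phi> (x - t)) \<and> tsupp (\<lambda>t. pds w \<phi> (x - t)) \<subseteq> L) U"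
    by (rule Cut_local[OF \<Omega> U K])
  show "eventually (\<lambda>\<phi>. \<forall>x\<in>K. Emb \<Omega> (dderiv \<alpha> T) \<phi> x - mpd \<alpha> (Emb \<Omega> T \<phi>) x = 0) U"
    using ev admissible_basic[OF U]
  proof eventually_elim
    case (elim \<phi>)
    then have \<phi>: "test_fun UNIV \<phi>" by simp
    show ?case
    proof
      fix x assume x: "x \<in> K"
      let ?s = "(- 1) ^ mdeg \<alpha> :: complex"
      have k: "(\<lambda>t. Cut \<Omega> \<phi> t * \<phi> (x - t)) = (\<lambda>t. \<phi> (x - t))"
        using elim(1)[rule_format, OF x, of "[]"] by simp
      \<comment> \<open>The artificial zero summand brings the scalar multiple into the two-term
        form of \<open>wdist_linear\<close>.\<close>
      have d: "?d (\<lambda>t. \<phi> (x - t)) = (\<lambda>t. ?s * ?d \<phi> (x - t) + 0 * ?d \<phi> (x - t))"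
        by (simp add: fun_eq_iff smooth_on_reflect(2)[OF test_funD(1)[OF \<phi>]] length_mword)
      have t: "test_fun \<Omega> (\<lambda>t. ?d \<phi> (x - t))" using elim(1) x by blast
      have "Emb \<Omega> (dderiv \<alpha> T) \<phi> x = ?s * T (?d (\<lambda>t. \<phi> (x - t)))"
        by (simp add: Emb_def conv_def dT k)
      also have "\<dots> = (?s * ?s) * T (\<lambda>t. ?d \<phi> (x - t))"
        unfolding d wdist_linear[OF T t t] by simp
      also have "?s * ?s = 1" by (simp flip: power_mult_distrib)
      also have "1 * T (\<lambda>t. ?d \<phi> (x - t)) = mpd \<alpha> (Emb \<Omega> T \<phi>) x"
        unfolding mpd_mword Emb_smooth(2)[OF \<Omega> T \<phi>] using elim(1) x by simp
      finally show "Emb \<Omega> (dderiv \<alpha> T) \<phi> x - mpd \<alpha> (Emb \<Omega> T \<phi>) x = 0" by simp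
    qed
  qed
qed

lemma wdist_subset:
  assumes T: "wdist \<Omega> T" and V: "V \<subseteq> \<Omega>"
  shows "wdist V T"
  unfolding wdist_def
proof (intro conjI allI impI)
  show "T (\<lambda>x. a * \<tau>1 x + b * \<tau>2 x) = a * T \<tau>1 + b * T \<tau>2" if "test_fun V \<tau>1" "test_fun V \<tau>2" for \<tau>1 \<tau>2 a b
    by (rule wdist_linear[OF T test_fun_mono[OF that(1) V] test_fun_mono[OF that(2) V]])
  fix K assume "compact K" "K \<subseteq> V"
  with V have "\<exists>C\<ge>0. \<exists>m. \<forall>\<tau> B. test_fun \<Omega> \<tau> \<longrightarrow> tsupp \<tau> \<subseteq> K \<longrightarrow>
      (\<forall>w x. length w \<le> m \<longrightarrow> norm (pds w \<tau> x) \<le> B) \<longrightarrow> norm (T \<tau>) \<le> C * B"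
    by (intro wdist_bound[OF T]) auto
  then show "\<exists>C\<ge>0. \<exists>m. \<forall>\<tau> B. test_fun V \<tau> \<longrightarrow> tsupp \<tau> \<subseteq> K \<longrightarrow>
      (\<forall>w x. length w \<le> m \<longrightarrow> norm (pds w \<tau> x) \<le> B) \<longrightarrow> norm (T \<tau>) \<le> C * B"
    using test_fun_mono[OF _ V] by blast
qed

text \<open>On a compact subset of V both regularizations become T (\<phi> (x - \<cdot>)), in which
  the open set no longer occurs. The restricted distribution is the same functional T, evaluated on
  fewer test functions.\<close>

lemma Emb_restrict:
  assumes \<Omega>: "open \<Omega>" and U: "admissible_U U" and T: "wdist \<Omega> T" and V: "open V" "V \<subseteq> \<Omega>"
  shows "wnegl U V (\<lambda>\<phi> x. Emb \<Omega> T \<phi> x - Emb V T \<phi> x)"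
proof (rule wnegl_if_eventually_zero[OF V(1) U])
  show "smooth_on V (\<lambda>x. Emb \<Omega> T \<phi> x - Emb V T \<phi> x)" if "test_fun UNIV \<phi>" for \<phi>
    using smooth_on_diff(1)[OF open_UNIV Emb_smooth(1)[OF \<Omega> T that] Emb_smooth(1)[OF V(1) wdist_subset[OF T V(2)] that]]
    by (rule smooth_on_subset) simp
  fix K assume K: "compact K" "K \<subseteq> V"
  have K': "K \<subseteq> \<Omega>" using K V by blast
  have local: "eventually (\<lambda>\<phi>. \<forall>x\<in>K. Emb W T \<phi> x = T (\<lambda>t. \<phi> (x - t))) U" if W: "open W" "K \<subseteq> W" for W
  proof -
    obtain L where
      "eventually (\<lambda>\<phi>. \<forall>x\<in>K. \<forall>w. (\<lambda>t. Cut W \<phi> t * pds w \<phi> (x - t)) = (\<lambda>t. pds w \<phi> (x - t)) \<and>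
         test_fun W (\<lambda>t. pds w \<phi> (x - t)) \<and> tsupp (\<lambda>t. pds w \<phi> (x - t)) \<subseteq> L) U"
      by (rule Cut_local[OF W(1) U K(1) W(2)])
    then show ?thesis
    proof eventually_elim
      case (elim \<phi>)
      then have "(\<lambda>t. Cut W \<phi> t * pds [] \<phi> (x - t)) = (\<lambda>t. pds [] \<phi> (x - t))" if "x \<in> K" for x
        using that by blast
      then show ?case by (simp add: Emb_def conv_def)
    qed
  qed
  show "eventually (\<lambda>\<phi>. \<forall>x\<in>K. Emb \<Omega> T \<phi> x - Emb V T \<phi> x = 0) U"
    using local[OF \<Omega> K'] local[OF V(1) K(2)] by eventually_elim simp
qed

lemma Emb_Lemb_restrict:
  assumes \<Omega>: "open \<Omega>" and U: "admissible_U U" and g: "loc_int \<Omega> g" and V: "open V" "V \<subseteq> \<Omega>"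
  shows "fun_eq U V (Emb \<Omega> (Lemb \<Omega> g)) (Emb V (Lemb V g))"
proof -
  note w = wdist_Lemb[OF g]
  have L: "Lemb \<Omega> g \<tau> = Lemb V g \<tau>" if "test_fun V \<tau>" for \<tau>
    unfolding Lemb_def using test_funD(3)[OF that] tsupp_outside[of _ \<tau>]
    by (intro integral_zero_outside(1)[OF V(2)]) auto
  have eq: "Emb V (Lemb \<Omega> g) \<phi> x = Emb V (Lemb V g) \<phi> x" if "test_fun UNIV \<phi>" for \<phi> x
    by (rule Emb_cong[OF V(1) that L])
  have "wnegl U V (\<lambda>\<phi> x. Emb \<Omega> (Lemb \<Omega> g) \<phi> x - Emb V (Lemb V g) \<phi> x)"
    by (rule wnegl_cong[OF V(1) U Emb_restrict[OF \<Omega> U w V]]) (simp add: eq)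
  then show ?thesis by (rule fun_eq_if_wnegl)
qed

lemma Emb_Lemb_inject:
  fixes f g :: "'n::finite cfun"
  assumes \<Omega>: "open \<Omega>" and U: "admissible_U U" and f: "loc_int \<Omega> f" and g: "loc_int \<Omega> g"
    and eq: "fun_eq U \<Omega> (Emb \<Omega> (Lemb \<Omega> f)) (Emb \<Omega> (Lemb \<Omega> g))"
  shows "negligible {x \<in> \<Omega>. f x \<noteq> g x}"
proof -
  let ?h = "\<lambda>x. f x - g x"
  have h: "loc_int \<Omega> ?h"
    using f g unfolding loc_int_def by (auto intro: set_integral_diff(1))
  have zero: "integral \<Omega> (\<lambda>x. ?h x * \<tau> x) = 0" if "test_fun \<Omega> \<tau>" for \<tau>
    using Emb_inject[OF \<Omega> U wdist_Lemb[OF f] wdist_Lemb[OF g] eq that] Lemb_lincomb[OF f g that, of 1 "-1"]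
    by (simp add: Lemb_def)
  \<comment> \<open>Mollifiers exist because each \<open>Dn n\<close> belongs to the proper filter
    U.\<close>
  have Dn: "\<exists>\<phi>. \<phi> \<in> (Dn n :: 'n cfun set)" if "n \<ge> 1" for n
    using eventually_happens'[OF _ admissible_eventually[OF U that]] U by (auto simp: admissible_U_def)
  have "negligible {x \<in> \<Omega>. ?h x \<noteq> 0}"
    by (rule negligible_if_compact_integrals_vanish[OF \<Omega> h integral_compact_vanishing[OF \<Omega> h Dn zero]])
  then show ?thesis by simp
qed

text \<open>Classes are represented by nets, and equality of classes by \<open>fun_eq\<close> and
  \<open>negl_num\<close>. The isomorphism of differential algebras is expressed as compatibility
  with linear combinations, products and derivatives together with injectivity; restriction to V
  means comparing the same nets on V.\<close>

theorem theorem5p3: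
  fixes U :: "('n::finite cfun) filter" and \<Omega> :: "(real^'n) set"
  assumes hU: "admissible_U U" and hO: "open \<Omega>"
  shows
   "\<comment> \<open>(i)\<close>
    (\<forall>f. smooth_on \<Omega> f \<longrightarrow> mod_fun U \<Omega> (sig f) \<and>
        fun_eq U \<Omega> (Emb \<Omega> (Lemb \<Omega> f)) (sig f)) \<and>
    (\<forall>f g a b. smooth_on \<Omega> f \<and> smooth_on \<Omega> g \<longrightarrow>
        fun_eq U \<Omega> (sig (\<lambda>x. a * f x + b * g x)) (\<lambda>\<phi> x. a * sig f \<phi> x + b * sig g \<phi> x) \<and>
        fun_eq U \<Omega> (sig (\<lambda>x. f x * g x)) (\<lambda>\<phi> x. sig f \<phi> x * sig g \<phi> x) \<and>
        fun_eq U \<Omega> (Emb \<Omega> (Lemb \<Omega> (\<lambda>x. a * f x + b * g x)))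
          (\<lambda>\<phi> x. a * Emb \<Omega> (Lemb \<Omega> f) \<phi> x + b * Emb \<Omega> (Lemb \<Omega> g) \<phi> x) \<and>
        fun_eq U \<Omega> (Emb \<Omega> (Lemb \<Omega> (\<lambda>x. f x * g x)))
          (\<lambda>\<phi> x. Emb \<Omega> (Lemb \<Omega> f) \<phi> x * Emb \<Omega> (Lemb \<Omega> g) \<phi> x)) \<and>
    (\<forall>f \<alpha>. smooth_on \<Omega> f \<longrightarrow>
        fun_eq U \<Omega> (sig (mpd \<alpha> f)) (\<lambda>\<phi>. mpd \<alpha> (sig f \<phi>)) \<and>
        fun_eq U \<Omega> (Emb \<Omega> (Lemb \<Omega> (mpd \<alpha> f))) (\<lambda>\<phi>. mpd \<alpha> (Emb \<Omega> (Lemb \<Omega> f) \<phi>))) \<and>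
    (\<forall>f \<tau>. smooth_on \<Omega> f \<and> test_fun \<Omega> \<tau> \<longrightarrow>
        negl_num U (\<lambda>\<phi>. integral \<Omega> (\<lambda>x. f x * \<tau> x) - pairing \<Omega> (sig f) \<tau> \<phi>) \<and>
        negl_num U (\<lambda>\<phi>. pairing \<Omega> (sig f) \<tau> \<phi> - pairing \<Omega> (Emb \<Omega> (Lemb \<Omega> f)) \<tau> \<phi>)) \<and>
    (\<forall>f g. smooth_on \<Omega> f \<and> smooth_on \<Omega> g \<and> fun_eq U \<Omega> (sig f) (sig g) \<longrightarrow> (\<forall>x\<in>\<Omega>. f x = g x)) \<and>
    (\<forall>f g. smooth_on \<Omega> f \<and> smooth_on \<Omega> g \<and>
        fun_eq U \<Omega> (Emb \<Omega> (Lemb \<Omega> f)) (Emb \<Omega> (Lemb \<Omega> g)) \<longrightarrow> (\<forall>x\<in>\<Omega>. f x = g x)) \<and>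
    \<comment> \<open>(ii)\<close>
    (\<forall>T. distribution \<Omega> T \<longrightarrow> mod_fun U \<Omega> (Emb \<Omega> T)) \<and>
    (\<forall>T S a b. distribution \<Omega> T \<and> distribution \<Omega> S \<longrightarrow>
        fun_eq U \<Omega> (Emb \<Omega> (\<lambda>\<tau>. a * T \<tau> + b * S \<tau>)) (\<lambda>\<phi> x. a * Emb \<Omega> T \<phi> x + b * Emb \<Omega> S \<phi> x)) \<and>
    (\<forall>T \<alpha>. distribution \<Omega> T \<longrightarrow>
        fun_eq U \<Omega> (Emb \<Omega> (dderiv \<alpha> T)) (\<lambda>\<phi>. mpd \<alpha> (Emb \<Omega> T \<phi>))) \<and>
    (\<forall>T \<tau>. distribution \<Omega> T \<and> test_fun \<Omega> \<tau> \<longrightarrow>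
        negl_num U (\<lambda>\<phi>. T \<tau> - pairing \<Omega> (Emb \<Omega> T) \<tau> \<phi>)) \<and>
    (\<forall>T S. distribution \<Omega> T \<and> distribution \<Omega> S \<and> fun_eq U \<Omega> (Emb \<Omega> T) (Emb \<Omega> S) \<longrightarrow>
        (\<forall>\<tau>. test_fun \<Omega> \<tau> \<longrightarrow> T \<tau> = S \<tau>)) \<and>
    \<comment> \<open>(iii)\<close>
    (\<forall>f g a b. loc_int \<Omega> f \<and> loc_int \<Omega> g \<longrightarrow>
        fun_eq U \<Omega> (Emb \<Omega> (Lemb \<Omega> (\<lambda>x. a * f x + b * g x)))
          (\<lambda>\<phi> x. a * Emb \<Omega> (Lemb \<Omega> f) \<phi> x + b * Emb \<Omega> (Lemb \<Omega> g) \<phi> x)) \<and>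
    (\<forall>f \<tau>. loc_int \<Omega> f \<and> test_fun \<Omega> \<tau> \<longrightarrow>
        negl_num U (\<lambda>\<phi>. integral \<Omega> (\<lambda>x. f x * \<tau> x) - pairing \<Omega> (Emb \<Omega> (Lemb \<Omega> f)) \<tau> \<phi>)) \<and>
    (\<forall>f g. loc_int \<Omega> f \<and> loc_int \<Omega> g \<and>
        fun_eq U \<Omega> (Emb \<Omega> (Lemb \<Omega> f)) (Emb \<Omega> (Lemb \<Omega> g)) \<longrightarrow> negligible {x\<in>\<Omega>. f x \<noteq> g x}) \<and>
    \<comment> \<open>(iv)\<close>
    (\<forall>V. open V \<and> V \<subseteq> \<Omega> \<longrightarrow>
        (\<forall>f. smooth_on \<Omega> f \<longrightarrow> fun_eq U V (sig f) (sig f)) \<and>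
        (\<forall>T. distribution \<Omega> T \<longrightarrow> fun_eq U V (Emb \<Omega> T) (Emb V T)) \<and>
        (\<forall>g. loc_int \<Omega> g \<longrightarrow> fun_eq U V (Emb \<Omega> (Lemb \<Omega> g)) (Emb V (Lemb V g))))"
proof -
  note ev = fun_eq_if_eq[OF hO hU]
  have 1: "mod_fun U \<Omega> (sig f)" "fun_eq U \<Omega> (Emb \<Omega> (Lemb \<Omega> f)) (sig f)" if "smooth_on \<Omega> f" for f
    using wmod_imp_mod_fun[OF wmod_sig[OF hU that]] fun_eq_if_wnegl[of U \<Omega> _ "sig f"] Emb_smooth_fun[OF hO hU that]
    by (simp_all add: sig_def)
  have 2: "negl_num U (\<lambda>\<phi>. integral \<Omega> (\<lambda>x. f x * \<tau> x) - pairing \<Omega> (Emb \<Omega> (Lemb \<Omega> f)) \<tau> \<phi>)"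
    if "loc_int \<Omega> f" "test_fun \<Omega> \<tau>" for f \<tau>
    using Emb_pairing[OF hO hU wdist_Lemb[OF that(1)] that(2)] by (simp add: Lemb_def)
  \<comment> \<open>The bound in \<open>negl_num\<close> is strict, so even the zero net relies on
    the positivity of \<open>Rad \<phi>\<close>.\<close>
  have 3: "negl_num U (\<lambda>\<phi>. 0)"
    unfolding negl_num_def using admissible_basic[OF hU] by (auto elim!: eventually_mono)
  have 4: "pairing \<Omega> (sig f) \<tau> \<phi> = integral \<Omega> (\<lambda>x. f x * \<tau> x)" for f \<tau> and \<phi> :: "'n cfun"
    by (simp add: pairing_def sig_def)
  show ?thesis
    apply (intro conjI allI impI ballI; (elim conjE)?)
    subgoal by (rule 1)
    subgoal by (rule 1)
    subgoal by (rule ev) (simp add: sig_def)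
    subgoal by (rule ev) (simp add: sig_def)
    subgoal by (intro Emb_Lemb_lincomb hO hU smooth_on_loc_int)
    subgoal by (rule Emb_Lemb_mult[OF hO hU])
    subgoal by (rule ev) (simp add: sig_def)
    subgoal by (rule Emb_Lemb_mpd[OF hO hU])
    subgoal using 3 by (simp add: 4)
    subgoal using 2 by (simp add: 4 smooth_on_loc_int)
    subgoal by (rule sig_inject[OF hU])
    subgoal by (rule Emb_Lemb_smooth_inject[OF hO hU])
    subgoal by (intro wmod_imp_mod_fun wmod_Emb hO hU distribution_imp_wdist)
    subgoal by (rule ev) (simp add: Emb_def conv_def)
    subgoal by (intro Emb_dderiv hO hU distribution_imp_wdist)
    subgoal by (intro Emb_pairing hO hU distribution_imp_wdist)
    subgoal by (rule Emb_inject[OF hO hU distribution_imp_wdist distribution_imp_wdist])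
    subgoal by (intro Emb_Lemb_lincomb hO hU)
    subgoal by (rule 2)
    subgoal by (rule Emb_Lemb_inject[OF hO hU])
    subgoal by (rule fun_eq_if_eq[OF _ hU]) simp_all
    subgoal by (intro fun_eq_if_wnegl Emb_restrict hO hU distribution_imp_wdist)
    subgoal by (rule Emb_Lemb_restrict[OF hO hU])
    done
qed

end
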